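(* Let $\mathbf{k}$ be a unitary commutative ring, $\Omega$ a nonempty set, $(F,\kappa_\Omega)$, $\kappa_\Omega=(\kappa_\omega)_{\omega\in\Omega}$, a commutative matching Rota-Baxter algebra of weight zero, and $A=\mathbf{k}\oplus A^+$ a commutative augmented algebra. Let $\mathrm{Sha}_{\Omega,F}(A)$, with its product $\diamond$, its operators $P_{\Omega,F,A}=(P_\omega)_{\omega\in\Omega}$ and the natural embeddings $i:F\to\mathrm{Sha}_{\Omega,F}(A)$ and $j_A:A\to\mathrm{Sha}_{\Omega,F}(A)$, be as defined in the context. Then the triple $(\mathrm{Sha}_{\Omega,F}(A),\diamond,P_{\Omega,F,A})$, together with the maps $i$ and $j_A$, is the free commutative $(F,\kappa_\Omega)$-matching Rota-Baxter algebra on $A$. That is, with structure map $i$ it is a commutative $(F,\kappa_\Omega)$-matching Rota-Baxter algebra (of weight zero), $j_A$ is an algebra homomorphism, and for every commutative $(F,\kappa_\Omega)$-matching Rota-Baxter algebra $(R,P_{\Omega,R})$ and every algebra homomorphism $f:A\to R$ there is a unique homomorphism of $(F,\kappa_\Omega)$-matching Rota-Baxter algebras $\bar f:\mathrm{Sha}_{\Omega,F}(A)\to R$ such that $f=\bar f\,j_A$.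
   Context: All modules, algebras, tensor products and linear maps are over a unitary commutative ring $\mathbf{k}$. An algebra is an associative unitary $\mathbf{k}$-algebra; algebra homomorphisms preserve the unit. Linear operators such as $\kappa_\omega,P_\omega$ are $\mathbf{k}$-linear (not assumed $F$-linear). Matching Rota-Baxter algebra of weight zero (indexed by $\Omega$): a pair $(R,(P_\omega)_{\omega\in\Omega})$ of an algebra $R$ and linear operators $P_\omega:R\to R$ such that $P_\alpha(x)P_\beta(y)=P_\alpha(xP_\beta(y))+P_\beta(P_\alpha(x)y)$ for all $x,y\in R$, $\alpha,\beta\in\Omega$. It is commutative if $R$ is. A homomorphism $(R,(P_\omega))\to(R',(P'_\omega))$ is an algebra homomorphism $f$ with $fP_\omega=P'_\omega f$ for all $\omega\in\Omega$. An $(F,\kappa_\Omega)$-matching Rota-Baxter algebra is a matching Rota-Baxter algebra $(R,P_{\Omega,R})$, $P_{\Omega,R}=(P_{\omega,R})_{\omega\in\Omega}$, of weight zero together with a matching Rota-Baxter algebra homomorphism $i_R:(F,\kappa_\Omega)\to(R,P_{\Omega,R})$ (its structure map, making $R$ an $F$-algebra). A homomorphism $(R,P_{\Omega,R})\to(R',P'_{\Omega,R'})$ of such objects is an $F$-algebra homomorphism $f:R\to R'$ (i.e. an algebra homomorphism with $f\,i_R=i_{R'}$) such that $fP_{\omega,R}=P'_{\omega,R'}f$ for all $\omega\in\Omega$. Augmented algebra: $A=\mathbf{k}\oplus A^+$ is the unitization of a (not necessarily unitary) algebra $A^+$. Shuffle product algebra: for a $\mathbf{k}$-module $V$, $\mathrm{Sh}(V)$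 is the module $\bigoplus_{k\ge 0}V^{\otimes k}$ ($V^{\otimes 0}=\mathbf{k}$) with the bilinear shuffle product $\sqcup\!\sqcup$ with unit $1\in\mathbf{k}$, defined recursively, for $\mathfrak a=a_1\otimes\mathfrak a'\in V^{\otimes m}$, $\mathfrak b=b_1\otimes \mathfrak b'\in V^{\otimes n}$, $m,n\ge1$, $\mathfrak a'\in V^{\otimes(m-1)}$, $\mathfrak b'\in V^{\otimes(n-1)}$, by $\mathfrak a\sqcup\!\sqcup\mathfrak b=a_1\otimes(\mathfrak a'\sqcup\!\sqcup\mathfrak b)+b_1\otimes(\mathfrak a\sqcup\!\sqcup\mathfrak b')$, where $\mathfrak a'$ (resp. $\mathfrak b'$) is $1\in\mathbf{k}$ (up to a scalar absorbed in $a_1$, resp. $b_1$) if $m=1$ (resp. $n=1$). Construction: put $\mathfrak A:=F\otimes A$ (tensor product algebra) and $\mathfrak A^+:=F\otimes A^+$, so $\mathfrak A=F\oplus\mathfrak A^+$, where $F$ is identified with $F\otimes\mathbf{k}$. Let $\mathbf{k}\Omega$ be the free $\mathbf{k}$-module on $\Omega$. Then $$\mathrm{Sha}_{\Omega,F}(A):=\mathfrak A\otimes\mathrm{Sh}(\mathbf{k}\Omega\otimes\mathfrak A^+)=\bigoplus_{k\ge0}\mathfrak A\otimes(\mathbf{k}\Omega\otimes\mathfrak A^+)^{\otimes k}$$ is the tensor product algebra, with product $(u_0\otimes\bar{\mathfrak u})\diamond(v_0\otimes\bar{\mathfrak v})=u_0v_0\otimes(\bar{\mathfrak u}\sqcup\!\sqcup\bar{\mathfrak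 v})$. For $\omega\in\Omega$, the linear operator $P_\omega$ on $\mathrm{Sha}_{\Omega,F}(A)$ is defined on a pure tensor $\mathfrak u=u_0\otimes(\omega_1\otimes u_1)\otimes\cdots\otimes(\omega_n\otimes u_n)$, with $u_0\in F$ or $u_0\in\mathfrak A^+$, $u_1,\dots,u_n\in\mathfrak A^+$, $\omega_1,\dots,\omega_n\in\Omega$, $n\ge 0$, by: - if $u_0\in F$ and $n=0$: $P_\omega(\mathfrak u)=\kappa_\omega(u_0)$; - if $u_0\in F$ and $n\ge1$: $P_\omega(\mathfrak u)=\kappa_\omega(u_0)\otimes(\omega_1\otimes u_1)\otimes(\omega_2\otimes u_2)\otimes\cdots\otimes(\omega_n\otimes u_n)-1\otimes(\omega_1\otimes\kappa_\omega(u_0)u_1)\otimes(\omega_2\otimes u_2)\otimes\cdots\otimes(\omega_n\otimes u_n)$; - if $u_0\in\mathfrak A^+$: $P_\omega(\mathfrak u)=1\otimes(\omega\otimes u_0)\otimes(\omega_1\otimes u_1)\otimes\cdots\otimes(\omega_n\otimes u_n)$. The maps $i:F\hookrightarrow\mathfrak A\subseteq\mathrm{Sha}_{\Omega,F}(A)$ and $j_A:A\hookrightarrow\mathfrak A\subseteq\mathrm{Sha}_{\Omega,F}(A)$ are the natural ones, $c\mapsto c\otimes 1_A$ and $a\mapsto 1_F\otimes a$, with $\mathfrak A$ embedded as the $k=0$ summand. *)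

theory Defs
  imports "HOL-Algebra.QuotRing" "HOL-Algebra.Module"
begin

section \<open>Algebras and linear maps over a commutative ring\<close>

text \<open>The library locale \<^locale>\<open>algebra\<close> describes associative, commutative, unitary algebras.
  A record is used for non-unitary algebras and for plain modules as well; the fields
  \<open>one\<close> (and \<open>mult\<close>, for modules) then carry no information.\<close>

definition linear_maps :: "'k ring \<Rightarrow> ('k, 'm) module \<Rightarrow> ('k, 'n) module \<Rightarrow> ('m \<Rightarrow> 'n) set" where
  "linear_maps K M N = {h \<in> carrier M \<rightarrow> carrier N.
     (\<forall>x\<in>carrier M. \<forall>y\<in>carrier M. h (x \<oplus>\<^bsub>M\<^esub> y) = h x \<oplus>\<^bsub>N\<^esub> h y) \<and>
     (\<forall>a\<in>carrier K. \<forall>x\<in>carrier M. h (a \<odot>\<^bsub>M\<^esub> x) = a \<odot>\<^bsub>N\<^esub> h x)}"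

definition algebra_homs :: "'k ring \<Rightarrow> ('k, 'm) module \<Rightarrow> ('k, 'n) module \<Rightarrow> ('m \<Rightarrow> 'n) set" where
  "algebra_homs K M N = ring_hom M N \<inter> linear_maps K M N"

locale nonunital_comm_algebra = module K B
  for K :: "'k ring" and B :: "('k, 'b) module" (structure) +
  assumes m_closed: "\<lbrakk>x \<in> carrier B; y \<in> carrier B\<rbrakk> \<Longrightarrow> x \<otimes> y \<in> carrier B"
    and m_assoc: "\<lbrakk>x \<in> carrier B; y \<in> carrier B; z \<in> carrier B\<rbrakk> \<Longrightarrow> (x \<otimes> y) \<otimes> z = x \<otimes> (y \<otimes> z)"
    and m_comm: "\<lbrakk>x \<in> carrier B; y \<in> carrier B\<rbrakk> \<Longrightarrow> x \<otimes> y = y \<otimes> x"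
    and l_distr: "\<lbrakk>x \<in> carrier B; y \<in> carrier B; z \<in> carrier B\<rbrakk> \<Longrightarrow> (x \<oplus> y) \<otimes> z = x \<otimes> z \<oplus> y \<otimes> z"
    and smult_assoc2: "\<lbrakk>a \<in> carrier K; x \<in> carrier B; y \<in> carrier B\<rbrakk> \<Longrightarrow> (a \<odot> x) \<otimes> y = a \<odot> (x \<otimes> y)"

text \<open>The augmented algebra \<open>\<k> \<oplus> B\<close> with augmentation ideal \<open>B\<close>.\<close>

definition unitization :: "'k ring \<Rightarrow> ('k, 'b) module \<Rightarrow> ('k, 'k \<times> 'b) module" where
  "unitization K B =
     \<lparr>carrier = carrier K \<times> carrier B,
      mult = (\<lambda>(a, x) (b, y). (a \<otimes>\<^bsub>K\<^esub> b, a \<odot>\<^bsub>B\<^esub> y \<oplus>\<^bsub>B\<^esub> b \<odot>\<^bsub>B\<^esub> x \<oplus>\<^bsub>B\<^esub> x \<otimes>\<^bsub>B\<^esub> y)),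
      one = (\<one>\<^bsub>K\<^esub>, \<zero>\<^bsub>B\<^esub>),
      zero = (\<zero>\<^bsub>K\<^esub>, \<zero>\<^bsub>B\<^esub>),
      add = (\<lambda>(a, x) (b, y). (a \<oplus>\<^bsub>K\<^esub> b, x \<oplus>\<^bsub>B\<^esub> y)),
      smult = (\<lambda>c (a, x). (c \<otimes>\<^bsub>K\<^esub> a, c \<odot>\<^bsub>B\<^esub> x))\<rparr>"


section \<open>Matching Rota-Baxter algebras of weight zero\<close>

locale comm_matching_RBA = algebra K R
  for K :: "'k ring" and \<Omega> :: "'w set" and R :: "('k, 'r) module" (structure)
    and P :: "'w \<Rightarrow> 'r \<Rightarrow> 'r" +
  assumes P_linear: "\<omega> \<in> \<Omega> \<Longrightarrow> P \<omega> \<in> linear_maps K R R"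
    and Rota_Baxter: "\<lbrakk>\<alpha> \<in> \<Omega>; \<beta> \<in> \<Omega>; x \<in> carrier R; y \<in> carrier R\<rbrakk> \<Longrightarrow>
      P \<alpha> x \<otimes> P \<beta> y = P \<alpha> (x \<otimes> P \<beta> y) \<oplus> P \<beta> (P \<alpha> x \<otimes> y)"

definition matching_RBA_homs ::
  "'k ring \<Rightarrow> 'w set \<Rightarrow> ('k, 'r) module \<Rightarrow> ('w \<Rightarrow> 'r \<Rightarrow> 'r) \<Rightarrow>
    ('k, 's) module \<Rightarrow> ('w \<Rightarrow> 's \<Rightarrow> 's) \<Rightarrow> ('r \<Rightarrow> 's) set" where
  "matching_RBA_homs K \<Omega> R P S Q =
     {h \<in> algebra_homs K R S. \<forall>\<omega>\<in>\<Omega>. \<forall>x\<in>carrier R. h (P \<omega> x) = Q \<omega> (h x)}"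

text \<open>Commutative \<open>(F, \<kappa>\<^sub>\<Omega>)\<close>-matching Rota-Baxter algebras; \<open>\<iota>\<close> is the structure map.\<close>

locale comm_rel_matching_RBA =
  F: comm_matching_RBA K \<Omega> F \<kappa> + R: comm_matching_RBA K \<Omega> R P
  for K :: "'k ring" and \<Omega> :: "'w set"
    and F :: "('k, 'f) module" and \<kappa> :: "'w \<Rightarrow> 'f \<Rightarrow> 'f"
    and R :: "('k, 'r) module" and P :: "'w \<Rightarrow> 'r \<Rightarrow> 'r" and \<iota> :: "'f \<Rightarrow> 'r" +
  assumes structure_map: "\<iota> \<in> matching_RBA_homs K \<Omega> F \<kappa> R P"

definition rel_matching_RBA_homs ::
  "'k ring \<Rightarrow> 'w set \<Rightarrow> ('k, 'f) module \<Rightarrow>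
    ('k, 'r) module \<Rightarrow> ('w \<Rightarrow> 'r \<Rightarrow> 'r) \<Rightarrow> ('f \<Rightarrow> 'r) \<Rightarrow>
    ('k, 's) module \<Rightarrow> ('w \<Rightarrow> 's \<Rightarrow> 's) \<Rightarrow> ('f \<Rightarrow> 's) \<Rightarrow> ('r \<Rightarrow> 's) set" where
  "rel_matching_RBA_homs K \<Omega> F R P \<iota> S Q \<iota>' =
     {h \<in> matching_RBA_homs K \<Omega> R P S Q. \<forall>c\<in>carrier F. h (\<iota> c) = \<iota>' c}"


section \<open>Free modules and quotient modules\<close>

definition free_module :: "'k ring \<Rightarrow> 'x set \<Rightarrow> ('k, 'x \<Rightarrow> 'k) module" where
  "free_module K X =
     \<lparr>carrier = {p. range p \<subseteq> carrier K \<and> finite {x. p x \<noteq> \<zero>\<^bsub>K\<^esub>} \<and> {x. p x \<noteq> \<zero>\<^bsub>K\<^esub>} \<subseteq> X},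
      mult = undefined,
      one = undefined,
      zero = (\<lambda>x. \<zero>\<^bsub>K\<^esub>),
      add = (\<lambda>p q x. p x \<oplus>\<^bsub>K\<^esub> q x),
      smult = (\<lambda>a p x. a \<otimes>\<^bsub>K\<^esub> p x)\<rparr>"

definition basis_elt :: "'k ring \<Rightarrow> 'x \<Rightarrow> 'x \<Rightarrow> 'k" where
  "basis_elt K x = (\<lambda>y. if y = x then \<one>\<^bsub>K\<^esub> else \<zero>\<^bsub>K\<^esub>)"

text \<open>Linear extension of a map \<open>g\<close>, defined on a basis, to the free module.\<close>

definition lin_ext :: "'k ring \<Rightarrow> ('k, 'm) module \<Rightarrow> ('x \<Rightarrow> 'm) \<Rightarrow> ('x \<Rightarrow> 'k) \<Rightarrow> 'm" where
  "lin_ext K M g p = finsum M (\<lambda>x. p x \<odot>\<^bsub>M\<^esub> g x) {x. p x \<noteq> \<zero>\<^bsub>K\<^esub>}"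

text \<open>The free module on \<open>X\<close> with the bilinear product that is given by \<open>m\<close> on the basis.\<close>

definition free_algebra ::
  "'k ring \<Rightarrow> 'x set \<Rightarrow> ('x \<Rightarrow> 'x \<Rightarrow> ('x \<Rightarrow> 'k)) \<Rightarrow> ('x \<Rightarrow> 'k) \<Rightarrow> ('k, 'x \<Rightarrow> 'k) module" where
  "free_algebra K X m e = (free_module K X)
     \<lparr>mult := (\<lambda>p q. lin_ext K (free_module K X) (\<lambda>x. lin_ext K (free_module K X) (m x) q) p),
      one := e\<rparr>"

definition submodule_span :: "'k ring \<Rightarrow> ('k, 'm) module \<Rightarrow> 'm set \<Rightarrow> 'm set" where
  "submodule_span K M S = \<Inter>{H. submodule H K M \<and> S \<subseteq> H}"

definition quot_module :: "('k, 'm) module \<Rightarrow> 'm set \<Rightarrow> ('k, 'm set) module" where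
  "quot_module M N =
     ring.extend (M Quot N) (module.fields (\<lambda>a X. \<Union>x\<in>X. N +>\<^bsub>M\<^esub> (a \<odot>\<^bsub>M\<^esub> x)))"


section \<open>Tensor products\<close>

definition bilinear_relations ::
  "'k ring \<Rightarrow> ('k, 'm) module \<Rightarrow> ('k, 'n) module \<Rightarrow> ('m \<times> 'n \<Rightarrow> 'k) set" where
  "bilinear_relations K M N =
     (let L = free_module K (carrier M \<times> carrier N); d = basis_elt K in
       {d (x \<oplus>\<^bsub>M\<^esub> x', y) \<ominus>\<^bsub>L\<^esub> (d (x, y) \<oplus>\<^bsub>L\<^esub> d (x', y)) | x x' y.
          x \<in> carrier M \<and> x' \<in> carrier M \<and> y \<in> carrier N} \<union>
       {d (x, y \<oplus>\<^bsub>N\<^esub> y') \<ominus>\<^bsub>L\<^esub> (d (x, y) \<oplus>\<^bsub>L\<^esub> d (x, y')) | x y y'.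
          x \<in> carrier M \<and> y \<in> carrier N \<and> y' \<in> carrier N} \<union>
       {d (a \<odot>\<^bsub>M\<^esub> x, y) \<ominus>\<^bsub>L\<^esub> a \<odot>\<^bsub>L\<^esub> d (x, y) | a x y.
          a \<in> carrier K \<and> x \<in> carrier M \<and> y \<in> carrier N} \<union>
       {d (x, a \<odot>\<^bsub>N\<^esub> y) \<ominus>\<^bsub>L\<^esub> a \<odot>\<^bsub>L\<^esub> d (x, y) | a x y.
          a \<in> carrier K \<and> x \<in> carrier M \<and> y \<in> carrier N})"

definition tensor_kernel ::
  "'k ring \<Rightarrow> ('k, 'm) module \<Rightarrow> ('k, 'n) module \<Rightarrow> ('m \<times> 'n \<Rightarrow> 'k) set" where
  "tensor_kernel K M N =
     submodule_span K (free_module K (carrier M \<times> carrier N)) (bilinear_relations K M N)"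

text \<open>If \<open>M\<close> and \<open>N\<close> are algebras, this is the tensor product algebra, with
  \<open>(x \<otimes> y) (x' \<otimes> y') = x x' \<otimes> y y'\<close>.\<close>

definition tensor ::
  "'k ring \<Rightarrow> ('k, 'm) module \<Rightarrow> ('k, 'n) module \<Rightarrow> ('k, ('m \<times> 'n \<Rightarrow> 'k) set) module" where
  "tensor K M N =
     quot_module
       (free_algebra K (carrier M \<times> carrier N)
         (\<lambda>(x, y) (x', y'). basis_elt K (x \<otimes>\<^bsub>M\<^esub> x', y \<otimes>\<^bsub>N\<^esub> y'))
         (basis_elt K (\<one>\<^bsub>M\<^esub>, \<one>\<^bsub>N\<^esub>)))
       (tensor_kernel K M N)"

definition pure_tensor ::
  "'k ring \<Rightarrow> ('k, 'm) module \<Rightarrow> ('k, 'n) module \<Rightarrow> 'm \<Rightarrow> 'n \<Rightarrow> ('m \<times> 'n \<Rightarrow> 'k) set" where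
  "pure_tensor K M N x y =
     tensor_kernel K M N +>\<^bsub>free_module K (carrier M \<times> carrier N)\<^esub> basis_elt K (x, y)"

text \<open>The map \<open>f \<otimes> g\<close> into the tensor product of \<open>M\<close> and \<open>N\<close>, for linear \<open>f\<close> and \<open>g\<close>
  with values in \<open>M\<close> and \<open>N\<close>; an argument \<open>X\<close> is a coset in the free module on pairs.\<close>

definition tensor_map ::
  "'k ring \<Rightarrow> ('k, 'm) module \<Rightarrow> ('k, 'n) module \<Rightarrow> ('x \<Rightarrow> 'm) \<Rightarrow> ('y \<Rightarrow> 'n) \<Rightarrow>
    ('x \<times> 'y \<Rightarrow> 'k) set \<Rightarrow> ('m \<times> 'n \<Rightarrow> 'k) set" where
  "tensor_map K M N f g X =
     (let L = free_module K (carrier M \<times> carrier N) in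
       \<Union>p\<in>X. tensor_kernel K M N +>\<^bsub>L\<^esub> lin_ext K L (\<lambda>(x, y). basis_elt K (f x, g y)) p)"


section \<open>The shuffle product algebra\<close>

text \<open>The word \<open>[v\<^sub>1, \<dots>, v\<^sub>k]\<close> over \<open>V\<close> stands for the pure tensor of \<open>v\<^sub>1, \<dots>, v\<^sub>k\<close>.
  Since each relation of multilinearity only involves words of one length, the quotient of the
  free module on all words by these relations is the direct sum over \<open>k\<close> of the \<open>k\<close>-fold tensor
  powers of \<open>V\<close>; there are no relations in length 0, where the empty word spans a copy of \<open>\<k>\<close>.\<close>

definition multilinear_relations :: "'k ring \<Rightarrow> ('k, 'v) module \<Rightarrow> ('v list \<Rightarrow> 'k) set" where
  "multilinear_relations K V =
     (let L = free_module K (lists (carrier V)); d = basis_elt K in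
       {d (s @ [x \<oplus>\<^bsub>V\<^esub> y] @ t) \<ominus>\<^bsub>L\<^esub> (d (s @ [x] @ t) \<oplus>\<^bsub>L\<^esub> d (s @ [y] @ t)) | s t x y.
          s \<in> lists (carrier V) \<and> t \<in> lists (carrier V) \<and> x \<in> carrier V \<and> y \<in> carrier V} \<union>
       {d (s @ [a \<odot>\<^bsub>V\<^esub> x] @ t) \<ominus>\<^bsub>L\<^esub> a \<odot>\<^bsub>L\<^esub> d (s @ [x] @ t) | s t a x.
          s \<in> lists (carrier V) \<and> t \<in> lists (carrier V) \<and> a \<in> carrier K \<and> x \<in> carrier V})"

definition words_kernel :: "'k ring \<Rightarrow> ('k, 'v) module \<Rightarrow> ('v list \<Rightarrow> 'k) set" where
  "words_kernel K V =
     submodule_span K (free_module K (lists (carrier V))) (multilinear_relations K V)"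

fun shuffle :: "'k ring \<Rightarrow> 'v set \<Rightarrow> 'v list \<Rightarrow> 'v list \<Rightarrow> ('v list \<Rightarrow> 'k)" where
  "shuffle K X [] t = basis_elt K t"
| "shuffle K X (a # s) [] = basis_elt K (a # s)"
| "shuffle K X (a # s) (b # t) =
     lin_ext K (free_module K (lists X)) (\<lambda>w. basis_elt K (a # w)) (shuffle K X s (b # t))
     \<oplus>\<^bsub>free_module K (lists X)\<^esub>
     lin_ext K (free_module K (lists X)) (\<lambda>w. basis_elt K (b # w)) (shuffle K X (a # s) t)"

definition Sh :: "'k ring \<Rightarrow> ('k, 'v) module \<Rightarrow> ('k, ('v list \<Rightarrow> 'k) set) module" where
  "Sh K V =
     quot_module
       (free_algebra K (lists (carrier V)) (shuffle K (carrier V)) (basis_elt K []))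
       (words_kernel K V)"

definition word_tensor :: "'k ring \<Rightarrow> ('k, 'v) module \<Rightarrow> 'v list \<Rightarrow> ('v list \<Rightarrow> 'k) set" where
  "word_tensor K V s = words_kernel K V +>\<^bsub>free_module K (lists (carrier V))\<^esub> basis_elt K s"


section \<open>The algebra \<open>Sha\<^bsub>\<Omega>,F\<^esub>(A)\<close> for \<open>A = \<k> \<oplus> B\<close>\<close>

definition frakA :: "'k ring \<Rightarrow> ('k, 'f) module \<Rightarrow> ('k, 'b) module \<Rightarrow>
    ('k, ('f \<times> ('k \<times> 'b) \<Rightarrow> 'k) set) module" where
  "frakA K F B = tensor K F (unitization K B)"

definition frakA_plus :: "'k ring \<Rightarrow> ('k, 'f) module \<Rightarrow> ('k, 'b) module \<Rightarrow>
    ('k, ('f \<times> 'b \<Rightarrow> 'k) set) module" where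
  "frakA_plus K F B = tensor K F B"

text \<open>The embeddings of the two summands of the decomposition of \<^const>\<open>frakA\<close> into
  \<open>F\<close> and \<^const>\<open>frakA_plus\<close>, and the action of \<open>F\<close> on the second summand.\<close>

definition F_embed :: "'k ring \<Rightarrow> ('k, 'f) module \<Rightarrow> ('k, 'b) module \<Rightarrow> 'f \<Rightarrow>
    ('f \<times> ('k \<times> 'b) \<Rightarrow> 'k) set" where
  "F_embed K F B c = pure_tensor K F (unitization K B) c \<one>\<^bsub>unitization K B\<^esub>"

definition plus_embed :: "'k ring \<Rightarrow> ('k, 'f) module \<Rightarrow> ('k, 'b) module \<Rightarrow>
    ('f \<times> 'b \<Rightarrow> 'k) set \<Rightarrow> ('f \<times> ('k \<times> 'b) \<Rightarrow> 'k) set" where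
  "plus_embed K F B = tensor_map K F (unitization K B) (\<lambda>c. c) (\<lambda>b. (\<zero>\<^bsub>K\<^esub>, b))"

definition F_action :: "'k ring \<Rightarrow> ('k, 'f) module \<Rightarrow> ('k, 'b) module \<Rightarrow> 'f \<Rightarrow>
    ('f \<times> 'b \<Rightarrow> 'k) set \<Rightarrow> ('f \<times> 'b \<Rightarrow> 'k) set" where
  "F_action K F B c = tensor_map K F B (\<lambda>c'. c \<otimes>\<^bsub>F\<^esub> c') (\<lambda>b. b)"

type_synonym ('k, 'w, 'f, 'b) letter = "(('w \<Rightarrow> 'k) \<times> ('f \<times> 'b \<Rightarrow> 'k) set \<Rightarrow> 'k) set"

type_synonym ('k, 'w, 'f, 'b) sha =
  "(('f \<times> ('k \<times> 'b) \<Rightarrow> 'k) set \<times> (('k, 'w, 'f, 'b) letter list \<Rightarrow> 'k) set \<Rightarrow> 'k) set"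

definition letters :: "'k ring \<Rightarrow> 'w set \<Rightarrow> ('k, 'f) module \<Rightarrow> ('k, 'b) module \<Rightarrow>
    ('k, ('k, 'w, 'f, 'b) letter) module" where
  "letters K \<Omega> F B = tensor K (free_module K \<Omega>) (frakA_plus K F B)"

definition Sha :: "'k ring \<Rightarrow> 'w set \<Rightarrow> ('k, 'f) module \<Rightarrow> ('k, 'b) module \<Rightarrow>
    ('k, ('k, 'w, 'f, 'b) sha) module" where
  "Sha K \<Omega> F B = tensor K (frakA K F B) (Sh K (letters K \<Omega> F B))"

text \<open>The pure tensor \<open>u\<^sub>0 \<otimes> (\<omega>\<^sub>1 \<otimes> u\<^sub>1) \<otimes> \<dots> \<otimes> (\<omega>\<^sub>n \<otimes> u\<^sub>n)\<close> with \<open>u\<^sub>0\<close> in \<^const>\<open>frakA\<close> and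
  \<open>u\<^sub>1, \<dots>, u\<^sub>n\<close> in \<^const>\<open>frakA_plus\<close>.\<close>

definition sha_pure :: "'k ring \<Rightarrow> 'w set \<Rightarrow> ('k, 'f) module \<Rightarrow> ('k, 'b) module \<Rightarrow>
    ('f \<times> ('k \<times> 'b) \<Rightarrow> 'k) set \<Rightarrow> ('w \<times> ('f \<times> 'b \<Rightarrow> 'k) set) list \<Rightarrow> ('k, 'w, 'f, 'b) sha" where
  "sha_pure K \<Omega> F B u ws =
     pure_tensor K (frakA K F B) (Sh K (letters K \<Omega> F B)) u
       (word_tensor K (letters K \<Omega> F B)
         (map (\<lambda>(\<omega>, v). pure_tensor K (free_module K \<Omega>) (frakA_plus K F B) (basis_elt K \<omega>) v) ws))"

definition is_sha_operator :: "'k ring \<Rightarrow> 'w set \<Rightarrow> ('k, 'f) module \<Rightarrow> ('w \<Rightarrow> 'f \<Rightarrow> 'f) \<Rightarrow>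
    ('k, 'b) module \<Rightarrow> 'w \<Rightarrow> (('k, 'w, 'f, 'b) sha \<Rightarrow> ('k, 'w, 'f, 'b) sha) \<Rightarrow> bool" where
  "is_sha_operator K \<Omega> F \<kappa> B \<omega> P \<longleftrightarrow>
     P \<in> linear_maps K (Sha K \<Omega> F B) (Sha K \<Omega> F B) \<and>
     (\<forall>c\<in>carrier F.
        P (sha_pure K \<Omega> F B (F_embed K F B c) []) = sha_pure K \<Omega> F B (F_embed K F B (\<kappa> \<omega> c)) []) \<and>
     (\<forall>c\<in>carrier F. \<forall>\<omega>1\<in>\<Omega>. \<forall>u1\<in>carrier (frakA_plus K F B).
        \<forall>ws\<in>lists (\<Omega> \<times> carrier (frakA_plus K F B)).
        P (sha_pure K \<Omega> F B (F_embed K F B c) ((\<omega>1, u1) # ws)) =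
          sha_pure K \<Omega> F B (F_embed K F B (\<kappa> \<omega> c)) ((\<omega>1, u1) # ws)
          \<ominus>\<^bsub>Sha K \<Omega> F B\<^esub>
          sha_pure K \<Omega> F B \<one>\<^bsub>frakA K F B\<^esub> ((\<omega>1, F_action K F B (\<kappa> \<omega> c) u1) # ws)) \<and>
     (\<forall>u0\<in>carrier (frakA_plus K F B). \<forall>ws\<in>lists (\<Omega> \<times> carrier (frakA_plus K F B)).
        P (sha_pure K \<Omega> F B (plus_embed K F B u0) ws) =
          sha_pure K \<Omega> F B \<one>\<^bsub>frakA K F B\<^esub> ((\<omega>, u0) # ws))"

text \<open>The pure tensors in \<^const>\<open>is_sha_operator\<close> span the module, so there is at most one such
  operator. Extensionality fixes the junk values outside the carrier, as needed for \<open>THE\<close>.\<close>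

definition sha_operator :: "'k ring \<Rightarrow> 'w set \<Rightarrow> ('k, 'f) module \<Rightarrow> ('w \<Rightarrow> 'f \<Rightarrow> 'f) \<Rightarrow>
    ('k, 'b) module \<Rightarrow> 'w \<Rightarrow> ('k, 'w, 'f, 'b) sha \<Rightarrow> ('k, 'w, 'f, 'b) sha" where
  "sha_operator K \<Omega> F \<kappa> B \<omega> =
     (THE P. P \<in> extensional (carrier (Sha K \<Omega> F B)) \<and> is_sha_operator K \<Omega> F \<kappa> B \<omega> P)"

definition sha_i :: "'k ring \<Rightarrow> 'w set \<Rightarrow> ('k, 'f) module \<Rightarrow> ('k, 'b) module \<Rightarrow>
    'f \<Rightarrow> ('k, 'w, 'f, 'b) sha" where
  "sha_i K \<Omega> F B c = sha_pure K \<Omega> F B (pure_tensor K F (unitization K B) c \<one>\<^bsub>unitization K B\<^esub>) []"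

definition sha_j :: "'k ring \<Rightarrow> 'w set \<Rightarrow> ('k, 'f) module \<Rightarrow> ('k, 'b) module \<Rightarrow>
    'k \<times> 'b \<Rightarrow> ('k, 'w, 'f, 'b) sha" where
  "sha_j K \<Omega> F B a = sha_pure K \<Omega> F B (pure_tensor K F (unitization K B) \<one>\<^bsub>F\<^esub> a) []"

end

theory Submission
  imports Defs
begin

text \<open>Why \<open>Sha\<close> is free. Write \<open>A = \<k> \<oplus> B\<close> and \<open>V = \<k>\<Omega> \<otimes> (F \<otimes> B)\<close>, and let \<open>v w\<close> be the word \<open>w\<close> with the
  letter \<open>v\<close> prefixed. In any relative matching Rota-Baxter algebra \<open>R\<close> with a homomorphism
  \<open>f : A \<rightarrow> R\<close> the algebra generated by the images of \<open>F\<close> and \<open>A\<close> contains the products of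
  \<open>\<phi>(u\<^sub>0) = \<iota>(c) f(a)\<close>, for \<open>u\<^sub>0 = c \<otimes> a\<close>, with iterated integrals
  \<open>P\<^sub>\<omega>\<^sub>1(\<phi>(u\<^sub>1) P\<^sub>\<omega>\<^sub>2(\<phi>(u\<^sub>2) \<dots>))\<close>. The Rota-Baxter identity of weight zero is integration by parts, so
  iterated integrals multiply by the shuffle product; and it rewrites \<open>P\<^sub>\<omega>(\<iota>(c) P\<^sub>\<beta>(y))\<close>, with \<open>c\<close> in \<open>F\<close>,
  as \<open>\<iota>(\<kappa>\<^sub>\<omega>(c)) P\<^sub>\<beta>(y) - P\<^sub>\<beta>(\<iota>(\<kappa>\<^sub>\<omega>(c)) y)\<close>, so that elements of \<open>F\<close> never need to stay inside an
  integral. Hence such products span a subalgebra closed under the operators, and \<open>Sha\<close> is this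
  algebra with no further relations.

  The operator on \<open>Sha\<close> is, for \<open>u\<close> in \<open>F \<otimes> A\<close> with components \<open>c\<close> in \<open>F\<close> and \<open>u'\<close> in \<open>F \<otimes> B\<close>,

    \<open>P\<^sub>\<omega>(u \<otimes> p) = \<kappa>\<^sub>\<omega>(c) \<otimes> p - 1 \<otimes> D\<^sub>d(p) + 1 \<otimes> (\<omega> \<otimes> u') p\<close> with \<open>d = \<kappa>\<^sub>\<omega>(c)\<close>,

  where \<open>D\<^sub>d\<close> multiplies the first letter of a word by \<open>d\<close> and kills the empty word. This formula is
  bilinear in \<open>(u, p)\<close>, so it defines an operator on the tensor product, and by linearity there is
  only one operator with the prescribed values. Its Rota-Baxter identity reduces to three
  identities in the shuffle algebra: the recursion \<open>cons_mult_cons\<close> of the shuffle product, and the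
  two rules \<open>letter_map_mult_cons\<close> and \<open>letter_map_mult_letter_map\<close> for products involving \<open>D\<^sub>d\<close>.

  Given \<open>R\<close> and \<open>f\<close>, the extension sends \<open>u \<otimes> p\<close> to \<open>\<phi>(u) \<Theta>(p)\<close>, where \<open>\<Theta>\<close> takes a word to its
  iterated integral. It is multiplicative by \<open>word_fold_mult\<close> and commutes with the operators by
  \<open>J_letter_act\<close> and \<open>ext_op\<close>. It is unique (\<open>homs_agree\<close>) because \<open>1 \<otimes> (\<omega> \<otimes> u) p\<close> is the
  value of \<open>P\<^sub>\<omega>\<close> at \<open>u \<otimes> p\<close>, so that \<open>F\<close>, \<open>A\<close>, products and operators generate everything.

  Tensor products and the shuffle algebra are concrete quotients of free modules. They are treated
  uniformly as modules with generators and relations, for which maps and products are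
  constructed once and for all. After that only their universal properties are used, together with
  the principle that (multi)linear maps agreeing on spanning sets are equal.\<close>


section \<open>Linear maps, bilinear maps and spanning sets\<close>

lemma linear_mapsI:
  assumes "\<And>x. x \<in> carrier M \<Longrightarrow> h x \<in> carrier N"
    and "\<And>x y. x \<in> carrier M \<Longrightarrow> y \<in> carrier M \<Longrightarrow> h (x \<oplus>\<^bsub>M\<^esub> y) = h x \<oplus>\<^bsub>N\<^esub> h y"
    and "\<And>a x. a \<in> carrier K \<Longrightarrow> x \<in> carrier M \<Longrightarrow> h (a \<odot>\<^bsub>M\<^esub> x) = a \<odot>\<^bsub>N\<^esub> h x"
  shows "h \<in> linear_maps K M N"
  using assms by (simp add: linear_maps_def Pi_iff)

lemma linear_closed: "h \<in> linear_maps K M N \<Longrightarrow> x \<in> carrier M \<Longrightarrow> h x \<in> carrier N"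
  by (auto simp: linear_maps_def)

lemma linear_add:
  "h \<in> linear_maps K M N \<Longrightarrow> x \<in> carrier M \<Longrightarrow> y \<in> carrier M \<Longrightarrow> h (x \<oplus>\<^bsub>M\<^esub> y) = h x \<oplus>\<^bsub>N\<^esub> h y"
  by (auto simp: linear_maps_def)

lemma linear_smult:
  "h \<in> linear_maps K M N \<Longrightarrow> a \<in> carrier K \<Longrightarrow> x \<in> carrier M \<Longrightarrow> h (a \<odot>\<^bsub>M\<^esub> x) = a \<odot>\<^bsub>N\<^esub> h x"
  by (auto simp: linear_maps_def)

lemma linear_cong:
  assumes "h \<in> linear_maps K M N" "\<And>x. x \<in> carrier M \<Longrightarrow> h x = k x" "module K M"
  shows "k \<in> linear_maps K M N"
proof -
  interpret M: module K M by fact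
  show ?thesis using assms(1,2)
    by (simp add: linear_maps_def Pi_iff)
qed

locale module_over = module K M
  for K :: "'k ring" and M :: "('k, 'm) module" (structure)

lemma (in module_over) diff_eq_zeroD:
  assumes "x \<ominus> y = \<zero>" "x \<in> carrier M" "y \<in> carrier M" shows "x = y"
proof -
  have "x \<oplus> \<ominus> y = \<zero>" using assms(1) by (simp add: M.minus_eq)
  from M.minus_equality[OF this] assms(2,3) show ?thesis by simp
qed

locale two_modules = M: module K M + N: module K N
  for K :: "'k ring" and M :: "('k, 'm) module" and N :: "('k, 'n) module"
begin

lemma linear_zero:
  assumes "h \<in> linear_maps K M N" shows "h \<zero>\<^bsub>M\<^esub> = \<zero>\<^bsub>N\<^esub>"
proof -
  have "h (\<zero>\<^bsub>K\<^esub> \<odot>\<^bsub>M\<^esub> \<zero>\<^bsub>M\<^esub>) = \<zero>\<^bsub>K\<^esub> \<odot>\<^bsub>N\<^esub> h \<zero>\<^bsub>M\<^esub>"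
    using assms by (intro linear_smult) auto
  then show ?thesis using linear_closed[OF assms, of "\<zero>\<^bsub>M\<^esub>"] by simp
qed

lemma linear_neg:
  assumes "h \<in> linear_maps K M N" "x \<in> carrier M" shows "h (\<ominus>\<^bsub>M\<^esub> x) = \<ominus>\<^bsub>N\<^esub> h x"
proof -
  have "h x \<oplus>\<^bsub>N\<^esub> h (\<ominus>\<^bsub>M\<^esub> x) = \<zero>\<^bsub>N\<^esub>"
    using assms linear_add[OF assms(1), of x "\<ominus>\<^bsub>M\<^esub> x"] linear_zero[OF assms(1)] by (simp add: M.M.r_neg)
  then show ?thesis using assms linear_closed[OF assms(1)]
    by (metis M.M.a_inv_closed N.M.minus_equality N.M.minus_minus)
qed

lemma linear_diff:
  assumes "h \<in> linear_maps K M N" "x \<in> carrier M" "y \<in> carrier M"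
  shows "h (x \<ominus>\<^bsub>M\<^esub> y) = h x \<ominus>\<^bsub>N\<^esub> h y"
  using assms by (simp add: a_minus_def linear_add linear_neg)

lemma equalizer_submodule:
  assumes "h \<in> linear_maps K M N" "k \<in> linear_maps K M N"
  shows "submodule {x \<in> carrier M. h x = k x} K M"
  using assms by (intro M.submoduleI) (auto simp: linear_zero linear_neg linear_add linear_smult)

lemma preimage_submodule:
  assumes "h \<in> linear_maps K M N" "submodule H K N"
  shows "submodule {x \<in> carrier M. h x \<in> H} K M"
proof -
  note E = N.submoduleE[OF assms(2)]
  have "\<zero>\<^bsub>N\<^esub> \<in> H" using submodule.axioms(1)[OF assms(2)] by (metis monoid.select_convs(2) subgroup.one_closed)
  then show ?thesis using assms(1) E
    by (intro M.submoduleI) (auto simp: linear_zero linear_neg linear_add linear_smult)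
qed

lemma linear_zero_map: "(\<lambda>x. \<zero>\<^bsub>N\<^esub>) \<in> linear_maps K M N"
  by (intro linear_mapsI) auto

lemma linear_sum:
  assumes "h \<in> linear_maps K M N" "k \<in> linear_maps K M N"
  shows "(\<lambda>x. h x \<oplus>\<^bsub>N\<^esub> k x) \<in> linear_maps K M N"
  using assms linear_closed[OF assms(1)] linear_closed[OF assms(2)]
  by (intro linear_mapsI) (auto simp: linear_add linear_smult N.M.a_ac N.smult_r_distr)

lemma linear_scale:
  assumes "h \<in> linear_maps K M N" "a \<in> carrier K"
  shows "(\<lambda>x. a \<odot>\<^bsub>N\<^esub> h x) \<in> linear_maps K M N"
  using assms linear_closed[OF assms(1)]
  by (intro linear_mapsI)
    (auto simp: linear_add linear_smult N.smult_r_distr N.smult_assoc1[symmetric] M.R.m_comm)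

lemma linear_negation:
  assumes "h \<in> linear_maps K M N"
  shows "(\<lambda>x. \<ominus>\<^bsub>N\<^esub> h x) \<in> linear_maps K M N"
  using assms linear_closed[OF assms(1)]
  by (intro linear_mapsI) (auto simp: linear_add linear_smult N.M.minus_add N.smult_r_minus)

lemma linear_difference:
  assumes "h \<in> linear_maps K M N" "k \<in> linear_maps K M N"
  shows "(\<lambda>x. h x \<ominus>\<^bsub>N\<^esub> k x) \<in> linear_maps K M N"
  unfolding a_minus_def by (intro linear_sum linear_negation assms)

end

lemma linear_id: "(\<lambda>x. x) \<in> linear_maps K M M"
  by (auto simp: linear_maps_def)

lemma linear_comp:
  "h \<in> linear_maps K M N \<Longrightarrow> k \<in> linear_maps K N Q \<Longrightarrow> (\<lambda>x. k (h x)) \<in> linear_maps K M Q"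
  by (auto simp: linear_maps_def Pi_iff)

definition bilinear_maps ::
  "'k ring \<Rightarrow> ('k, 'm) module \<Rightarrow> ('k, 'n) module \<Rightarrow> ('k, 'q) module \<Rightarrow> ('m \<Rightarrow> 'n \<Rightarrow> 'q) set" where
  "bilinear_maps K M N Q = {b. (\<forall>x\<in>carrier M. b x \<in> linear_maps K N Q) \<and>
     (\<forall>y\<in>carrier N. (\<lambda>x. b x y) \<in> linear_maps K M Q)}"

lemma bilinear_mapsI:
  assumes "\<And>x. x \<in> carrier M \<Longrightarrow> b x \<in> linear_maps K N Q"
    and "\<And>y. y \<in> carrier N \<Longrightarrow> (\<lambda>x. b x y) \<in> linear_maps K M Q"
  shows "b \<in> bilinear_maps K M N Q"
  using assms by (auto simp: bilinear_maps_def)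

lemma bilinear_right:
  "b \<in> bilinear_maps K M N Q \<Longrightarrow> x \<in> carrier M \<Longrightarrow> b x \<in> linear_maps K N Q"
  by (auto simp: bilinear_maps_def)

lemma bilinear_left:
  "b \<in> bilinear_maps K M N Q \<Longrightarrow> y \<in> carrier N \<Longrightarrow> (\<lambda>x. b x y) \<in> linear_maps K M Q"
  by (auto simp: bilinear_maps_def)

lemma bilinear_closed:
  "b \<in> bilinear_maps K M N Q \<Longrightarrow> x \<in> carrier M \<Longrightarrow> y \<in> carrier N \<Longrightarrow> b x y \<in> carrier Q"
  by (meson bilinear_right linear_closed)

lemma bilinear_swap: "b \<in> bilinear_maps K M N Q \<Longrightarrow> (\<lambda>y x. b x y) \<in> bilinear_maps K N M Q"
  by (simp add: bilinear_maps_def)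

lemma linear_bilinear_right:
  "b \<in> bilinear_maps K M N Q \<Longrightarrow> x \<in> carrier M \<Longrightarrow> h \<in> linear_maps K M' N \<Longrightarrow>
    (\<lambda>z. b x (h z)) \<in> linear_maps K M' Q"
  by (rule linear_comp[OF _ bilinear_right])

lemma linear_bilinear_left:
  assumes "b \<in> bilinear_maps K M N Q" "y \<in> carrier N" "h \<in> linear_maps K M' M"
  shows "(\<lambda>z. b (h z) y) \<in> linear_maps K M' Q"
  using linear_comp[OF assms(3) bilinear_left[OF assms(1,2)]] .

lemma mult_bilinear:
  fixes A :: "('k, 'a) module"
  assumes "algebra K A" shows "(\<otimes>\<^bsub>A\<^esub>) \<in> bilinear_maps K A A A"
proof -
  interpret A: algebra K A by fact
  have "x \<otimes>\<^bsub>A\<^esub> (a \<odot>\<^bsub>A\<^esub> y) = a \<odot>\<^bsub>A\<^esub> (x \<otimes>\<^bsub>A\<^esub> y)"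
    if "a \<in> carrier K" "x \<in> carrier A" "y \<in> carrier A" for a x y
    using that by (metis A.m_comm A.smult_assoc2 A.smult_closed)
  then show ?thesis
    by (intro bilinear_mapsI linear_mapsI) (auto simp: A.r_distr A.l_distr A.smult_assoc2)
qed

lemma submodule_span_least:
  "submodule H K M \<Longrightarrow> S \<subseteq> H \<Longrightarrow> submodule_span K M S \<subseteq> H"
  by (auto simp: submodule_span_def)

lemma submodule_span_superset: "S \<subseteq> submodule_span K M S"
  by (auto simp: submodule_span_def)

lemma (in module_over) submodule_span_submodule:
  assumes "S \<subseteq> carrier M" shows "submodule (submodule_span K M S) K M"
proof -
  have zero: "\<zero>\<^bsub>M\<^esub> \<in> H" if "submodule H K M" for H
    using submodule.axioms(1)[OF that] by (metis monoid.select_convs(2) subgroup.one_closed)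
  show ?thesis
  proof (rule submoduleI)
    show "submodule_span K M S \<subseteq> carrier M"
      using submodule_span_least[OF carrier_is_submodule assms] .
  qed (auto simp: submodule_span_def zero dest: submoduleE)
qed

text \<open>A set \<open>T\<close> spans \<open>M\<close> if \<open>submodule_span K M T = carrier M\<close>; this is the form in which
  identities are reduced to generators.\<close>

lemma spanning_induct:
  assumes "submodule_span K M T = carrier M" "submodule H K M" "T \<subseteq> H" "x \<in> carrier M"
  shows "x \<in> H"
  using submodule_span_least[OF assms(2,3)] assms(1,4) by auto

lemma (in module_over) spanningI:
  assumes "T \<subseteq> carrier M" "\<And>H. submodule H K M \<Longrightarrow> T \<subseteq> H \<Longrightarrow> carrier M \<subseteq> H"
  shows "submodule_span K M T = carrier M"
  using submodule_span_least[OF carrier_is_submodule assms(1)] assms(2)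
  by (auto simp: submodule_span_def)

lemma (in two_modules) linear_eq_on_span:
  assumes "submodule_span K M T = carrier M" "h \<in> linear_maps K M N" "k \<in> linear_maps K M N"
    and "\<And>t. t \<in> T \<Longrightarrow> h t = k t" "x \<in> carrier M"
  shows "h x = k x"
proof -
  have "T \<subseteq> carrier M" using assms(1) submodule_span_superset[of T K M] by simp
  then show ?thesis
    using spanning_induct[OF assms(1) equalizer_submodule[OF assms(2,3)] _ assms(5)] assms(4) by auto
qed

lemmas linear_zero = two_modules.linear_zero[OF two_modules.intro]
lemmas linear_eq_on_span = two_modules.linear_eq_on_span[OF two_modules.intro]

lemma bilinear_eq_on_span:
  assumes "module K M" "module K N" "module K Q"
    and S: "submodule_span K M S = carrier M" and T: "submodule_span K N T = carrier N"
    and b: "b \<in> bilinear_maps K M N Q" and c: "c \<in> bilinear_maps K M N Q"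
    and eq: "\<And>s t. s \<in> S \<Longrightarrow> t \<in> T \<Longrightarrow> b s t = c s t"
    and "x \<in> carrier M" "y \<in> carrier N"
  shows "b x y = c x y"
proof (rule linear_eq_on_span[OF assms(1,3) S bilinear_left[OF b] bilinear_left[OF c]])
  fix s assume s: "s \<in> S"
  then have "s \<in> carrier M" using S submodule_span_superset[of S K M] by auto
  then show "b s y = c s y"
    using linear_eq_on_span[OF assms(2,3) T bilinear_right[OF b] bilinear_right[OF c] eq[OF s] \<open>y \<in> carrier N\<close>] by auto
qed fact+

text \<open>Additivity and homogeneity in the first argument are, for a fixed first argument, equations
  between linear functions of the second one. They need only be tested on a spanning set.\<close>

lemma bilinear_from_span:
  assumes "module K M" "module K N" "module K Q"
    and T: "submodule_span K N T = carrier N"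
    and right: "\<And>x. x \<in> carrier M \<Longrightarrow> b x \<in> linear_maps K N Q"
    and left: "\<And>t. t \<in> T \<Longrightarrow> (\<lambda>x. b x t) \<in> linear_maps K M Q"
  shows "b \<in> bilinear_maps K M N Q"
proof (rule bilinear_mapsI)
  interpret M: module K M by fact
  interpret NQ: two_modules K N Q by (intro two_modules.intro assms)
  fix y assume y: "y \<in> carrier N"
  note eq = linear_eq_on_span[OF assms(2,3) T _ _ _ y]
  show "(\<lambda>x. b x y) \<in> linear_maps K M Q"
  proof (rule linear_mapsI)
    show "b x y \<in> carrier Q" if "x \<in> carrier M" for x
      using linear_closed[OF right[OF that] y] .
    show "b (x \<oplus>\<^bsub>M\<^esub> x') y = b x y \<oplus>\<^bsub>Q\<^esub> b x' y" if "x \<in> carrier M" "x' \<in> carrier M" for x x'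
      by (rule eq) (use that in \<open>auto intro!: right NQ.linear_sum linear_add[OF left]\<close>)
    show "b (a \<odot>\<^bsub>M\<^esub> x) y = a \<odot>\<^bsub>Q\<^esub> b x y" if "a \<in> carrier K" "x \<in> carrier M" for a x
      by (rule eq) (use that in \<open>auto intro!: right NQ.linear_scale linear_smult[OF left]\<close>)
  qed
qed (rule right)

text \<open>Each axiom of a commutative algebra equates two multilinear maps.\<close>

lemma algebra_from_spanning_set:
  assumes G: "module K G" and T: "submodule_span K G T = carrier G"
    and b: "(\<otimes>\<^bsub>G\<^esub>) \<in> bilinear_maps K G G G" and one: "\<one>\<^bsub>G\<^esub> \<in> carrier G"
    and comm: "\<And>x y. x \<in> T \<Longrightarrow> y \<in> T \<Longrightarrow> x \<otimes>\<^bsub>G\<^esub> y = y \<otimes>\<^bsub>G\<^esub> x"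
    and assoc: "\<And>x y z. x \<in> T \<Longrightarrow> y \<in> T \<Longrightarrow> z \<in> T \<Longrightarrow> x \<otimes>\<^bsub>G\<^esub> y \<otimes>\<^bsub>G\<^esub> z = x \<otimes>\<^bsub>G\<^esub> (y \<otimes>\<^bsub>G\<^esub> z)"
    and unit: "\<And>x. x \<in> T \<Longrightarrow> \<one>\<^bsub>G\<^esub> \<otimes>\<^bsub>G\<^esub> x = x"
  shows "algebra K G"
proof -
  interpret G: module K G by fact
  have TG: "T \<subseteq> carrier G" using T submodule_span_superset[of T K G] by simp
  note cl = bilinear_closed[OF b]
  have comm': "x \<otimes>\<^bsub>G\<^esub> y = y \<otimes>\<^bsub>G\<^esub> x" if "x \<in> carrier G" "y \<in> carrier G" for x y
    using bilinear_eq_on_span[OF G G G T T b, of "\<lambda>x y. y \<otimes>\<^bsub>G\<^esub> x"] comm b that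
    by (auto simp: bilinear_maps_def)
  have unit': "\<one>\<^bsub>G\<^esub> \<otimes>\<^bsub>G\<^esub> x = x" if "x \<in> carrier G" for x
    by (rule linear_eq_on_span[OF G G T bilinear_right[OF b one] linear_id]) (auto simp: that unit)
  have assoc1: "x \<otimes>\<^bsub>G\<^esub> y \<otimes>\<^bsub>G\<^esub> z = x \<otimes>\<^bsub>G\<^esub> (y \<otimes>\<^bsub>G\<^esub> z)"
    if "x \<in> T" "y \<in> T" "z \<in> carrier G" for x y z
    by (rule linear_eq_on_span[OF G G T])
      (use that TG in \<open>auto intro!: linear_bilinear_right[OF b] bilinear_right[OF b] cl assoc\<close>)
  have assoc2: "x \<otimes>\<^bsub>G\<^esub> y \<otimes>\<^bsub>G\<^esub> z = x \<otimes>\<^bsub>G\<^esub> (y \<otimes>\<^bsub>G\<^esub> z)"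
    if "x \<in> carrier G" "y \<in> carrier G" "z \<in> carrier G" for x y z
    by (rule bilinear_eq_on_span[OF G G G T T, where b="\<lambda>x y. x \<otimes>\<^bsub>G\<^esub> y \<otimes>\<^bsub>G\<^esub> z" and c="\<lambda>x y. x \<otimes>\<^bsub>G\<^esub> (y \<otimes>\<^bsub>G\<^esub> z)"])
      (use that assoc1 in \<open>auto intro!: linear_bilinear_right[OF b] bilinear_right[OF b] linear_id
        linear_bilinear_left[OF b] bilinear_left[OF b] bilinear_mapsI cl\<close>)
  have dl: "(x \<oplus>\<^bsub>G\<^esub> y) \<otimes>\<^bsub>G\<^esub> z = x \<otimes>\<^bsub>G\<^esub> z \<oplus>\<^bsub>G\<^esub> y \<otimes>\<^bsub>G\<^esub> z"
    if "x \<in> carrier G" "y \<in> carrier G" "z \<in> carrier G" for x y z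
    using linear_add[OF bilinear_left[OF b]] that by blast
  have sl: "(a \<odot>\<^bsub>G\<^esub> y) \<otimes>\<^bsub>G\<^esub> z = a \<odot>\<^bsub>G\<^esub> (y \<otimes>\<^bsub>G\<^esub> z)"
    if "a \<in> carrier K" "y \<in> carrier G" "z \<in> carrier G" for a y z
    using linear_smult[OF bilinear_left[OF b]] that by blast
  have "Group.comm_monoid G"
    by (intro comm_monoidI one cl assoc2 unit' comm')
  then have "cring G" by (intro cringI G.abelian_group_axioms dl)
  then show ?thesis
    by (intro algebraI sl G.smult_l_distr G.smult_r_distr G.smult_assoc1 G.R.is_cring) auto
qed


section \<open>Free modules, quotient modules and presentations\<close>

lemma free_module_simps:
  "p \<in> carrier (free_module K X) \<longleftrightarrow>
     (\<forall>x. p x \<in> carrier K) \<and> finite {x. p x \<noteq> \<zero>\<^bsub>K\<^esub>} \<and> {x. p x \<noteq> \<zero>\<^bsub>K\<^esub>} \<subseteq> X"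
  "\<zero>\<^bsub>free_module K X\<^esub> = (\<lambda>x. \<zero>\<^bsub>K\<^esub>)"
  "p \<oplus>\<^bsub>free_module K X\<^esub> q = (\<lambda>x. p x \<oplus>\<^bsub>K\<^esub> q x)"
  "a \<odot>\<^bsub>free_module K X\<^esub> p = (\<lambda>x. a \<otimes>\<^bsub>K\<^esub> p x)"
  by (auto simp: free_module_def)

locale coefficients = cring K for K :: "'k ring" (structure)
begin

lemma free_module_module: "module K (free_module K X)"
proof -
  have sum_supp: "{x. p x \<oplus> q x \<noteq> \<zero>} \<subseteq> {x. p x \<noteq> \<zero>} \<union> {x. q x \<noteq> \<zero>}" for p q
    by auto
  have smult_supp: "{x. a \<otimes> p x \<noteq> \<zero>} \<subseteq> {x. p x \<noteq> \<zero>}" if "a \<in> carrier K" for a p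
    using that by auto
  have neg_supp: "{x. \<ominus> p x \<noteq> \<zero>} \<subseteq> {x. p x \<noteq> \<zero>}" for p
    by auto
  have "abelian_group (free_module K X)"
  proof (rule abelian_groupI)
    fix p q assume "p \<in> carrier (free_module K X)" "q \<in> carrier (free_module K X)"
    then show "p \<oplus>\<^bsub>free_module K X\<^esub> q \<in> carrier (free_module K X)"
      using sum_supp[of p q] by (auto simp: free_module_simps intro: finite_subset)
  next
    fix p assume "p \<in> carrier (free_module K X)"
    then show "\<exists>q\<in>carrier (free_module K X). q \<oplus>\<^bsub>free_module K X\<^esub> p = \<zero>\<^bsub>free_module K X\<^esub>"
      using neg_supp[of p]
      by (intro bexI[of _ "\<lambda>x. \<ominus> p x"]) (auto simp: free_module_simps l_neg intro: finite_subset)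
  qed (auto simp: free_module_simps a_ac)
  then show ?thesis
  proof (intro moduleI is_cring)
    fix a p assume "a \<in> carrier K" "p \<in> carrier (free_module K X)"
    then show "a \<odot>\<^bsub>free_module K X\<^esub> p \<in> carrier (free_module K X)"
      using smult_supp[of a p] by (auto simp: free_module_simps intro: finite_subset)
  qed (auto simp: free_module_simps l_distr r_distr m_assoc)
qed

lemma basis_elt_closed: "x \<in> X \<Longrightarrow> basis_elt K x \<in> carrier (free_module K X)"
  by (auto simp: free_module_simps basis_elt_def)

text \<open>One coordinate at a time is split off, by induction on a finite set containing the support.\<close>

lemma basis_spans_free_module:
  "submodule_span K (free_module K X) (basis_elt K ` X) = carrier (free_module K X)"
proof (rule module_over.spanningI[OF module_over.intro[OF free_module_module]])
  interpret L: module K "free_module K X" by (rule free_module_module)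
  fix H assume H: "submodule H K (free_module K X)" and b: "basis_elt K ` X \<subseteq> H"
  note E = L.submoduleE[OF H]
  have zero: "(\<lambda>x. \<zero>) \<in> H"
    using submodule.axioms(1)[OF H] subgroup.one_closed by (fastforce simp: free_module_simps)
  have "p \<in> H" if "finite A" "A \<subseteq> X" "\<forall>x. p x \<in> carrier K" "{x. p x \<noteq> \<zero>} \<subseteq> A" for A p
    using that
  proof (induction A arbitrary: p rule: finite_induct)
    case empty
    then have "p = (\<lambda>x. \<zero>)" by auto
    then show ?case using zero by simp
  next
    case (insert x A)
    then have "p(x := \<zero>) \<in> H" by (intro insert.IH) auto
    moreover have "p x \<odot>\<^bsub>free_module K X\<^esub> basis_elt K x \<in> H" using insert.prems b by (intro E(4)) auto
    moreover have "p = p(x := \<zero>) \<oplus>\<^bsub>free_module K X\<^esub> (p x \<odot>\<^bsub>free_module K X\<^esub> basis_elt K x)"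
      using insert.prems by (auto simp: free_module_simps basis_elt_def fun_eq_iff)
    ultimately show ?case using E(5) by metis
  qed
  then show "carrier (free_module K X) \<subseteq> H"
    by (fastforce simp: free_module_simps)
qed (auto simp: basis_elt_closed)

end

context module_over
begin

text \<open>Summing over a common finite set makes the linear extensions of two functions comparable
  although their supports differ.\<close>

lemma lin_ext_superset:
  assumes "finite A" "{x. p x \<noteq> \<zero>\<^bsub>K\<^esub>} \<subseteq> A" "\<And>x. p x \<in> carrier K" "\<And>x. x \<in> A \<Longrightarrow> g x \<in> carrier M"
  shows "lin_ext K M g p = finsum M (\<lambda>x. p x \<odot>\<^bsub>M\<^esub> g x) A"
  unfolding lin_ext_def
  by (rule M.add.finprod_mono_neutral_cong_left) (use assms in auto)

lemma lin_ext_linear: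
  assumes "\<And>x. x \<in> X \<Longrightarrow> g x \<in> carrier M"
  shows "lin_ext K M g \<in> linear_maps K (free_module K X) M"
proof (rule linear_mapsI)
  fix p assume p: "p \<in> carrier (free_module K X)"
  then show "lin_ext K M g p \<in> carrier M"
    unfolding lin_ext_def by (intro M.finsum_closed) (use assms in \<open>auto simp: free_module_simps Pi_iff\<close>)
  fix q assume q: "q \<in> carrier (free_module K X)"
  define A where "A = {x. p x \<noteq> \<zero>\<^bsub>K\<^esub>} \<union> {x. q x \<noteq> \<zero>\<^bsub>K\<^esub>}"
  have A: "finite A" "A \<subseteq> X" using p q by (auto simp: A_def free_module_simps)
  then have g: "\<And>x. x \<in> A \<Longrightarrow> g x \<in> carrier M" using assms by auto
  have pq: "\<And>x. p x \<in> carrier K" "\<And>x. q x \<in> carrier K" using p q by (auto simp: free_module_simps)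
  have "lin_ext K M g (\<lambda>x. p x \<oplus>\<^bsub>K\<^esub> q x) = finsum M (\<lambda>x. (p x \<oplus>\<^bsub>K\<^esub> q x) \<odot>\<^bsub>M\<^esub> g x) A"
    by (rule lin_ext_superset) (use A g pq in \<open>auto simp: A_def\<close>)
  also have "\<dots> = finsum M (\<lambda>x. p x \<odot>\<^bsub>M\<^esub> g x \<oplus>\<^bsub>M\<^esub> q x \<odot>\<^bsub>M\<^esub> g x) A"
    by (rule M.finsum_cong') (use g pq in \<open>auto simp: smult_l_distr\<close>)
  also have "\<dots> = finsum M (\<lambda>x. p x \<odot>\<^bsub>M\<^esub> g x) A \<oplus>\<^bsub>M\<^esub> finsum M (\<lambda>x. q x \<odot>\<^bsub>M\<^esub> g x) A"
    by (rule M.finsum_addf) (use g pq in auto)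
  also have "finsum M (\<lambda>x. p x \<odot>\<^bsub>M\<^esub> g x) A = lin_ext K M g p"
    by (rule lin_ext_superset[symmetric]) (use A g pq in \<open>auto simp: A_def\<close>)
  also have "finsum M (\<lambda>x. q x \<odot>\<^bsub>M\<^esub> g x) A = lin_ext K M g q"
    by (rule lin_ext_superset[symmetric]) (use A g pq in \<open>auto simp: A_def\<close>)
  finally show "lin_ext K M g (p \<oplus>\<^bsub>free_module K X\<^esub> q) = lin_ext K M g p \<oplus>\<^bsub>M\<^esub> lin_ext K M g q"
    by (simp add: free_module_simps)
next
  fix a p assume a: "a \<in> carrier K" and p: "p \<in> carrier (free_module K X)"
  define A where "A = {x. p x \<noteq> \<zero>\<^bsub>K\<^esub>}"
  have A: "finite A" "A \<subseteq> X" using p by (auto simp: A_def free_module_simps)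
  then have g: "\<And>x. x \<in> A \<Longrightarrow> g x \<in> carrier M" using assms by auto
  have p': "\<And>x. p x \<in> carrier K" using p by (auto simp: free_module_simps)
  have "lin_ext K M g (\<lambda>x. a \<otimes>\<^bsub>K\<^esub> p x) = finsum M (\<lambda>x. (a \<otimes>\<^bsub>K\<^esub> p x) \<odot>\<^bsub>M\<^esub> g x) A"
    by (rule lin_ext_superset) (use A g a p' in \<open>auto simp: A_def\<close>)
  also have "\<dots> = finsum M (\<lambda>x. a \<odot>\<^bsub>M\<^esub> (p x \<odot>\<^bsub>M\<^esub> g x)) A"
    by (rule M.finsum_cong') (use g a p' in \<open>auto simp: smult_assoc1\<close>)
  also have "\<dots> = a \<odot>\<^bsub>M\<^esub> lin_ext K M g p"
    unfolding lin_ext_def A_def[symmetric]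
    by (rule finsum_smult_ldistr[symmetric]) (use A g a p' in auto)
  finally show "lin_ext K M g (a \<odot>\<^bsub>free_module K X\<^esub> p) = a \<odot>\<^bsub>M\<^esub> lin_ext K M g p"
    by (simp add: free_module_simps)
qed

lemma lin_ext_basis:
  assumes "g x \<in> carrier M"
  shows "lin_ext K M g (basis_elt K x) = g x"
proof -
  have "lin_ext K M g (basis_elt K x) = finsum M (\<lambda>y. basis_elt K x y \<odot>\<^bsub>M\<^esub> g y) {x}"
    by (rule lin_ext_superset) (auto simp: basis_elt_def assms)
  then show ?thesis using assms by (simp add: basis_elt_def)
qed

end

subsection \<open>Quotient modules\<close>

text \<open>The map induced on cosets by a map that is constant on each of them.\<close>

definition coset_lift :: "('m \<Rightarrow> 'q) \<Rightarrow> 'm set \<Rightarrow> 'q" where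
  "coset_lift h C = the_elem (h ` C)"

locale module_quotient = module_over K M for K :: "'k ring" and M :: "('k, 'm) module" (structure) +
  fixes N :: "'m set"
  assumes N: "submodule N K M"
begin

sublocale N: abelian_subgroup N M
  using N by (intro abelian_subgroupI3 additive_subgroupI M.abelian_group_axioms submodule.axioms(1))

lemma quot_carrier: "carrier (quot_module M N) = (\<lambda>x. N +> x) ` carrier M"
  by (auto simp: quot_module_def ring.defs module.defs FactRing_def A_RCOSETS_def')

lemma quot_zero: "\<zero>\<^bsub>quot_module M N\<^esub> = N"
  by (simp add: quot_module_def ring.defs module.defs FactRing_def)

lemma coset_diff:
  assumes "y \<in> carrier M" "x \<in> N +> y"
  shows "x \<in> carrier M" "x \<ominus> y \<in> N"
  using assms N.a_rcos_module_imp[of y x] N.a_elemrcos_carrier[of y x]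
  by (auto simp: M.minus_eq)

lemma coset_eqI:
  assumes "x \<in> carrier M" "y \<in> carrier M" "x \<ominus> y \<in> N"
  shows "N +> x = N +> y"
  using assms N.a_rcos_module_rev[of y x] N.a_repr_independence' by (auto simp: M.minus_eq)

lemma coset_of_member: "x \<in> N \<Longrightarrow> N +> x = N"
  by (rule N.a_rcos_const)

lemma quot_add:
  "x \<in> carrier M \<Longrightarrow> y \<in> carrier M \<Longrightarrow>
    (N +> x) \<oplus>\<^bsub>quot_module M N\<^esub> (N +> y) = N +> (x \<oplus> y)"
  by (simp add: quot_module_def ring.defs module.defs FactRing_def N.a_rcos_sum)

lemma quot_smult:
  assumes a: "a \<in> carrier K" and x: "x \<in> carrier M"
  shows "a \<odot>\<^bsub>quot_module M N\<^esub> (N +> x) = N +> (a \<odot> x)"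
proof -
  have "N +> (a \<odot> y) = N +> (a \<odot> x)" if "y \<in> N +> x" for y
  proof (rule coset_eqI)
    note y = coset_diff[OF x that]
    have "a \<odot> (y \<ominus> x) \<in> N" using submodule.smult_closed[OF N a y(2)] .
    then show "a \<odot> y \<ominus> a \<odot> x \<in> N"
      using a x y(1) by (simp add: M.minus_eq smult_r_distr smult_r_minus)
    show "a \<odot> y \<in> carrier M" using a y(1) by simp
  qed (use a x in simp)
  moreover have "x \<in> N +> x" using x by (rule N.a_rcos_self)
  ultimately have "(\<Union>y\<in>N +> x. N +> (a \<odot> y)) = N +> (a \<odot> x)"
    by blast
  then show ?thesis
    by (simp add: quot_module_def ring.defs module.defs)
qed

lemma quot_module_module: "module K (quot_module M N)"
proof (rule moduleI)
  show "abelian_group (quot_module M N)"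
  proof (rule abelian_groupI)
    have zero: "\<zero>\<^bsub>quot_module M N\<^esub> = N +> \<zero>"
      by (simp add: quot_zero coset_of_member)
    then show "\<zero>\<^bsub>quot_module M N\<^esub> \<in> carrier (quot_module M N)"
      by (simp add: quot_carrier)
    fix C assume "C \<in> carrier (quot_module M N)"
    then obtain x where x: "C = N +> x" "x \<in> carrier M" by (auto simp: quot_carrier)
    show "\<zero>\<^bsub>quot_module M N\<^esub> \<oplus>\<^bsub>quot_module M N\<^esub> C = C"
      unfolding zero x(1) by (simp add: x(2) quot_add)
    show "\<exists>D\<in>carrier (quot_module M N). D \<oplus>\<^bsub>quot_module M N\<^esub> C = \<zero>\<^bsub>quot_module M N\<^esub>"
      unfolding zero x(1) quot_carrier using x(2)
      by (intro bexI[of _ "N +> (\<ominus> x)"]) (auto simp: quot_add M.l_neg)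
  qed (auto simp: quot_carrier quot_add M.a_ac)
qed (auto simp: quot_carrier quot_add quot_smult smult_l_distr smult_r_distr smult_assoc1 R.is_cring)

lemma coset_linear: "(\<lambda>x. N +> x) \<in> linear_maps K M (quot_module M N)"
  by (intro linear_mapsI) (auto simp: quot_carrier quot_add quot_smult)

context
  fixes Q :: "('k, 'q) module" and h
  assumes Q: "module K Q" and h: "h \<in> linear_maps K M Q"
    and vanish: "\<And>x. x \<in> N \<Longrightarrow> h x = \<zero>\<^bsub>Q\<^esub>"
begin

interpretation two_modules K M Q
  using Q by (intro two_modules.intro module_axioms)

lemma constant_on_coset:
  assumes "x \<in> carrier M" "y \<in> N +> x" shows "h y = h x"
proof -
  note y = coset_diff[OF assms]
  have "h y \<ominus>\<^bsub>Q\<^esub> h x = \<zero>\<^bsub>Q\<^esub>" using vanish[OF y(2)] linear_diff[OF h y(1) assms(1)] by simp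
  then show ?thesis using linear_closed[OF h] y(1) assms(1) using module_over.diff_eq_zeroD[OF module_over.intro[OF Q]] by blast
qed

lemma coset_lift_coset:
  assumes "x \<in> carrier M" shows "coset_lift h (N +> x) = h x"
proof -
  have "h ` (N +> x) = {h x}"
    using constant_on_coset[OF assms] N.a_rcos_self[OF assms] by blast
  then show ?thesis by (simp add: coset_lift_def)
qed

lemma coset_lift_linear: "coset_lift h \<in> linear_maps K (quot_module M N) Q"
  using linear_closed[OF h] linear_add[OF h] linear_smult[OF h]
  by (intro linear_mapsI) (auto simp: quot_carrier quot_add quot_smult coset_lift_coset)

end

end


subsection \<open>Modules and algebras given by generators and relations\<close>

lemma free_algebra_simps [simp]:
  "carrier (free_algebra K X m e) = carrier (free_module K X)"
  "\<zero>\<^bsub>free_algebra K X m e\<^esub> = \<zero>\<^bsub>free_module K X\<^esub>"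
  "(\<oplus>\<^bsub>free_algebra K X m e\<^esub>) = (\<oplus>\<^bsub>free_module K X\<^esub>)"
  "(\<odot>\<^bsub>free_algebra K X m e\<^esub>) = (\<odot>\<^bsub>free_module K X\<^esub>)"
  "add_monoid (free_algebra K X m e) = add_monoid (free_module K X)"
  "(+>\<^bsub>free_algebra K X m e\<^esub>) = (+>\<^bsub>free_module K X\<^esub>)"
  "linear_maps K (free_algebra K X m e) Q = linear_maps K (free_module K X) Q"
  "submodule H K (free_algebra K X m e) = submodule H K (free_module K X)"
  by (simp_all add: free_algebra_def a_r_coset_def fun_eq_iff linear_maps_def
      submodule_def submodule_axioms_def)

lemma free_algebra_mult:
  "p \<otimes>\<^bsub>free_algebra K X m e\<^esub> q =
    lin_ext K (free_module K X) (\<lambda>x. lin_ext K (free_module K X) (m x) q) p"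
  by (simp add: free_algebra_def)

lemma free_algebra_one: "\<one>\<^bsub>free_algebra K X m e\<^esub> = e"
  by (simp add: free_algebra_def)

lemma (in coefficients) free_algebra_module: "module K (free_algebra K X m e)"
proof -
  interpret L: module K "free_module K X" by (rule free_module_module)
  have "abelian_group (free_algebra K X m e)"
  proof (rule abelian_groupI)
    show "\<exists>y\<in>carrier (free_algebra K X m e). y \<oplus>\<^bsub>free_algebra K X m e\<^esub> x = \<zero>\<^bsub>free_algebra K X m e\<^esub>"
      if "x \<in> carrier (free_algebra K X m e)" for x
      using that by (intro bexI[of _ "\<ominus>\<^bsub>free_module K X\<^esub> x"]) (auto simp: L.M.l_neg)
  qed (auto simp: L.M.a_ac)
  then show ?thesis
    by (intro moduleI is_cring) (auto simp: L.smult_l_distr L.smult_r_distr L.smult_assoc1)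
qed

text \<open>\<open>G\<close> is the module on the generators \<open>X\<close> with relations \<open>S\<close>; tensor products and
  the shuffle algebra are both of this form.\<close>

locale presentation = coefficients K for K :: "'k ring" (structure) +
  fixes X :: "'x set" and S :: "('x \<Rightarrow> 'k) set" and m :: "'x \<Rightarrow> 'x \<Rightarrow> ('x \<Rightarrow> 'k)" and e :: "'x \<Rightarrow> 'k"
  assumes relations: "S \<subseteq> carrier (free_module K X)"
begin

abbreviation "L \<equiv> free_module K X"
abbreviation "N \<equiv> submodule_span K L S"
abbreviation "G \<equiv> quot_module (free_algebra K X m e) N"
abbreviation cls :: "('x \<Rightarrow> 'k) \<Rightarrow> ('x \<Rightarrow> 'k) set" where "cls p \<equiv> N +>\<^bsub>L\<^esub> p"
abbreviation "gen x \<equiv> cls (basis_elt K x)"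

sublocale L: module_over K L
  by (intro module_over.intro free_module_module)

sublocale q: module_quotient K "free_algebra K X m e" N
  by (intro module_quotient.intro module_quotient_axioms.intro module_over.intro
      free_algebra_module) (simp add: L.submodule_span_submodule[OF relations])

lemmas G_module = q.quot_module_module

lemma cls_linear: "cls \<in> linear_maps K L G"
  using q.coset_linear by simp

lemma gen_closed: "x \<in> X \<Longrightarrow> gen x \<in> carrier G"
  using linear_closed[OF cls_linear basis_elt_closed] .

lemma cls_zero: "p \<in> N \<Longrightarrow> cls p = \<zero>\<^bsub>G\<^esub>"
  using q.coset_of_member q.quot_zero by simp

lemma generators_span: "submodule_span K G (gen ` X) = carrier G"
proof (rule module_over.spanningI[OF module_over.intro[OF G_module]])
  interpret LG: two_modules K L G by (intro two_modules.intro G_module free_module_module)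
  fix H assume H: "submodule H K G" "gen ` X \<subseteq> H"
  have "p \<in> {p \<in> carrier L. cls p \<in> H}" if "p \<in> carrier L" for p
    using H(2) basis_elt_closed
    by (intro spanning_induct[OF basis_spans_free_module LG.preimage_submodule[OF cls_linear H(1)] _ that]) auto
  then show "carrier G \<subseteq> H" by (auto simp: q.quot_carrier)
qed (auto simp: gen_closed)

definition lift :: "('k, 'q) module \<Rightarrow> ('x \<Rightarrow> 'q) \<Rightarrow> ('x \<Rightarrow> 'k) set \<Rightarrow> 'q" where
  "lift Q g = coset_lift (lin_ext K Q g)"

lemma linear_vanishes_on_span:
  assumes "module K Q" "h \<in> linear_maps K L Q" "\<And>s. s \<in> S \<Longrightarrow> h s = \<zero>\<^bsub>Q\<^esub>" "p \<in> N"
  shows "h p = \<zero>\<^bsub>Q\<^esub>"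
proof -
  interpret LQ: two_modules K L Q by (intro two_modules.intro assms free_module_module)
  have "submodule {p \<in> carrier L. h p = \<zero>\<^bsub>Q\<^esub>} K L"
    by (rule LQ.equalizer_submodule[OF assms(2) LQ.linear_zero_map])
  then show ?thesis using submodule_span_least[of _ K L S] assms(3,4) relations by blast
qed

lemma bilinear_vanishes_on_span:
  assumes Q: "module K Q" and b: "b \<in> bilinear_maps K L L Q"
    and S: "\<And>s x. s \<in> S \<Longrightarrow> x \<in> X \<Longrightarrow> b s (basis_elt K x) = \<zero>\<^bsub>Q\<^esub>"
    and p: "p \<in> N" and q: "q \<in> carrier L"
  shows "b p q = \<zero>\<^bsub>Q\<^esub>"
proof (rule linear_vanishes_on_span[OF Q bilinear_left[OF b q] _ p])
  interpret LQ: two_modules K L Q by (intro two_modules.intro Q free_module_module)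
  show "b s q = \<zero>\<^bsub>Q\<^esub>" if "s \<in> S" for s
    by (rule linear_eq_on_span[OF free_module_module Q basis_spans_free_module bilinear_right[OF b]
          LQ.linear_zero_map _ q])
      (use that relations S in auto)
qed

text \<open>The universal property of \<open>G\<close>: maps on generators that respect the relations extend.\<close>

lemma
  assumes Q: "module K Q" and g: "\<And>x. x \<in> X \<Longrightarrow> g x \<in> carrier Q"
    and S: "\<And>s. s \<in> S \<Longrightarrow> lin_ext K Q g s = \<zero>\<^bsub>Q\<^esub>"
  shows lift_linear: "lift Q g \<in> linear_maps K G Q"
    and lift_gen: "x \<in> X \<Longrightarrow> lift Q g (gen x) = g x"
proof -
  interpret Q: module_over K Q using Q by (rule module_over.intro)
  have lin: "lin_ext K Q g \<in> linear_maps K L Q" using g by (rule Q.lin_ext_linear)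
  note vanish = linear_vanishes_on_span[OF Q lin S]
  show "lift Q g \<in> linear_maps K G Q"
    unfolding lift_def by (rule q.coset_lift_linear) (simp_all add: Q lin vanish)
  show "lift Q g (gen x) = g x" if "x \<in> X"
    using q.coset_lift_coset[OF Q, of "lin_ext K Q g" "basis_elt K x"] that lin vanish g[OF that]
    by (simp add: lift_def basis_elt_closed Q.lin_ext_basis)
qed

end

text \<open>A product on the generators descends to the quotient if it respects the relations in each
  of its arguments, since the span of the relations is then an ideal of the free algebra.\<close>

locale presented_algebra = presentation +
  assumes prod_closed: "x \<in> X \<Longrightarrow> y \<in> X \<Longrightarrow> m x y \<in> carrier L"
    and prod_left: "s \<in> S \<Longrightarrow> y \<in> X \<Longrightarrow> lin_ext K G (\<lambda>x. cls (m x y)) s = \<zero>\<^bsub>G\<^esub>"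
    and prod_right: "s \<in> S \<Longrightarrow> x \<in> X \<Longrightarrow> lin_ext K G (\<lambda>y. cls (m x y)) s = \<zero>\<^bsub>G\<^esub>"
begin

sublocale G: module_over K G by (intro module_over.intro G_module)

abbreviation free_mult where "free_mult p q \<equiv> lin_ext K L (\<lambda>x. lin_ext K L (m x) q) p"

lemma free_mult_bilinear: "free_mult \<in> bilinear_maps K L L L"
proof -
  have lin: "lin_ext K L (m x) \<in> linear_maps K L L" if "x \<in> X" for x
    by (rule L.lin_ext_linear) (use that prod_closed in auto)
  have left: "(\<lambda>p. free_mult p q) \<in> linear_maps K L L" if "q \<in> carrier L" for q
    by (rule L.lin_ext_linear) (rule linear_closed[OF lin that])
  have "(\<lambda>q p. free_mult p q) \<in> bilinear_maps K L L L"
  proof (rule bilinear_from_span[OF free_module_module free_module_module free_module_module basis_spans_free_module])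
    fix b assume "b \<in> basis_elt K ` X"
    then obtain x where x: "b = basis_elt K x" "x \<in> X" by auto
    then have "free_mult b q = lin_ext K L (m x) q" if "q \<in> carrier L" for q
      using linear_closed[OF lin that] by (simp add: L.lin_ext_basis)
    then show "free_mult b \<in> linear_maps K L L"
      by (intro linear_cong[OF lin[OF x(2)]] free_module_module) simp
  qed (rule left)
  then show ?thesis by (auto simp: bilinear_maps_def)
qed

lemma free_mult_basis:
  assumes "x \<in> X" "y \<in> X" shows "free_mult (basis_elt K x) (basis_elt K y) = m x y"
  using assms prod_closed basis_elt_closed linear_closed[OF bilinear_right[OF free_mult_bilinear]]
    L.lin_ext_basis[of "\<lambda>x. lin_ext K L (m x) (basis_elt K y)" x] L.lin_ext_basis[of "m x" y] by simp

lemma cls_free_mult_right_linear: "p \<in> carrier L \<Longrightarrow> (\<lambda>q. cls (free_mult p q)) \<in> linear_maps K L G"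
  by (rule linear_comp[OF bilinear_right[OF free_mult_bilinear] cls_linear])

lemma cls_free_mult_left_linear: "q \<in> carrier L \<Longrightarrow> (\<lambda>p. cls (free_mult p q)) \<in> linear_maps K L G"
  by (rule linear_comp[OF bilinear_left[OF free_mult_bilinear] cls_linear])

lemma cls_free_mult_bilinear: "(\<lambda>p q. cls (free_mult p q)) \<in> bilinear_maps K L L G"
  by (intro bilinear_mapsI cls_free_mult_right_linear cls_free_mult_left_linear)

lemma cls_free_mult_relation_left:
  assumes s: "s \<in> S" and y: "y \<in> X" shows "cls (free_mult s (basis_elt K y)) = \<zero>\<^bsub>G\<^esub>"
proof -
  have sL: "s \<in> carrier L" using s relations by auto
  have "cls (free_mult s (basis_elt K y)) = lin_ext K G (\<lambda>x. cls (m x y)) s"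
    by (rule linear_eq_on_span[OF free_module_module G_module basis_spans_free_module cls_free_mult_left_linear _ _ sL])
      (use y prod_closed in \<open>auto simp: free_mult_basis basis_elt_closed G.lin_ext_basis linear_closed[OF cls_linear]
        intro!: G.lin_ext_linear\<close>)
  then show ?thesis using prod_left[OF s y] by simp
qed

lemma cls_free_mult_relation_right:
  assumes s: "s \<in> S" and x: "x \<in> X" shows "cls (free_mult (basis_elt K x) s) = \<zero>\<^bsub>G\<^esub>"
proof -
  have sL: "s \<in> carrier L" using s relations by auto
  have "cls (free_mult (basis_elt K x) s) = lin_ext K G (\<lambda>y. cls (m x y)) s"
    by (rule linear_eq_on_span[OF free_module_module G_module basis_spans_free_module cls_free_mult_right_linear _ _ sL])
      (use x prod_closed in \<open>auto simp: free_mult_basis basis_elt_closed G.lin_ext_basis linear_closed[OF cls_linear]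
        intro!: G.lin_ext_linear\<close>)
  then show ?thesis using prod_right[OF s x] by simp
qed

lemma cls_free_mult_left: "p \<in> N \<Longrightarrow> q \<in> carrier L \<Longrightarrow> cls (free_mult p q) = \<zero>\<^bsub>G\<^esub>"
  by (rule bilinear_vanishes_on_span[OF G_module cls_free_mult_bilinear cls_free_mult_relation_left])

lemma cls_free_mult_right: "p \<in> carrier L \<Longrightarrow> q \<in> N \<Longrightarrow> cls (free_mult p q) = \<zero>\<^bsub>G\<^esub>"
  by (rule bilinear_vanishes_on_span[OF G_module bilinear_swap[OF cls_free_mult_bilinear] cls_free_mult_relation_right])

text \<open>The product of two cosets is defined as a union over representatives. By the two preceding
  lemmas all its terms coincide.\<close>

lemma cls_mult:
  assumes p: "p \<in> carrier L" and q: "q \<in> carrier L"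
  shows "cls p \<otimes>\<^bsub>G\<^esub> cls q = cls (free_mult p q)"
proof -
  interpret LL: two_modules K L L by (intro two_modules.intro free_module_module)
  interpret LG: two_modules K L G by (intro two_modules.intro G_module free_module_module)
  note lin = cls_free_mult_right_linear and lin' = cls_free_mult_left_linear
  have eq: "cls (free_mult p' q') = cls (free_mult p q)" if p': "p' \<in> cls p" and q': "q' \<in> cls q" for p' q'
  proof -
    have cp: "p' \<in> carrier L" "p' \<ominus>\<^bsub>L\<^esub> p \<in> N" and cq: "q' \<in> carrier L" "q' \<ominus>\<^bsub>L\<^esub> q \<in> N"
      using q.coset_diff[of p p'] q.coset_diff[of q q'] p q p' q' by (simp_all add: a_minus_def a_inv_def)
    have "cls (free_mult p' q') = cls (free_mult p q')"
      using cls_free_mult_left[OF cp(2) cq(1)] LG.linear_diff[OF lin'[OF cq(1)] cp(1) p]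
        linear_closed[OF lin'[OF cq(1)]] cp(1) p by (simp add: G.diff_eq_zeroD)
    also have "\<dots> = cls (free_mult p q)"
      using cls_free_mult_right[OF p cq(2)] LG.linear_diff[OF lin[OF p] cq(1) q]
        linear_closed[OF lin[OF p]] cq(1) q by (simp add: G.diff_eq_zeroD)
    finally show ?thesis .
  qed
  have "p \<in> cls p" "q \<in> cls q" using p q q.N.a_rcos_self by auto
  with eq have "(\<Union>p'\<in>cls p. \<Union>q'\<in>cls q. cls (free_mult p' q')) = cls (free_mult p q)"
    by blast
  then show ?thesis
    by (simp add: quot_module_def ring.defs module.defs FactRing_def rcoset_mult_def free_algebra_mult)
qed

lemma G_mult_bilinear: "(\<otimes>\<^bsub>G\<^esub>) \<in> bilinear_maps K G G G"
proof -
  note cl = bilinear_closed[OF free_mult_bilinear]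
  note b = free_mult_bilinear
  have add: "cls p \<oplus>\<^bsub>G\<^esub> cls q = cls (p \<oplus>\<^bsub>L\<^esub> q)" if "p \<in> carrier L" "q \<in> carrier L" for p q
    using linear_add[OF cls_linear that] by simp
  have smult: "a \<odot>\<^bsub>G\<^esub> cls p = cls (a \<odot>\<^bsub>L\<^esub> p)" if "a \<in> carrier K" "p \<in> carrier L" for a p
    using linear_smult[OF cls_linear that] by simp
  show ?thesis
    by (intro bilinear_mapsI linear_mapsI)
      (auto simp: q.quot_carrier cls_mult add smult cl linear_add[OF bilinear_right[OF b]]
        linear_add[OF bilinear_left[OF b]] linear_smult[OF bilinear_right[OF b]]
        linear_smult[OF bilinear_left[OF b]])
qed

lemma gen_mult: "x \<in> X \<Longrightarrow> y \<in> X \<Longrightarrow> gen x \<otimes>\<^bsub>G\<^esub> gen y = cls (m x y)"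
  by (simp add: cls_mult basis_elt_closed free_mult_basis)

lemma G_one: "\<one>\<^bsub>G\<^esub> = cls e"
  by (simp add: quot_module_def ring.defs module.defs FactRing_def free_algebra_one)

end

section \<open>Tensor products\<close>

definition tensor_lift :: "'k ring \<Rightarrow> ('k, 'q) module \<Rightarrow> ('m \<Rightarrow> 'n \<Rightarrow> 'q) \<Rightarrow> ('m \<times> 'n \<Rightarrow> 'k) set \<Rightarrow> 'q" where
  "tensor_lift K Q b = coset_lift (lin_ext K Q (\<lambda>(x, y). b x y))"

context two_modules
begin

sublocale coefficients K
  by (rule coefficients.intro) (rule M.R.is_cring)

lemma bilinear_relations_closed:
  "bilinear_relations K M N \<subseteq> carrier (free_module K (carrier M \<times> carrier N))"
proof -
  interpret L: module K "free_module K (carrier M \<times> carrier N)" by (rule free_module_module)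
  note [simp] = basis_elt_closed[of "(_, _)" "carrier M \<times> carrier N", simplified]
  show ?thesis
    unfolding bilinear_relations_def Let_def
    by (auto intro!: L.M.minus_closed L.M.add.m_closed L.smult_closed)
qed

sublocale tensor: presentation K "carrier M \<times> carrier N" "bilinear_relations K M N"
  "\<lambda>(x, y) (x', y'). basis_elt K (x \<otimes>\<^bsub>M\<^esub> x', y \<otimes>\<^bsub>N\<^esub> y')" "basis_elt K (\<one>\<^bsub>M\<^esub>, \<one>\<^bsub>N\<^esub>)"
  by (intro presentation.intro presentation_axioms.intro bilinear_relations_closed coefficients_axioms)

lemma tensor_presentation: "tensor.G = tensor K M N"
  by (simp add: tensor_def tensor_kernel_def)

lemma pure_tensor_gen: "tensor.gen (x, y) = pure_tensor K M N x y"
  by (simp add: pure_tensor_def tensor_kernel_def)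

lemma tensor_module: "module K (tensor K M N)"
  using tensor.G_module by (simp add: tensor_presentation)

lemma pure_tensor_closed:
  "x \<in> carrier M \<Longrightarrow> y \<in> carrier N \<Longrightarrow> pure_tensor K M N x y \<in> carrier (tensor K M N)"
  using tensor.gen_closed[of "(x, y)"] by (simp add: tensor_presentation pure_tensor_gen)

text \<open>Linear maps on the free module that kill the relations are bilinear maps in disguise. Applied to
  the quotient map this says that pure tensors are bilinear; applied to linear extensions it
  gives the universal property.\<close>

lemma relations_vanish_iff:
  assumes Q: "module K Q" and h: "h \<in> linear_maps K tensor.L Q"
  shows "(\<forall>s\<in>bilinear_relations K M N. h s = \<zero>\<^bsub>Q\<^esub>) \<longleftrightarrow>
    (\<lambda>x y. h (basis_elt K (x, y))) \<in> bilinear_maps K M N Q" (is "?l \<longleftrightarrow> ?r")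
proof -
  interpret LQ: two_modules K tensor.L Q by (intro two_modules.intro Q free_module_module)
  note b = basis_elt_closed[of "(_, _)" "carrier M \<times> carrier N", simplified]
  note cl = linear_closed[OF h]
  note lin = LQ.linear_diff[OF h] linear_add[OF h] linear_smult[OF h]
  have diff: "p \<ominus>\<^bsub>Q\<^esub> q = \<zero>\<^bsub>Q\<^esub> \<longleftrightarrow> p = q" if "p \<in> carrier Q" "q \<in> carrier Q" for p q
    using module_over.diff_eq_zeroD[OF module_over.intro[OF Q]] that
    by (auto simp: LQ.N.M.minus_eq LQ.N.M.r_neg)
  have rel: "h (basis_elt K (x \<oplus>\<^bsub>M\<^esub> x', y) \<ominus>\<^bsub>tensor.L\<^esub> (basis_elt K (x, y) \<oplus>\<^bsub>tensor.L\<^esub> basis_elt K (x', y))) = \<zero>\<^bsub>Q\<^esub>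
      \<longleftrightarrow> h (basis_elt K (x \<oplus>\<^bsub>M\<^esub> x', y)) = h (basis_elt K (x, y)) \<oplus>\<^bsub>Q\<^esub> h (basis_elt K (x', y))"
      "h (basis_elt K (x, y \<oplus>\<^bsub>N\<^esub> y') \<ominus>\<^bsub>tensor.L\<^esub> (basis_elt K (x, y) \<oplus>\<^bsub>tensor.L\<^esub> basis_elt K (x, y'))) = \<zero>\<^bsub>Q\<^esub>
      \<longleftrightarrow> h (basis_elt K (x, y \<oplus>\<^bsub>N\<^esub> y')) = h (basis_elt K (x, y)) \<oplus>\<^bsub>Q\<^esub> h (basis_elt K (x, y'))"
      "h (basis_elt K (a \<odot>\<^bsub>M\<^esub> x, y) \<ominus>\<^bsub>tensor.L\<^esub> (a \<odot>\<^bsub>tensor.L\<^esub> basis_elt K (x, y))) = \<zero>\<^bsub>Q\<^esub>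
      \<longleftrightarrow> h (basis_elt K (a \<odot>\<^bsub>M\<^esub> x, y)) = a \<odot>\<^bsub>Q\<^esub> h (basis_elt K (x, y))"
      "h (basis_elt K (x, a \<odot>\<^bsub>N\<^esub> y) \<ominus>\<^bsub>tensor.L\<^esub> (a \<odot>\<^bsub>tensor.L\<^esub> basis_elt K (x, y))) = \<zero>\<^bsub>Q\<^esub>
      \<longleftrightarrow> h (basis_elt K (x, a \<odot>\<^bsub>N\<^esub> y)) = a \<odot>\<^bsub>Q\<^esub> h (basis_elt K (x, y))"
    if "a \<in> carrier K" "x \<in> carrier M" "x' \<in> carrier M" "y \<in> carrier N" "y' \<in> carrier N" for a x x' y y'
    using that by (simp_all add: b cl lin diff)
  have "?l \<longleftrightarrow> (\<forall>x\<in>carrier M. \<forall>x'\<in>carrier M. \<forall>y\<in>carrier N.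
        h (basis_elt K (x \<oplus>\<^bsub>M\<^esub> x', y)) = h (basis_elt K (x, y)) \<oplus>\<^bsub>Q\<^esub> h (basis_elt K (x', y))) \<and>
      (\<forall>x\<in>carrier M. \<forall>y\<in>carrier N. \<forall>y'\<in>carrier N.
        h (basis_elt K (x, y \<oplus>\<^bsub>N\<^esub> y')) = h (basis_elt K (x, y)) \<oplus>\<^bsub>Q\<^esub> h (basis_elt K (x, y'))) \<and>
      (\<forall>a\<in>carrier K. \<forall>x\<in>carrier M. \<forall>y\<in>carrier N.
        h (basis_elt K (a \<odot>\<^bsub>M\<^esub> x, y)) = a \<odot>\<^bsub>Q\<^esub> h (basis_elt K (x, y))) \<and>
      (\<forall>a\<in>carrier K. \<forall>x\<in>carrier M. \<forall>y\<in>carrier N.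
        h (basis_elt K (x, a \<odot>\<^bsub>N\<^esub> y)) = a \<odot>\<^bsub>Q\<^esub> h (basis_elt K (x, y)))"
    unfolding bilinear_relations_def Let_def ball_Un conj_assoc
  proof (intro arg_cong2[of _ _ _ _ "(\<and>)"], goal_cases)
    case 1 show ?case using rel(1)[OF M.R.zero_closed _ _ _ N.M.zero_closed] by blast
  next
    case 2 show ?case using rel(2)[OF M.R.zero_closed _ M.M.zero_closed] by blast
  next
    case 3 show ?case using rel(3)[OF _ _ M.M.zero_closed _ N.M.zero_closed] by blast
  next
    case 4 show ?case using rel(4)[OF _ _ M.M.zero_closed _ N.M.zero_closed] by blast
  qed
  also have "\<dots> \<longleftrightarrow> ?r"
    unfolding bilinear_maps_def linear_maps_def by (auto simp: b cl)
  finally show ?thesis .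
qed

lemma pure_tensor_bilinear: "pure_tensor K M N \<in> bilinear_maps K M N (tensor K M N)"
proof -
  have "tensor.cls s = \<zero>\<^bsub>tensor.G\<^esub>" if "s \<in> bilinear_relations K M N" for s
    by (rule tensor.cls_zero[OF subsetD[OF submodule_span_superset that]])
  with relations_vanish_iff[OF tensor.G_module tensor.cls_linear]
  have "(\<lambda>x y. tensor.gen (x, y)) \<in> bilinear_maps K M N tensor.G" by blast
  then show ?thesis by (simp only: pure_tensor_gen tensor_presentation)
qed

lemma
  assumes Q: "module K Q" and b: "b \<in> bilinear_maps K M N Q"
  shows lin_ext_bilinear_vanishes:
      "s \<in> bilinear_relations K M N \<Longrightarrow> lin_ext K Q (\<lambda>(x, y). b x y) s = \<zero>\<^bsub>Q\<^esub>"
    and tensor_lift_linear: "tensor_lift K Q b \<in> linear_maps K (tensor K M N) Q"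
    and tensor_lift_pure:
      "x \<in> carrier M \<Longrightarrow> y \<in> carrier N \<Longrightarrow> tensor_lift K Q b (pure_tensor K M N x y) = b x y"
proof -
  interpret Q: module_over K Q using Q by (rule module_over.intro)
  have cl: "(case z of (x, y) \<Rightarrow> b x y) \<in> carrier Q" if "z \<in> carrier M \<times> carrier N" for z
    using that bilinear_closed[OF b] by auto
  have lin: "lin_ext K Q (\<lambda>(x, y). b x y) \<in> linear_maps K tensor.L Q"
    by (rule Q.lin_ext_linear) (rule cl)
  have "(\<lambda>x y. lin_ext K Q (\<lambda>(x, y). b x y) (basis_elt K (x, y))) \<in> bilinear_maps K M N Q"
  proof -
    have "lin_ext K Q (\<lambda>(x, y). b x y) (basis_elt K (x, y)) = b x y" if "x \<in> carrier M" "y \<in> carrier N" for x y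
      using Q.lin_ext_basis[of "\<lambda>(x, y). b x y" "(x, y)"] cl[of "(x, y)"] that by simp
    then show ?thesis using b by (simp add: bilinear_maps_def linear_maps_def Pi_iff)
  qed
  then have vanish: "\<And>s. s \<in> bilinear_relations K M N \<Longrightarrow> lin_ext K Q (\<lambda>(x, y). b x y) s = \<zero>\<^bsub>Q\<^esub>"
    using relations_vanish_iff[OF Q lin] by blast
  then show "s \<in> bilinear_relations K M N \<Longrightarrow> lin_ext K Q (\<lambda>(x, y). b x y) s = \<zero>\<^bsub>Q\<^esub>" .
  show "tensor_lift K Q b \<in> linear_maps K (tensor K M N) Q"
    using tensor.lift_linear[OF Q cl vanish] by (simp add: tensor.lift_def tensor_lift_def tensor_presentation)
  show "tensor_lift K Q b (pure_tensor K M N x y) = b x y" if "x \<in> carrier M" "y \<in> carrier N"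
    using tensor.lift_gen[OF Q cl vanish, of "(x, y)"] that
    by (simp add: tensor.lift_def tensor_lift_def pure_tensor_gen)
qed

lemma pure_tensors_span:
  assumes S: "submodule_span K M S = carrier M" and T: "submodule_span K N T = carrier N"
  shows "submodule_span K (tensor K M N) ((\<lambda>(x, y). pure_tensor K M N x y) ` (S \<times> T)) = carrier (tensor K M N)"
proof (rule module_over.spanningI[OF module_over.intro[OF tensor_module]])
  have sub: "S \<subseteq> carrier M" "T \<subseteq> carrier N" using S T submodule_span_superset by metis+
  then show "(\<lambda>(x, y). pure_tensor K M N x y) ` (S \<times> T) \<subseteq> carrier (tensor K M N)"
    by (auto intro!: pure_tensor_closed)
  fix H assume H: "submodule H K (tensor K M N)" "(\<lambda>(x, y). pure_tensor K M N x y) ` (S \<times> T) \<subseteq> H"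
  interpret MT: two_modules K M "tensor K M N" by (intro two_modules.intro M.module_axioms tensor_module)
  interpret NT: two_modules K N "tensor K M N" by (intro two_modules.intro N.module_axioms tensor_module)
  note b = pure_tensor_bilinear
  have 1: "pure_tensor K M N x y \<in> H" if "x \<in> S" "y \<in> carrier N" for x y
  proof -
    have "x \<in> carrier M" using that sub by auto
    from spanning_induct[OF T NT.preimage_submodule[OF bilinear_right[OF b this] H(1)] _ that(2)]
    show ?thesis using sub H(2) that(1) by auto
  qed
  have 2: "pure_tensor K M N x y \<in> H" if "x \<in> carrier M" "y \<in> carrier N" for x y
    using spanning_induct[OF S MT.preimage_submodule[OF bilinear_left[OF b that(2)] H(1)] _ that(1)] 1 that sub by auto
  show "carrier (tensor K M N) \<subseteq> H"
    unfolding tensor_presentation[symmetric]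
    using 2 H(1)
    by (subst tensor.generators_span[symmetric], intro submodule_span_least)
       (auto simp: tensor_presentation pure_tensor_gen)
qed

end

lemma carrier_spans:
  assumes "module K M" shows "submodule_span K M (carrier M) = carrier M"
  by (rule module_over.spanningI[OF module_over.intro[OF assms]]) auto

text \<open>The value of \<^const>\<open>tensor_map\<close> on a coset is a union over its representatives. It is well
  behaved because \<open>f \<otimes> g\<close> on free modules maps relations to relations.\<close>

locale two_linear_maps = src: two_modules K M' N' + tgt: two_modules K M N
  for K :: "'k ring" and M' :: "('k, 'm1) module" and N' :: "('k, 'n1) module"
    and M :: "('k, 'm) module" and N :: "('k, 'n) module" +
  fixes f :: "'m1 \<Rightarrow> 'm" and g :: "'n1 \<Rightarrow> 'n"
  assumes f: "f \<in> linear_maps K M' M" and g: "g \<in> linear_maps K N' N"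
begin

abbreviation "map_on_free \<equiv> lin_ext K tgt.tensor.L (\<lambda>(x, y). basis_elt K (f x, g y))"

lemma map_on_free_linear: "map_on_free \<in> linear_maps K src.tensor.L tgt.tensor.L"
  by (rule tgt.tensor.L.lin_ext_linear)
    (auto intro!: src.basis_elt_closed linear_closed[OF f] linear_closed[OF g])

lemma map_on_free_basis:
  assumes "x \<in> carrier M'" "y \<in> carrier N'"
  shows "map_on_free (basis_elt K (x, y)) = basis_elt K (f x, g y)"
  using tgt.tensor.L.lin_ext_basis[of "\<lambda>(x, y). basis_elt K (f x, g y)" "(x, y)"] assms
  by (simp add: src.basis_elt_closed linear_closed[OF f] linear_closed[OF g])

lemma cls_map_linear: "(\<lambda>p. tgt.tensor.cls (map_on_free p)) \<in> linear_maps K src.tensor.L tgt.tensor.G"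
  by (rule linear_comp[OF map_on_free_linear tgt.tensor.cls_linear])

lemma cls_map_vanishes:
  assumes "p \<in> src.tensor.N" shows "tgt.tensor.cls (map_on_free p) = \<zero>\<^bsub>tgt.tensor.G\<^esub>"
proof (rule src.tensor.linear_vanishes_on_span[OF tgt.tensor.G_module cls_map_linear _ assms])
  have "(\<lambda>x y. pure_tensor K M N (f x) (g y)) \<in> bilinear_maps K M' N' (tensor K M N)"
    by (intro bilinear_mapsI linear_bilinear_right[OF tgt.pure_tensor_bilinear]
        linear_bilinear_left[OF tgt.pure_tensor_bilinear] f g linear_closed[OF f] linear_closed[OF g])
  then have "(\<lambda>x y. tgt.tensor.cls (map_on_free (basis_elt K (x, y)))) \<in> bilinear_maps K M' N' tgt.tensor.G"
    unfolding tgt.tensor_presentation tgt.pure_tensor_gen[symmetric]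
    by (simp add: bilinear_maps_def linear_maps_def map_on_free_basis Pi_iff)
  with src.relations_vanish_iff[OF tgt.tensor.G_module cls_map_linear]
  show "tgt.tensor.cls (map_on_free s) = \<zero>\<^bsub>tgt.tensor.G\<^esub>" if "s \<in> bilinear_relations K M' N'" for s
    using that by blast
qed

lemma tensor_map_cls:
  assumes p: "p \<in> carrier src.tensor.L"
  shows "tensor_map K M N f g (src.tensor.cls p) = tgt.tensor.cls (map_on_free p)"
proof -
  have "tgt.tensor.cls (map_on_free q) = tgt.tensor.cls (map_on_free p)" if "q \<in> src.tensor.cls p" for q
    using src.tensor.q.constant_on_coset[OF tgt.tensor.G_module _ cls_map_vanishes, where x=p and y=q] that cls_map_linear p
    by simp
  moreover have "p \<in> src.tensor.cls p" using p src.tensor.q.N.a_rcos_self by simp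
  ultimately show ?thesis
    unfolding tensor_map_def Let_def tensor_kernel_def by blast
qed

lemma tensor_map_pure:
  "x \<in> carrier M' \<Longrightarrow> y \<in> carrier N' \<Longrightarrow>
    tensor_map K M N f g (pure_tensor K M' N' x y) = pure_tensor K M N (f x) (g y)"
  using tensor_map_cls[of "basis_elt K (x, y)"]
  by (simp add: src.pure_tensor_gen tgt.pure_tensor_gen map_on_free_basis src.basis_elt_closed)

lemma tensor_map_linear: "tensor_map K M N f g \<in> linear_maps K (tensor K M' N') (tensor K M N)"
proof -
  note add = linear_add[OF src.tensor.cls_linear, symmetric] linear_add[OF cls_map_linear]
  note smult = linear_smult[OF src.tensor.cls_linear, symmetric] linear_smult[OF cls_map_linear]
  note cl = linear_closed[OF cls_map_linear]
  have "tensor_map K M N f g \<in> linear_maps K src.tensor.G tgt.tensor.G"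
    by (rule linear_mapsI) (auto simp: src.tensor.q.quot_carrier tensor_map_cls add smult cl)
  then show ?thesis by (simp only: src.tensor_presentation tgt.tensor_presentation)
qed

end

locale two_algebras = A1: algebra K M + A2: algebra K N
  for K :: "'k ring" and M :: "('k, 'm) module" and N :: "('k, 'n) module"
begin

sublocale two_modules K M N
  by (intro two_modules.intro A1.module_axioms A2.module_axioms)

abbreviation pure where "pure \<equiv> pure_tensor K M N"

lemma tensor_presented_algebra:
  "presented_algebra K (carrier M \<times> carrier N) (bilinear_relations K M N)
    (\<lambda>(x, y) (x', y'). basis_elt K (x \<otimes>\<^bsub>M\<^esub> x', y \<otimes>\<^bsub>N\<^esub> y')) (basis_elt K (\<one>\<^bsub>M\<^esub>, \<one>\<^bsub>N\<^esub>))"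
proof (intro presented_algebra.intro presented_algebra_axioms.intro tensor.presentation_axioms)
  note m1 = mult_bilinear[OF A1.algebra_axioms] and m2 = mult_bilinear[OF A2.algebra_axioms]
  note lin = linear_bilinear_right[OF pure_tensor_bilinear] linear_bilinear_left[OF pure_tensor_bilinear]
    bilinear_right[OF m1] bilinear_right[OF m2] bilinear_left[OF m1] bilinear_left[OF m2]
  have L: "(\<lambda>x y. tensor.gen (x \<otimes>\<^bsub>M\<^esub> a, y \<otimes>\<^bsub>N\<^esub> b)) \<in> bilinear_maps K M N tensor.G"
    if "a \<in> carrier M" "b \<in> carrier N" for a b
    unfolding pure_tensor_gen tensor_presentation
    using that by (intro bilinear_mapsI) (auto intro!: lin)
  have R: "(\<lambda>x y. tensor.gen (a \<otimes>\<^bsub>M\<^esub> x, b \<otimes>\<^bsub>N\<^esub> y)) \<in> bilinear_maps K M N tensor.G"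
    if "a \<in> carrier M" "b \<in> carrier N" for a b
    unfolding pure_tensor_gen tensor_presentation
    using that by (intro bilinear_mapsI) (auto intro!: lin)
  fix s z assume s: "s \<in> bilinear_relations K M N" and z: "z \<in> carrier M \<times> carrier N"
  then show "lin_ext K tensor.G (\<lambda>x. tensor.cls ((case x of (x, y) \<Rightarrow>
      \<lambda>(x', y'). basis_elt K (x \<otimes>\<^bsub>M\<^esub> x', y \<otimes>\<^bsub>N\<^esub> y')) z)) s = \<zero>\<^bsub>tensor.G\<^esub>"
    using lin_ext_bilinear_vanishes[OF tensor.G_module L s] by (auto simp: case_prod_unfold)
  show "lin_ext K tensor.G (\<lambda>y. tensor.cls ((case z of (x, y) \<Rightarrow>
      \<lambda>(x', y'). basis_elt K (x \<otimes>\<^bsub>M\<^esub> x', y \<otimes>\<^bsub>N\<^esub> y')) y)) s = \<zero>\<^bsub>tensor.G\<^esub>"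
    using z lin_ext_bilinear_vanishes[OF tensor.G_module R s] by (auto simp: case_prod_unfold)
qed (auto intro!: basis_elt_closed)

lemma tensor_mult_bilinear: "(\<otimes>\<^bsub>tensor K M N\<^esub>) \<in> bilinear_maps K (tensor K M N) (tensor K M N) (tensor K M N)"
  using presented_algebra.G_mult_bilinear[OF tensor_presented_algebra] by (simp only: tensor_presentation)

lemma tensor_mult_pure:
  assumes "x \<in> carrier M" "y \<in> carrier N" "x' \<in> carrier M" "y' \<in> carrier N"
  shows "pure x y \<otimes>\<^bsub>tensor K M N\<^esub> pure x' y' = pure (x \<otimes>\<^bsub>M\<^esub> x') (y \<otimes>\<^bsub>N\<^esub> y')"
  using presented_algebra.gen_mult[OF tensor_presented_algebra, of "(x, y)" "(x', y')"] assms
  by (simp only: tensor_presentation pure_tensor_gen mem_Times_iff fst_conv snd_conv prod.case)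

lemma tensor_one: "\<one>\<^bsub>tensor K M N\<^esub> = pure \<one>\<^bsub>M\<^esub> \<one>\<^bsub>N\<^esub>"
  using presented_algebra.G_one[OF tensor_presented_algebra]
  by (simp only: tensor_presentation pure_tensor_gen)

lemma tensor_algebra: "algebra K (tensor K M N)"
proof (rule algebra_from_spanning_set[OF tensor_module pure_tensors_span tensor_mult_bilinear])
  show "submodule_span K M (carrier M) = carrier M" "submodule_span K N (carrier N) = carrier N"
    by (intro carrier_spans A1.module_axioms A2.module_axioms)+
  show "u \<otimes>\<^bsub>tensor K M N\<^esub> v = v \<otimes>\<^bsub>tensor K M N\<^esub> u"
    if "u \<in> (\<lambda>(x, y). pure x y) ` (carrier M \<times> carrier N)"
      "v \<in> (\<lambda>(x, y). pure x y) ` (carrier M \<times> carrier N)" for u v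
  proof -
    from that obtain x y x' y' where *: "u = pure x y" "v = pure x' y'"
      "x \<in> carrier M" "y \<in> carrier N" "x' \<in> carrier M" "y' \<in> carrier N" by auto
    then have "x \<otimes>\<^bsub>M\<^esub> x' = x' \<otimes>\<^bsub>M\<^esub> x" "y \<otimes>\<^bsub>N\<^esub> y' = y' \<otimes>\<^bsub>N\<^esub> y"
      by (intro A1.m_comm A2.m_comm; simp)+
    then show ?thesis using * by (simp add: tensor_mult_pure)
  qed
qed (auto simp: tensor_one tensor_mult_pure pure_tensor_closed A1.m_assoc A2.m_assoc)

end

section \<open>The shuffle algebra\<close>

definition multilinear_maps :: "'k ring \<Rightarrow> ('k, 'v) module \<Rightarrow> ('k, 'q) module \<Rightarrow> ('v list \<Rightarrow> 'q) set" where
  "multilinear_maps K V Q = {g \<in> lists (carrier V) \<rightarrow> carrier Q.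
     \<forall>s\<in>lists (carrier V). \<forall>t\<in>lists (carrier V). (\<lambda>x. g (s @ [x] @ t)) \<in> linear_maps K V Q}"

lemma multilinear_mapsI:
  assumes "\<And>w. w \<in> lists (carrier V) \<Longrightarrow> g w \<in> carrier Q"
    and "\<And>s t. s \<in> lists (carrier V) \<Longrightarrow> t \<in> lists (carrier V) \<Longrightarrow>
      (\<lambda>x. g (s @ [x] @ t)) \<in> linear_maps K V Q"
  shows "g \<in> multilinear_maps K V Q"
  using assms by (auto simp: multilinear_maps_def)

lemma multilinear_closed: "g \<in> multilinear_maps K V Q \<Longrightarrow> w \<in> lists (carrier V) \<Longrightarrow> g w \<in> carrier Q"
  unfolding multilinear_maps_def by blast

lemma multilinear_linear:
  "g \<in> multilinear_maps K V Q \<Longrightarrow> s \<in> lists (carrier V) \<Longrightarrow> t \<in> lists (carrier V) \<Longrightarrow>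
      (\<lambda>x. g (s @ [x] @ t)) \<in> linear_maps K V Q"
  unfolding multilinear_maps_def by blast

lemma multilinear_cong:
  assumes "g \<in> multilinear_maps K V Q" "\<And>w. w \<in> lists (carrier V) \<Longrightarrow> g w = g' w" "module K V"
  shows "g' \<in> multilinear_maps K V Q"
proof (rule multilinear_mapsI)
  show "(\<lambda>x. g' (s @ [x] @ t)) \<in> linear_maps K V Q"
    if "s \<in> lists (carrier V)" "t \<in> lists (carrier V)" for s t
    by (rule linear_cong[OF multilinear_linear[OF assms(1) that] _ assms(3)])
       (use that in \<open>auto intro!: assms(2)\<close>)
qed (use assms(2) multilinear_closed[OF assms(1)] in auto)

definition word_lift :: "'k ring \<Rightarrow> ('k, 'q) module \<Rightarrow> ('v list \<Rightarrow> 'q) \<Rightarrow> ('v list \<Rightarrow> 'k) set \<Rightarrow> 'q" where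
  "word_lift K Q g = coset_lift (lin_ext K Q g)"

locale shuffle_algebra = V: module_over K V for K :: "'k ring" and V :: "('k, 'v) module"
begin

sublocale coefficients K
  by (rule coefficients.intro) (rule V.R.is_cring)

abbreviation "W \<equiv> lists (carrier V)"

lemma multilinear_relations_closed: "multilinear_relations K V \<subseteq> carrier (free_module K W)"
proof -
  interpret L: module K "free_module K W" by (rule free_module_module)
  show ?thesis
    unfolding multilinear_relations_def Let_def
    by (auto intro!: basis_elt_closed L.M.minus_closed L.M.add.m_closed L.smult_closed)
qed

sublocale words: presentation K W "multilinear_relations K V" "shuffle K (carrier V)" "basis_elt K []"
  by (intro presentation.intro presentation_axioms.intro multilinear_relations_closed coefficients_axioms)

abbreviation "S \<equiv> Sh K V"
abbreviation "word \<equiv> word_tensor K V"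
abbreviation sh_mult (infixl "\<star>" 70) where "p \<star> q \<equiv> p \<otimes>\<^bsub>S\<^esub> q"
abbreviation sh_add (infixl "\<boxplus>" 65) where "p \<boxplus> q \<equiv> p \<oplus>\<^bsub>S\<^esub> q"

lemma Sh_presentation: "words.G = S"
  by (simp add: Sh_def words_kernel_def)

lemma word_gen: "words.gen w = word w"
  by (simp add: word_tensor_def words_kernel_def)

lemma Sh_module: "module K S"
  using words.G_module by (simp only: Sh_presentation)

sublocale S: module_over K S by (rule module_over.intro[OF Sh_module])

lemma word_closed: "w \<in> W \<Longrightarrow> word w \<in> carrier S"
  using words.gen_closed[of w] by (simp only: Sh_presentation word_gen)

lemma words_span: "submodule_span K S (word ` W) = carrier S"
  using words.generators_span by (simp only: Sh_presentation word_gen)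

text \<open>As for tensor products: killing the relations of multilinearity means being multilinear in
  the letters of each word.\<close>

lemma relations_vanish_iff:
  assumes Q: "module K Q" and h: "h \<in> linear_maps K words.L Q"
  shows "(\<forall>s\<in>multilinear_relations K V. h s = \<zero>\<^bsub>Q\<^esub>) \<longleftrightarrow>
    (\<lambda>w. h (basis_elt K w)) \<in> multilinear_maps K V Q" (is "?l \<longleftrightarrow> ?r")
proof -
  interpret LQ: two_modules K words.L Q by (intro two_modules.intro Q free_module_module)
  note b = basis_elt_closed[of _ W]
  note cl = linear_closed[OF h]
  note lin = LQ.linear_diff[OF h] linear_add[OF h] linear_smult[OF h]
  have diff: "p \<ominus>\<^bsub>Q\<^esub> q = \<zero>\<^bsub>Q\<^esub> \<longleftrightarrow> p = q" if "p \<in> carrier Q" "q \<in> carrier Q" for p q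
    using module_over.diff_eq_zeroD[OF module_over.intro[OF Q]] that
    by (auto simp: LQ.N.M.minus_eq LQ.N.M.r_neg)
  have rel: "h (basis_elt K (s @ [x \<oplus>\<^bsub>V\<^esub> y] @ t) \<ominus>\<^bsub>words.L\<^esub> (basis_elt K (s @ [x] @ t) \<oplus>\<^bsub>words.L\<^esub> basis_elt K (s @ [y] @ t))) = \<zero>\<^bsub>Q\<^esub>
      \<longleftrightarrow> h (basis_elt K (s @ [x \<oplus>\<^bsub>V\<^esub> y] @ t)) = h (basis_elt K (s @ [x] @ t)) \<oplus>\<^bsub>Q\<^esub> h (basis_elt K (s @ [y] @ t))"
      "h (basis_elt K (s @ [a \<odot>\<^bsub>V\<^esub> x] @ t) \<ominus>\<^bsub>words.L\<^esub> (a \<odot>\<^bsub>words.L\<^esub> basis_elt K (s @ [x] @ t))) = \<zero>\<^bsub>Q\<^esub>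
      \<longleftrightarrow> h (basis_elt K (s @ [a \<odot>\<^bsub>V\<^esub> x] @ t)) = a \<odot>\<^bsub>Q\<^esub> h (basis_elt K (s @ [x] @ t))"
    if "a \<in> carrier K" "x \<in> carrier V" "y \<in> carrier V" "s \<in> W" "t \<in> W" for a x y s t
    using that by (simp_all add: b cl lin diff)
  have "?l \<longleftrightarrow> (\<forall>s\<in>W. \<forall>t\<in>W. \<forall>x\<in>carrier V. \<forall>y\<in>carrier V. h (basis_elt K (s @ [x \<oplus>\<^bsub>V\<^esub> y] @ t)) =
          h (basis_elt K (s @ [x] @ t)) \<oplus>\<^bsub>Q\<^esub> h (basis_elt K (s @ [y] @ t))) \<and>
      (\<forall>s\<in>W. \<forall>t\<in>W. \<forall>a\<in>carrier K. \<forall>x\<in>carrier V. h (basis_elt K (s @ [a \<odot>\<^bsub>V\<^esub> x] @ t)) =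
          a \<odot>\<^bsub>Q\<^esub> h (basis_elt K (s @ [x] @ t)))"
    unfolding multilinear_relations_def Let_def ball_Un
  proof (intro arg_cong2[of _ _ _ _ "(\<and>)"], goal_cases)
    case 1 show ?case using rel(1)[OF V.R.zero_closed] by blast
  next
    case 2 show ?case using rel(2)[OF _ _ V.M.zero_closed] by blast
  qed
  also have "\<dots> \<longleftrightarrow> ?r"
    unfolding multilinear_maps_def linear_maps_def by (auto simp: b cl del: in_listsD in_listsI)
  finally show ?thesis .
qed

lemma word_multilinear: "word \<in> multilinear_maps K V S"
proof -
  have "words.cls s = \<zero>\<^bsub>words.G\<^esub>" if "s \<in> multilinear_relations K V" for s
    by (rule words.cls_zero[OF subsetD[OF submodule_span_superset that]])
  with relations_vanish_iff[OF words.G_module words.cls_linear]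
  have "(\<lambda>w. words.gen w) \<in> multilinear_maps K V words.G" by blast
  then show ?thesis by (simp only: word_gen Sh_presentation)
qed

lemma
  assumes Q: "module K Q" and g: "g \<in> multilinear_maps K V Q"
  shows lin_ext_multilinear_vanishes: "s \<in> multilinear_relations K V \<Longrightarrow> lin_ext K Q g s = \<zero>\<^bsub>Q\<^esub>"
    and word_lift_linear: "word_lift K Q g \<in> linear_maps K S Q"
    and word_lift_word: "w \<in> W \<Longrightarrow> word_lift K Q g (word w) = g w"
proof -
  interpret Q: module_over K Q using Q by (rule module_over.intro)
  note cl = multilinear_closed[OF g]
  have lin: "lin_ext K Q g \<in> linear_maps K words.L Q"
    by (rule Q.lin_ext_linear) (rule cl)
  have "(\<lambda>w. lin_ext K Q g (basis_elt K w)) \<in> multilinear_maps K V Q"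
    by (rule multilinear_cong[OF g]) (auto simp: Q.lin_ext_basis cl V.module_axioms)
  then have vanish: "\<And>s. s \<in> multilinear_relations K V \<Longrightarrow> lin_ext K Q g s = \<zero>\<^bsub>Q\<^esub>"
    using relations_vanish_iff[OF Q lin] by blast
  then show "s \<in> multilinear_relations K V \<Longrightarrow> lin_ext K Q g s = \<zero>\<^bsub>Q\<^esub>" .
  show "word_lift K Q g \<in> linear_maps K S Q"
    using words.lift_linear[OF Q cl vanish] by (simp only: words.lift_def word_lift_def Sh_presentation)
  show "word_lift K Q g (word w) = g w" if "w \<in> W"
    using words.lift_gen[OF Q cl vanish that] by (simp only: words.lift_def word_lift_def word_gen)
qed

subsection \<open>Prefixing a letter\<close>

text \<open>The bilinear map \<open>V \<times> Sh(V) \<rightarrow> Sh(V)\<close> through which all recursions on words are expressed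
  for arbitrary elements of the shuffle algebra.\<close>

definition cons :: "'v \<Rightarrow> ('v list \<Rightarrow> 'k) set \<Rightarrow> ('v list \<Rightarrow> 'k) set" where
  "cons v = word_lift K S (\<lambda>w. word (v # w))"

lemma cons_multilinear:
  assumes "v \<in> carrier V" shows "(\<lambda>w. word (v # w)) \<in> multilinear_maps K V S"
  using multilinear_linear[OF word_multilinear, of "v # _"] assms
  by (intro multilinear_mapsI word_closed) auto

lemma cons_word: "v \<in> carrier V \<Longrightarrow> w \<in> W \<Longrightarrow> cons v (word w) = word (v # w)"
  by (simp add: cons_def word_lift_word[OF Sh_module cons_multilinear])

lemma cons_bilinear: "cons \<in> bilinear_maps K V S S"
proof (rule bilinear_from_span[OF V.module_axioms Sh_module Sh_module words_span])
  show "cons v \<in> linear_maps K S S" if "v \<in> carrier V" for v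
    unfolding cons_def by (rule word_lift_linear[OF Sh_module cons_multilinear[OF that]])
  fix p assume "p \<in> word ` W"
  then obtain w where w: "p = word w" "w \<in> W" by auto
  show "(\<lambda>v. cons v p) \<in> linear_maps K V S"
    by (rule linear_cong[OF multilinear_linear[OF word_multilinear, of "[]" w]])
       (auto simp: w cons_word V.module_axioms)
qed

lemmas cons_closed = bilinear_closed[OF cons_bilinear]

text \<open>The structural induction principle of the shuffle algebra. Only letters from a spanning set
  of \<open>V\<close> occur in it, because \<^term>\<open>cons v p\<close> is linear in \<open>v\<close>.\<close>

lemma Sh_generated:
  assumes H: "submodule H K S" and nil: "word [] \<in> H"
    and cons: "\<And>v p. v \<in> T \<Longrightarrow> p \<in> H \<Longrightarrow> cons v p \<in> H"
    and T: "submodule_span K V T = carrier V" and p: "p \<in> carrier S"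
  shows "p \<in> H"
proof -
  interpret VS: two_modules K V S by (intro two_modules.intro V.module_axioms Sh_module)
  have sub: "T \<subseteq> carrier V" using T submodule_span_superset by metis
  have HS: "H \<subseteq> carrier S" using S.submoduleE(1)[OF H] .
  have cons': "cons v q \<in> H" if "v \<in> carrier V" "q \<in> H" for v q
  proof -
    have "q \<in> carrier S" using that(2) HS by auto
    from spanning_induct[OF T VS.preimage_submodule[OF bilinear_left[OF cons_bilinear this] H] _ that(1)]
    show ?thesis using sub cons that(2) by auto
  qed
  have "word w \<in> H" if "w \<in> W" for w
    using that by (induction w) (auto simp: nil cons_word[symmetric] cons')
  then show ?thesis by (intro spanning_induct[OF words_span H _ p]) auto
qed

text \<open>The span of these words is closed under prefixing a letter of \<open>T\<close>, so structural induction
  applies to it.\<close>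

lemma words_in_spanning_letters_span:
  assumes T: "submodule_span K V T = carrier V"
  shows "submodule_span K S (word ` lists T) = carrier S"
proof (rule S.spanningI)
  have sub: "T \<subseteq> carrier V" using T submodule_span_superset by metis
  then have sub': "lists T \<subseteq> W" by (rule lists_mono)
  then show gen: "word ` lists T \<subseteq> carrier S" using word_closed by blast
  interpret SS: two_modules K S S by (intro two_modules.intro Sh_module)
  define H0 where "H0 = submodule_span K S (word ` lists T)"
  have H0: "submodule H0 K S" unfolding H0_def by (rule S.submodule_span_submodule[OF gen])
  have gen': "word ` lists T \<subseteq> H0" unfolding H0_def by (rule submodule_span_superset)
  have "cons v p \<in> H0" if v: "v \<in> T" and p: "p \<in> H0" for v p
  proof -
    have v': "v \<in> carrier V" using v sub by auto
    have "word ` lists T \<subseteq> {p \<in> carrier S. cons v p \<in> H0}"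
    proof (intro image_subsetI CollectI conjI)
      fix w assume w: "w \<in> lists T"
      then have "word (v # w) \<in> word ` lists T" using v by simp
      moreover have "cons v (word w) = word (v # w)" using w sub' by (intro cons_word[OF v']) auto
      ultimately show "cons v (word w) \<in> H0" using gen' by auto
      show "word w \<in> carrier S" using w gen by blast
    qed
    then have "H0 \<subseteq> {p \<in> carrier S. cons v p \<in> H0}"
      by (subst H0_def) (rule submodule_span_least[OF SS.preimage_submodule[OF bilinear_right[OF cons_bilinear v'] H0]])
    then show ?thesis using p by auto
  qed
  then have "carrier S \<subseteq> H0"
    using Sh_generated[OF H0 _ _ T] gen' by blast
  moreover fix H assume "submodule H K S" "word ` lists T \<subseteq> H"
  then have "H0 \<subseteq> H" unfolding H0_def by (rule submodule_span_least)
  ultimately show "carrier S \<subseteq> H" by auto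
qed

text \<open>Together with the empty word, the elements \<^term>\<open>cons v p\<close> span the shuffle algebra.\<close>

lemma linear_eq_on_Sh:
  assumes Q: "module K Q" and h: "h \<in> linear_maps K S Q" and k: "k \<in> linear_maps K S Q"
    and "h (word []) = k (word [])"
    and "\<And>v p. v \<in> carrier V \<Longrightarrow> p \<in> carrier S \<Longrightarrow> h (cons v p) = k (cons v p)"
    and "p \<in> carrier S"
  shows "h p = k p"
proof -
  interpret SQ: two_modules K S Q by (intro two_modules.intro Sh_module Q)
  have "p \<in> {p \<in> carrier S. h p = k p}"
    by (rule Sh_generated[OF SQ.equalizer_submodule[OF h k] _ _ carrier_spans[OF V.module_axioms]])
      (use assms(4-6) in \<open>auto simp: word_closed cons_closed\<close>)
  then show ?thesis by simp
qed

lemma linear_eq_on_words: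
  assumes "module K Q" "h \<in> linear_maps K S Q" "k \<in> linear_maps K S Q"
    and "\<And>w. w \<in> W \<Longrightarrow> h (word w) = k (word w)" "p \<in> carrier S"
  shows "h p = k p"
  by (rule linear_eq_on_span[OF Sh_module assms(1) words_span assms(2,3) _ assms(5)]) (use assms(4) in blast)

lemma word_fold_multilinear:
  assumes "b \<in> bilinear_maps K V Q Q" "q \<in> carrier Q"
  shows "(\<lambda>w. foldr b w q) \<in> multilinear_maps K V Q"
proof -
  have cl: "foldr b w q \<in> carrier Q" if "w \<in> W" for w
    using that by (induction w) (auto simp: assms intro: bilinear_closed[OF assms(1)])
  have "(\<lambda>x. foldr b (s @ [x] @ t) q) \<in> linear_maps K V Q" if "s \<in> W" "t \<in> W" for s t
    using that(1)
    by (induction s) (auto simp: cl that(2) bilinear_left[OF assms(1)] intro!: linear_bilinear_right[OF assms(1)])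
  with cl show ?thesis by (rule multilinear_mapsI)
qed

text \<open>The linear map that sends a word \<open>v\<^sub>1 \<dots> v\<^sub>n\<close> to \<open>b v\<^sub>1 (\<dots> (b v\<^sub>n q))\<close>. With integral operators
  for \<open>b\<close> these are iterated integrals.\<close>

definition word_fold :: "('k, 'q) module \<Rightarrow> ('v \<Rightarrow> 'q \<Rightarrow> 'q) \<Rightarrow> 'q \<Rightarrow> ('v list \<Rightarrow> 'k) set \<Rightarrow> 'q" where
  "word_fold Q b q = word_lift K Q (\<lambda>w. foldr b w q)"

context
  fixes Q :: "('k, 'q) module" and b q
  assumes Q: "module K Q" and b: "b \<in> bilinear_maps K V Q Q" and q: "q \<in> carrier Q"
begin

lemma word_fold_linear: "word_fold Q b q \<in> linear_maps K S Q"
  unfolding word_fold_def by (rule word_lift_linear[OF Q word_fold_multilinear[OF b q]])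

lemma word_fold_word: "w \<in> W \<Longrightarrow> word_fold Q b q (word w) = foldr b w q"
  unfolding word_fold_def by (rule word_lift_word[OF Q word_fold_multilinear[OF b q]])

lemma word_fold_cons:
  assumes v: "v \<in> carrier V" and p: "p \<in> carrier S"
  shows "word_fold Q b q (cons v p) = b v (word_fold Q b q p)"
proof (rule linear_eq_on_words[OF Q _ _ _ p])
  show "(\<lambda>p. word_fold Q b q (cons v p)) \<in> linear_maps K S Q"
    by (rule linear_comp[OF bilinear_right[OF cons_bilinear v] word_fold_linear])
  show "(\<lambda>p. b v (word_fold Q b q p)) \<in> linear_maps K S Q"
    by (rule linear_bilinear_right[OF b v word_fold_linear])
qed (simp add: cons_word v word_fold_word)

end

subsection \<open>The shuffle product\<close>

abbreviation "sh s t \<equiv> words.cls (shuffle K (carrier V) s t)"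

lemma lin_ext_prefix:
  assumes a: "a \<in> carrier V"
  shows "lin_ext K words.L (\<lambda>w. basis_elt K (a # w)) \<in> linear_maps K words.L words.L"
  by (rule words.L.lin_ext_linear) (simp add: a basis_elt_closed)

lemma shuffle_closed: "s \<in> W \<Longrightarrow> t \<in> W \<Longrightarrow> shuffle K (carrier V) s t \<in> carrier words.L"
proof (induction s arbitrary: t)
  case Nil
  then show ?case by (simp add: basis_elt_closed)
next
  case (Cons a s)
  note IHs = Cons.IH and as = Cons.prems(1)
  from Cons.prems(2) show ?case
  proof (induction t)
    case Nil
    then show ?case using as by (simp add: basis_elt_closed)
  next
    case (Cons b t)
    with as have ab: "a \<in> carrier V" "b \<in> carrier V" and "s \<in> W" "b # t \<in> W" by auto
    then show ?case
      using linear_closed[OF lin_ext_prefix[OF ab(1)] IHs] linear_closed[OF lin_ext_prefix[OF ab(2)] Cons.IH]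
      by simp
  qed
qed

lemma sh_closed: "s \<in> W \<Longrightarrow> t \<in> W \<Longrightarrow> sh s t \<in> carrier S"
  using linear_closed[OF words.cls_linear shuffle_closed] by (simp only: Sh_presentation)

lemma cls_prefix:
  assumes a: "a \<in> carrier V" and p: "p \<in> carrier words.L"
  shows "words.cls (lin_ext K words.L (\<lambda>w. basis_elt K (a # w)) p) = cons a (words.cls p)"
proof (rule linear_eq_on_span[OF free_module_module Sh_module basis_spans_free_module _ _ _ p])
  note cls = words.cls_linear[unfolded Sh_presentation]
  show "(\<lambda>p. words.cls (lin_ext K words.L (\<lambda>w. basis_elt K (a # w)) p)) \<in> linear_maps K words.L S"
    by (rule linear_comp[OF lin_ext_prefix[OF a] cls])
  show "(\<lambda>p. cons a (words.cls p)) \<in> linear_maps K words.L S"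
    by (rule linear_bilinear_right[OF cons_bilinear a cls])
  fix b assume "b \<in> basis_elt K ` W"
  then obtain w where "b = basis_elt K w" "w \<in> W" by blast
  then show "words.cls (lin_ext K words.L (\<lambda>w. basis_elt K (a # w)) b) = cons a (words.cls b)"
    using a by (simp add: words.L.lin_ext_basis basis_elt_closed word_gen cons_word)
qed

lemma sh_Nil: "sh [] t = word t"
  by (simp add: word_gen)

lemma sh_Nil2: "sh s [] = word s"
  by (cases s) (simp_all add: word_gen)

lemma sh_Cons:
  assumes "a \<in> carrier V" "b \<in> carrier V" "s \<in> W" "t \<in> W"
  shows "sh (a # s) (b # t) = cons a (sh s (b # t)) \<boxplus> cons b (sh (a # s) t)"
proof -
  have 1: "shuffle K (carrier V) s (b # t) \<in> carrier words.L" "shuffle K (carrier V) (a # s) t \<in> carrier words.L"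
    using assms by (auto intro!: shuffle_closed)
  have "sh (a # s) (b # t) =
      words.cls (lin_ext K words.L (\<lambda>w. basis_elt K (a # w)) (shuffle K (carrier V) s (b # t))) \<oplus>\<^bsub>words.G\<^esub>
      words.cls (lin_ext K words.L (\<lambda>w. basis_elt K (b # w)) (shuffle K (carrier V) (a # s) t))"
    using linear_add[OF words.cls_linear linear_closed[OF lin_ext_prefix] linear_closed[OF lin_ext_prefix]]
      assms 1 by simp
  then show ?thesis using assms 1 by (simp only: cls_prefix Sh_presentation)
qed

lemma sh_comm: "s \<in> W \<Longrightarrow> t \<in> W \<Longrightarrow> sh s t = sh t s"
proof (induction s arbitrary: t)
  case Nil
  then show ?case by (simp only: sh_Nil sh_Nil2)
next
  case (Cons a s)
  note IHs = Cons.IH and as = Cons.prems(1)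
  from Cons.prems(2) show ?case
  proof (induction t)
    case Nil
    then show ?case by (simp only: sh_Nil sh_Nil2)
  next
    case (Cons b t)
    with as have "a \<in> carrier V" "s \<in> W" "b \<in> carrier V" "t \<in> W" by auto
    then show ?case using IHs[of "b # t"] Cons.IH
      by (simp add: sh_Cons S.M.a_comm cons_closed sh_closed del: shuffle.simps)
  qed
qed

text \<open>Multilinearity in the second word, for a fixed first word: both summands of the recursion are
  linear in every letter of the second word, by induction or because \<^const>\<open>cons\<close> is
  bilinear. Commutativity then transfers this to the first word.\<close>

lemma sh_linear:
  "s \<in> W \<Longrightarrow> u \<in> W \<Longrightarrow> t \<in> W \<Longrightarrow> (\<lambda>x. sh s (u @ [x] @ t)) \<in> linear_maps K V S"
proof (induction s arbitrary: u)
  case Nil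
  then show ?case using multilinear_linear[OF word_multilinear] by (simp only: sh_Nil)
next
  case (Cons a s)
  note IHs = Cons.IH
  from Cons.prems have as: "a \<in> carrier V" "s \<in> W" and t: "t \<in> W" by auto
  interpret VS: two_modules K V S by (intro two_modules.intro V.module_axioms Sh_module)
  from Cons.prems(2) show ?case
  proof (induction u)
    case Nil
    have "(\<lambda>x. cons a (sh s ([] @ [x] @ t)) \<boxplus> cons x (sh (a # s) t)) \<in> linear_maps K V S"
      using as t by (intro VS.linear_sum linear_bilinear_right[OF cons_bilinear] IHs
        bilinear_left[OF cons_bilinear] sh_closed) auto
    then show ?case
      by (rule linear_cong) (use as t in \<open>simp_all add: sh_Cons V.module_axioms del: shuffle.simps\<close>)
  next
    case (Cons b u)
    then have b: "b \<in> carrier V" "u \<in> W" "b # u \<in> W" by auto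
    have "(\<lambda>x. cons a (sh s ((b # u) @ [x] @ t)) \<boxplus> cons b (sh (a # s) (u @ [x] @ t))) \<in> linear_maps K V S"
      using as t b Cons.prems by (intro VS.linear_sum linear_bilinear_right[OF cons_bilinear] IHs Cons.IH)
    then show ?case
      by (rule linear_cong) (use as t b in \<open>simp_all add: sh_Cons V.module_axioms del: shuffle.simps\<close>)
  qed
qed

lemma Sh_presented_algebra:
  "presented_algebra K W (multilinear_relations K V) (shuffle K (carrier V)) (basis_elt K [])"
proof (intro presented_algebra.intro presented_algebra_axioms.intro words.presentation_axioms shuffle_closed)
  have multi: "sh t \<in> multilinear_maps K V S" if "t \<in> W" for t
    by (rule multilinear_mapsI) (use that sh_closed sh_linear in auto)
  fix s t assume s: "s \<in> multilinear_relations K V" and t: "t \<in> W"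
  show "lin_ext K words.G (sh t) s = \<zero>\<^bsub>words.G\<^esub>"
    unfolding Sh_presentation by (rule lin_ext_multilinear_vanishes[OF Sh_module multi[OF t] s])
  have "(\<lambda>w. sh w t) \<in> multilinear_maps K V S"
    by (rule multilinear_cong[OF multi[OF t] _ V.module_axioms]) (rule sh_comm[OF t])
  then show "lin_ext K words.G (\<lambda>w. sh w t) s = \<zero>\<^bsub>words.G\<^esub>"
    unfolding Sh_presentation by (rule lin_ext_multilinear_vanishes[OF Sh_module _ s])
qed (auto intro: basis_elt_closed)

lemma Sh_mult_bilinear: "(\<otimes>\<^bsub>S\<^esub>) \<in> bilinear_maps K S S S"
  using presented_algebra.G_mult_bilinear[OF Sh_presented_algebra] by (simp only: Sh_presentation)

lemma word_mult: "s \<in> W \<Longrightarrow> t \<in> W \<Longrightarrow> word s \<star> word t = sh s t"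
  using presented_algebra.gen_mult[OF Sh_presented_algebra] by (simp only: Sh_presentation word_gen)

lemma Sh_one: "\<one>\<^bsub>S\<^esub> = word []"
  using presented_algebra.G_one[OF Sh_presented_algebra] by (simp only: Sh_presentation word_gen)

lemmas Sh_mult_closed = bilinear_closed[OF Sh_mult_bilinear]

lemma bilinear_eq_on_words:
  assumes "module K Q" "b \<in> bilinear_maps K S S Q" "c \<in> bilinear_maps K S S Q"
    and "\<And>s t. s \<in> W \<Longrightarrow> t \<in> W \<Longrightarrow> b (word s) (word t) = c (word s) (word t)"
    and "p \<in> carrier S" "q \<in> carrier S"
  shows "b p q = c p q"
  by (rule bilinear_eq_on_span[OF Sh_module Sh_module assms(1) words_span words_span assms(2,3) _ assms(5,6)])
     (use assms(4) in blast)

text \<open>Both sides are bilinear in \<open>p\<close> and \<open>q\<close>, and on words this is the recursion that defines the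
  shuffle product.\<close>

lemma cons_mult_cons:
  assumes a: "a \<in> carrier V" and b: "b \<in> carrier V" and p: "p \<in> carrier S" and q: "q \<in> carrier S"
  shows "cons a p \<star> cons b q = cons a (p \<star> cons b q) \<boxplus> cons b (cons a p \<star> q)"
proof -
  interpret SS: two_modules K S S by (intro two_modules.intro Sh_module)
  note lin = bilinear_right[OF Sh_mult_bilinear] bilinear_left[OF Sh_mult_bilinear]
    bilinear_right[OF cons_bilinear a] bilinear_right[OF cons_bilinear b]
  note cl = Sh_mult_closed cons_closed a b
  show ?thesis
  proof (rule bilinear_eq_on_words[OF Sh_module _ _ _ p q])
    show "(\<lambda>p q. cons a p \<star> cons b q) \<in> bilinear_maps K S S S"
      by (intro bilinear_mapsI linear_comp[OF lin(4) lin(1)] linear_comp[OF lin(3) lin(2)] cl)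
    have 1: "(\<lambda>p q. cons a (p \<star> cons b q)) \<in> bilinear_maps K S S S"
      by (intro bilinear_mapsI linear_comp[OF linear_comp[OF lin(4) lin(1)] lin(3)] linear_comp[OF lin(2) lin(3)] cl)
    have 2: "(\<lambda>p q. cons b (cons a p \<star> q)) \<in> bilinear_maps K S S S"
      by (intro bilinear_mapsI linear_comp[OF linear_comp[OF lin(3) lin(2)] lin(4)] linear_comp[OF lin(1) lin(4)] cl)
    show "(\<lambda>p q. cons a (p \<star> cons b q) \<boxplus> cons b (cons a p \<star> q)) \<in> bilinear_maps K S S S"
      by (intro bilinear_mapsI SS.linear_sum bilinear_right[OF 1] bilinear_left[OF 1] bilinear_right[OF 2] bilinear_left[OF 2])
    show "cons a (word s) \<star> cons b (word t) =
      cons a (word s \<star> cons b (word t)) \<boxplus> cons b (cons a (word s) \<star> word t)"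
      if "s \<in> W" "t \<in> W" for s t
      using that a b by (simp add: cons_word word_mult sh_Cons del: shuffle.simps)
  qed
qed

lemma Sh_mult_comm_words: "s \<in> W \<Longrightarrow> t \<in> W \<Longrightarrow> word s \<star> word t = word t \<star> word s"
  by (simp add: word_mult sh_comm del: shuffle.simps)

text \<open>By induction on the total length: either side of the associative law for \<open>a p\<close>, \<open>b q\<close> and
  \<open>d r\<close> expands into three summands, according to which of the letters \<open>a\<close>, \<open>b\<close>, \<open>d\<close> comes first.\<close>

lemma Sh_mult_assoc_words:
  "s \<in> W \<Longrightarrow> t \<in> W \<Longrightarrow> u \<in> W \<Longrightarrow>
    word s \<star> word t \<star> word u = word s \<star> (word t \<star> word u)"
proof (induction "length s + length t + length u" arbitrary: s t u rule: less_induct)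
  case less
  note m = Sh_mult_closed and c = cons_closed
  have one_left: "word [] \<star> p = p" if "p \<in> carrier S" for p
    by (rule linear_eq_on_words[OF Sh_module bilinear_right[OF Sh_mult_bilinear word_closed] linear_id _ that])
       (simp_all add: word_mult sh_Nil del: shuffle.simps)
  have one_right: "p \<star> word [] = p" if "p \<in> carrier S" for p
    by (rule linear_eq_on_words[OF Sh_module bilinear_left[OF Sh_mult_bilinear word_closed] linear_id _ that])
       (simp_all add: word_mult sh_Nil2 del: shuffle.simps)
  show ?case
  proof (cases "s = [] \<or> t = [] \<or> u = []")
    case True
    then show ?thesis using less.prems
      by (elim disjE) (simp_all add: one_left one_right word_closed m)
  next
    case False
    then obtain a s' b t' d u' where eq: "s = a # s'" "t = b # t'" "u = d # u'"
      by (meson neq_Nil_conv)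
    define p q r where "p = word s'" "q = word t'" "r = word u'"
    have V: "a \<in> carrier V" "b \<in> carrier V" "d \<in> carrier V" and W: "s' \<in> W" "t' \<in> W" "u' \<in> W"
      using less.prems by (auto simp: eq)
    have pqr: "p \<in> carrier S" "q \<in> carrier S" "r \<in> carrier S"
      using W by (simp_all add: p_q_r_def word_closed)
    have words: "word s = cons a p" "word t = cons b q" "word u = cons d r"
      using V W by (simp_all add: eq p_q_r_def cons_word)
    have IH: "p \<star> cons b q \<star> cons d r = p \<star> (cons b q \<star> cons d r)"
        "cons a p \<star> q \<star> cons d r = cons a p \<star> (q \<star> cons d r)"
        "cons a p \<star> cons b q \<star> r = cons a p \<star> (cons b q \<star> r)"
      using less.hyps[of s' t u] less.hyps[of s t' u] less.hyps[of s t u'] less.prems W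
      by (simp_all add: p_q_r_def eq cons_word V W)
    note dist = linear_add[OF bilinear_right[OF Sh_mult_bilinear]] linear_add[OF bilinear_left[OF Sh_mult_bilinear]]
    note simps = cons_mult_cons dist m c S.M.a_ac linear_add[OF bilinear_right[OF cons_bilinear]]
    have "cons a p \<star> cons b q \<star> cons d r =
      cons a (p \<star> cons b q \<star> cons d r) \<boxplus> cons b (cons a p \<star> q \<star> cons d r) \<boxplus>
      (cons d (cons a (p \<star> cons b q) \<star> r) \<boxplus> cons d (cons b (cons a p \<star> q) \<star> r))"
      using V pqr by (simp add: simps)
    also have "cons d (cons a (p \<star> cons b q) \<star> r) \<boxplus> cons d (cons b (cons a p \<star> q) \<star> r)
       = cons d (cons a p \<star> cons b q \<star> r)"
      using V pqr by (simp add: simps)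
    also have "cons a (p \<star> cons b q \<star> cons d r) \<boxplus> cons b (cons a p \<star> q \<star> cons d r) \<boxplus>
       cons d (cons a p \<star> cons b q \<star> r) = cons a (p \<star> (cons b q \<star> cons d r)) \<boxplus>
       cons b (cons a p \<star> (q \<star> cons d r)) \<boxplus> cons d (cons a p \<star> (cons b q \<star> r))"
      by (simp only: IH)
    also have "\<dots> = cons a p \<star> (cons b q \<star> cons d r)"
      using V pqr by (simp add: simps)
    finally show ?thesis unfolding words .
  qed
qed

lemma Sh_algebra: "algebra K S"
proof (rule algebra_from_spanning_set[OF Sh_module words_span Sh_mult_bilinear])
  show "\<one>\<^bsub>S\<^esub> \<in> carrier S" by (simp add: Sh_one word_closed)
  show "x \<star> y = y \<star> x" if "x \<in> word ` W" "y \<in> word ` W" for x y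
    using that Sh_mult_comm_words by blast
  show "x \<star> y \<star> z = x \<star> (y \<star> z)" if "x \<in> word ` W" "y \<in> word ` W" "z \<in> word ` W" for x y z
    using that Sh_mult_assoc_words by blast
  show "\<one>\<^bsub>S\<^esub> \<star> x = x" if "x \<in> word ` W" for x
  proof -
    from that obtain w where "x = word w" "w \<in> W" by blast
    then show ?thesis by (simp add: Sh_one word_mult sh_Nil del: shuffle.simps)
  qed
qed

sublocale S: algebra K S by (rule Sh_algebra)

text \<open>The shuffle relations for iterated integrals: the hypothesis on \<open>J\<close> has the same shape as the
  recursion of the shuffle product.\<close>

lemma word_fold_mult:
  assumes R: "algebra K R" and J: "J \<in> bilinear_maps K V R R"
    and RB: "\<And>v w x y. v \<in> carrier V \<Longrightarrow> w \<in> carrier V \<Longrightarrow> x \<in> carrier R \<Longrightarrow> y \<in> carrier R \<Longrightarrow>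
      J v x \<otimes>\<^bsub>R\<^esub> J w y = J v (x \<otimes>\<^bsub>R\<^esub> J w y) \<oplus>\<^bsub>R\<^esub> J w (J v x \<otimes>\<^bsub>R\<^esub> y)"
    and p: "p \<in> carrier S" and q: "q \<in> carrier S"
  shows "word_fold R J \<one>\<^bsub>R\<^esub> (p \<star> q) = word_fold R J \<one>\<^bsub>R\<^esub> p \<otimes>\<^bsub>R\<^esub> word_fold R J \<one>\<^bsub>R\<^esub> q"
    (is "?h (p \<star> q) = _")
proof -
  interpret R: algebra K R by fact
  note fold = R.module_axioms J R.one_closed
  note h = word_fold_linear[OF fold] and h_cons = word_fold_cons[OF fold]
  have h_Nil: "?h (word []) = \<one>\<^bsub>R\<^esub>" by (simp add: word_fold_word[OF fold])
  note hc = linear_closed[OF h] and Jc = bilinear_closed[OF J]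
  have words: "s \<in> W \<Longrightarrow> t \<in> W \<Longrightarrow> ?h (word s \<star> word t) = ?h (word s) \<otimes>\<^bsub>R\<^esub> ?h (word t)" for s t
  proof (induction s arbitrary: t)
    case Nil
    then show ?case using hc[OF word_closed] S.l_one[OF word_closed] by (simp add: h_Nil Sh_one)
  next
    case (Cons a s)
    note IHs = Cons.IH and as = Cons.prems(1)
    from Cons.prems(2) show ?case
    proof (induction t)
      case Nil
      then show ?case using as hc[OF word_closed] S.r_one[OF word_closed] by (simp add: h_Nil Sh_one)
    next
      case (Cons b t)
      with as have V: "a \<in> carrier V" "b \<in> carrier V" and W: "s \<in> W" "b # t \<in> W" "t \<in> W" by auto
      have "?h (word (a # s) \<star> word (b # t)) =
          J a (?h (word s \<star> word (b # t))) \<oplus>\<^bsub>R\<^esub> J b (?h (word (a # s) \<star> word t))"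
        using V W by (simp add: cons_word[symmetric] cons_mult_cons linear_add[OF h] h_cons
            word_closed cons_closed Sh_mult_closed)
      also have "\<dots> = J a (?h (word s) \<otimes>\<^bsub>R\<^esub> J b (?h (word t))) \<oplus>\<^bsub>R\<^esub> J b (J a (?h (word s)) \<otimes>\<^bsub>R\<^esub> ?h (word t))"
        using V W by (simp add: IHs Cons.IH) (simp add: cons_word[symmetric] h_cons word_closed)
      also have "\<dots> = J a (?h (word s)) \<otimes>\<^bsub>R\<^esub> J b (?h (word t))"
        using V W by (simp add: RB hc word_closed)
      also have "\<dots> = ?h (word (a # s)) \<otimes>\<^bsub>R\<^esub> ?h (word (b # t))"
        using V W by (simp add: cons_word[symmetric] h_cons word_closed)
      finally show ?case .
    qed
  qed
  note m = mult_bilinear[OF R]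
  show ?thesis
  proof (rule bilinear_eq_on_words[OF R.module_axioms _ _ _ p q])
    show "(\<lambda>p q. ?h (p \<star> q)) \<in> bilinear_maps K S S R"
      by (intro bilinear_mapsI linear_comp[OF bilinear_right[OF Sh_mult_bilinear] h]
          linear_comp[OF bilinear_left[OF Sh_mult_bilinear] h])
    show "(\<lambda>p q. ?h p \<otimes>\<^bsub>R\<^esub> ?h q) \<in> bilinear_maps K S S R"
      by (intro bilinear_mapsI linear_comp[OF h bilinear_right[OF m]] linear_comp[OF h bilinear_left[OF m]] hc)
  qed (rule words)
qed

subsection \<open>Operators on the first letter\<close>

text \<open>The operator that applies \<open>\<alpha>\<close> to the first letter and kills the empty word. For \<open>\<alpha>\<close> the
  multiplication by \<open>\<kappa>\<^sub>\<omega>(c)\<close>, it is the correction term in the formula for \<open>P\<^sub>\<omega>\<close> at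
  \<open>c \<otimes> w\<close> with \<open>c\<close> in \<open>F\<close>.\<close>

definition letter_map :: "('v \<Rightarrow> 'v) \<Rightarrow> ('v list \<Rightarrow> 'k) set \<Rightarrow> ('v list \<Rightarrow> 'k) set" where
  "letter_map \<alpha> = word_lift K S (\<lambda>w. case w of [] \<Rightarrow> \<zero>\<^bsub>S\<^esub> | v # w' \<Rightarrow> word (\<alpha> v # w'))"

context
  fixes \<alpha> assumes \<alpha>: "\<alpha> \<in> linear_maps K V V"
begin

lemma letter_map_multilinear:
  "(\<lambda>w. case w of [] \<Rightarrow> \<zero>\<^bsub>S\<^esub> | v # w' \<Rightarrow> word (\<alpha> v # w')) \<in> multilinear_maps K V S"
proof (rule multilinear_mapsI)
  note \<alpha>c = linear_closed[OF \<alpha>]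
  show "(case w of [] \<Rightarrow> \<zero>\<^bsub>S\<^esub> | v # w' \<Rightarrow> word (\<alpha> v # w')) \<in> carrier S" if "w \<in> W" for w
    using that by (cases w) (simp_all add: word_closed \<alpha>c)
  fix s t assume s: "s \<in> W" and t: "t \<in> W"
  show "(\<lambda>x. case s @ [x] @ t of [] \<Rightarrow> \<zero>\<^bsub>S\<^esub> | v # w' \<Rightarrow> word (\<alpha> v # w')) \<in> linear_maps K V S"
  proof (cases s)
    case Nil
    then show ?thesis
      using linear_comp[OF \<alpha> multilinear_linear[OF word_multilinear lists.Nil t]] by simp
  next
    case (Cons a s')
    then show ?thesis
      using multilinear_linear[OF word_multilinear, of "\<alpha> a # s'" t] s t by (simp add: \<alpha>c)
  qed
qed

lemma letter_map_linear: "letter_map \<alpha> \<in> linear_maps K S S"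
  unfolding letter_map_def by (rule word_lift_linear[OF Sh_module letter_map_multilinear])

lemma letter_map_Nil: "letter_map \<alpha> (word []) = \<zero>\<^bsub>S\<^esub>"
  unfolding letter_map_def by (subst word_lift_word[OF Sh_module letter_map_multilinear]) auto

lemma letter_map_word: "v \<in> carrier V \<Longrightarrow> w \<in> W \<Longrightarrow> letter_map \<alpha> (word (v # w)) = word (\<alpha> v # w)"
  unfolding letter_map_def by (subst word_lift_word[OF Sh_module letter_map_multilinear]) auto

lemma letter_map_cons:
  assumes v: "v \<in> carrier V" and p: "p \<in> carrier S"
  shows "letter_map \<alpha> (cons v p) = cons (\<alpha> v) p"
  by (rule linear_eq_on_words[OF Sh_module linear_comp[OF bilinear_right[OF cons_bilinear v] letter_map_linear]
      bilinear_right[OF cons_bilinear linear_closed[OF \<alpha> v]] _ p])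
    (simp add: v cons_word letter_map_word linear_closed[OF \<alpha>])

text \<open>This and the next identity measure how far \<^const>\<open>letter_map\<close> is from a derivation; they are what
  the Rota-Baxter identity of \<open>Sha\<close> requires if one or both arguments have their first factor in \<open>F\<close>.
  Both are checked on the empty word and on elements \<^term>\<open>cons v p\<close>, where the recursion of the
  shuffle product matches the terms by their first letters.\<close>

lemma letter_map_mult_cons:
  assumes b: "b \<in> carrier V" and p: "p \<in> carrier S" and q: "q \<in> carrier S"
  shows "letter_map \<alpha> (p \<star> cons b q) \<boxplus> cons b (letter_map \<alpha> p \<star> q) =
    cons (\<alpha> b) (p \<star> q) \<boxplus> letter_map \<alpha> p \<star> cons b q"
proof -
  interpret SS: two_modules K S S by (intro two_modules.intro Sh_module)
  note D = letter_map_linear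
  note lin = bilinear_left[OF Sh_mult_bilinear] bilinear_right[OF cons_bilinear]
  note cl = cons_closed b q linear_closed[OF \<alpha>] linear_closed[OF D] Sh_mult_closed
  show ?thesis
  proof (rule linear_eq_on_Sh[OF Sh_module _ _ _ _ p])
    show "(\<lambda>p. letter_map \<alpha> (p \<star> cons b q) \<boxplus> cons b (letter_map \<alpha> p \<star> q)) \<in> linear_maps K S S"
      by (intro SS.linear_sum linear_comp[OF lin(1) D] linear_comp[OF linear_comp[OF D lin(1)] lin(2)] cl)
    show "(\<lambda>p. cons (\<alpha> b) (p \<star> q) \<boxplus> letter_map \<alpha> p \<star> cons b q) \<in> linear_maps K S S"
      by (intro SS.linear_sum linear_comp[OF lin(1) lin(2)] linear_comp[OF D lin(1)] cl)
    have "\<zero>\<^bsub>S\<^esub> \<star> r = \<zero>\<^bsub>S\<^esub>" "cons b \<zero>\<^bsub>S\<^esub> = \<zero>\<^bsub>S\<^esub>" if "r \<in> carrier S" for r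
      using that SS.linear_zero[OF lin(2)[OF b]] by simp_all
    then show "letter_map \<alpha> (word [] \<star> cons b q) \<boxplus> cons b (letter_map \<alpha> (word []) \<star> q) =
      cons (\<alpha> b) (word [] \<star> q) \<boxplus> letter_map \<alpha> (word []) \<star> cons b q"
      using cl by (simp add: Sh_one[symmetric] letter_map_Nil[folded Sh_one] letter_map_cons)
    show "letter_map \<alpha> (cons v p \<star> cons b q) \<boxplus> cons b (letter_map \<alpha> (cons v p) \<star> q) =
      cons (\<alpha> b) (cons v p \<star> q) \<boxplus> letter_map \<alpha> (cons v p) \<star> cons b q"
      if "v \<in> carrier V" "p \<in> carrier S" for v p
      using that cl by (simp add: cons_mult_cons letter_map_cons linear_add[OF D] S.M.a_ac)
  qed
qed

end

lemma letter_map_mult_letter_map: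
  assumes \<alpha>: "\<alpha> \<in> linear_maps K V V" and \<beta>: "\<beta> \<in> linear_maps K V V" and \<gamma>: "\<gamma> \<in> linear_maps K V V"
    and \<alpha>\<beta>: "\<And>v. v \<in> carrier V \<Longrightarrow> \<alpha> (\<beta> v) = \<gamma> v" and \<beta>\<alpha>: "\<And>v. v \<in> carrier V \<Longrightarrow> \<beta> (\<alpha> v) = \<gamma> v"
    and p: "p \<in> carrier S" and q: "q \<in> carrier S"
  shows "letter_map \<alpha> p \<star> letter_map \<beta> q \<boxplus> letter_map \<gamma> (p \<star> q) =
    letter_map \<alpha> (p \<star> letter_map \<beta> q) \<boxplus> letter_map \<beta> (letter_map \<alpha> p \<star> q)"
proof -
  interpret SS: two_modules K S S by (intro two_modules.intro Sh_module)
  note D = letter_map_linear[OF \<alpha>] letter_map_linear[OF \<beta>] letter_map_linear[OF \<gamma>]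
  note Dcl = linear_closed[OF \<alpha>] linear_closed[OF \<beta>] linear_closed[OF \<gamma>]
    linear_closed[OF D(1)] linear_closed[OF D(2)] linear_closed[OF D(3)]
  note lin = bilinear_left[OF Sh_mult_bilinear] bilinear_right[OF Sh_mult_bilinear]
  note cl = cons_closed Dcl Sh_mult_closed
  note Nil = letter_map_Nil[OF \<alpha>, folded Sh_one] letter_map_Nil[OF \<beta>, folded Sh_one] letter_map_Nil[OF \<gamma>, folded Sh_one]
  note cons = letter_map_cons[OF \<alpha>] letter_map_cons[OF \<beta>] letter_map_cons[OF \<gamma>]
  have zero: "\<And>h. h \<in> linear_maps K S S \<Longrightarrow> h \<zero>\<^bsub>S\<^esub> = \<zero>\<^bsub>S\<^esub>" by (rule SS.linear_zero)
  have comp: "letter_map \<alpha> (letter_map \<beta> q) = letter_map \<gamma> q" if "q \<in> carrier S" for q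
    by (rule linear_eq_on_Sh[OF Sh_module linear_comp[OF D(2) D(1)] D(3) _ _ that])
      (simp_all add: Sh_one[symmetric] Nil zero[OF D(1)] cons Dcl \<alpha>\<beta>)
  have comp': "letter_map \<beta> (letter_map \<alpha> q) = letter_map \<gamma> q" if "q \<in> carrier S" for q
    by (rule linear_eq_on_Sh[OF Sh_module linear_comp[OF D(1) D(2)] D(3) _ _ that])
      (simp_all add: Sh_one[symmetric] Nil zero[OF D(2)] cons Dcl \<beta>\<alpha>)
  have left: "(\<lambda>p. letter_map \<alpha> p \<star> letter_map \<beta> q \<boxplus> letter_map \<gamma> (p \<star> q)) \<in> linear_maps K S S"
    "(\<lambda>p. letter_map \<alpha> (p \<star> letter_map \<beta> q) \<boxplus> letter_map \<beta> (letter_map \<alpha> p \<star> q)) \<in> linear_maps K S S"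
    if "q \<in> carrier S" for q
    by (intro SS.linear_sum linear_comp[OF D(1) lin(1)] linear_comp[OF lin(1) D(3)] linear_comp[OF lin(1) D(1)]
      linear_comp[OF linear_comp[OF D(1) lin(1)] D(2)] cl that)+
  have right: "(\<lambda>q. letter_map \<alpha> p \<star> letter_map \<beta> q \<boxplus> letter_map \<gamma> (p \<star> q)) \<in> linear_maps K S S"
    "(\<lambda>q. letter_map \<alpha> (p \<star> letter_map \<beta> q) \<boxplus> letter_map \<beta> (letter_map \<alpha> p \<star> q)) \<in> linear_maps K S S"
    if "p \<in> carrier S" for p
    by (intro SS.linear_sum linear_comp[OF D(2) lin(2)] linear_comp[OF lin(2) D(3)] linear_comp[OF lin(2) D(2)]
      linear_comp[OF linear_comp[OF D(2) lin(2)] D(1)] cl that)+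
  show ?thesis
  proof (rule linear_eq_on_Sh[OF Sh_module left(1)[OF q] left(2)[OF q] _ _ p])
    show "letter_map \<alpha> (word []) \<star> letter_map \<beta> q \<boxplus> letter_map \<gamma> (word [] \<star> q) =
      letter_map \<alpha> (word [] \<star> letter_map \<beta> q) \<boxplus> letter_map \<beta> (letter_map \<alpha> (word []) \<star> q)"
      using cl q by (simp add: Sh_one[symmetric] Nil comp zero[OF D(2)])
    fix v p assume v: "v \<in> carrier V" and p: "p \<in> carrier S"
    then have vp: "cons v p \<in> carrier S" by (rule cons_closed)
    show "letter_map \<alpha> (cons v p) \<star> letter_map \<beta> q \<boxplus> letter_map \<gamma> (cons v p \<star> q) =
      letter_map \<alpha> (cons v p \<star> letter_map \<beta> q) \<boxplus> letter_map \<beta> (letter_map \<alpha> (cons v p) \<star> q)"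
    proof (rule linear_eq_on_Sh[OF Sh_module right(1)[OF vp] right(2)[OF vp] _ _ q])
      show "letter_map \<alpha> (cons v p) \<star> letter_map \<beta> (word []) \<boxplus> letter_map \<gamma> (cons v p \<star> word []) =
        letter_map \<alpha> (cons v p \<star> letter_map \<beta> (word [])) \<boxplus> letter_map \<beta> (letter_map \<alpha> (cons v p) \<star> word [])"
        using cl vp by (simp add: Sh_one[symmetric] Nil comp' zero[OF D(1)])
      fix w q assume w: "w \<in> carrier V" and q: "q \<in> carrier S"
      show "letter_map \<alpha> (cons v p) \<star> letter_map \<beta> (cons w q) \<boxplus> letter_map \<gamma> (cons v p \<star> cons w q) =
        letter_map \<alpha> (cons v p \<star> letter_map \<beta> (cons w q)) \<boxplus> letter_map \<beta> (letter_map \<alpha> (cons v p) \<star> cons w q)"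
        using cl v p w q
        by (simp add: cons cons_mult_cons linear_add[OF D(1)] linear_add[OF D(2)] linear_add[OF D(3)]
            \<alpha>\<beta> \<beta>\<alpha> S.M.a_ac)
    qed
  qed
qed

lemma letter_map_bilinear:
  assumes F: "module K F" and act: "act \<in> bilinear_maps K F V V"
  shows "(\<lambda>c. letter_map (act c)) \<in> bilinear_maps K F S S"
proof (rule bilinear_from_span[OF F Sh_module Sh_module words_span])
  show "letter_map (act c) \<in> linear_maps K S S" if "c \<in> carrier F" for c
    by (rule letter_map_linear[OF bilinear_right[OF act that]])
  interpret FS: two_modules K F S by (intro two_modules.intro F Sh_module)
  fix p assume "p \<in> word ` W"
  then obtain w where w: "p = word w" "w \<in> W" by blast
  show "(\<lambda>c. letter_map (act c) p) \<in> linear_maps K F S"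
  proof (cases w)
    case Nil
    show ?thesis
      by (rule linear_cong[OF FS.linear_zero_map])
        (simp_all add: w Nil F letter_map_Nil[OF bilinear_right[OF act]])
  next
    case (Cons v w')
    with w have v: "v \<in> carrier V" "w' \<in> W" by auto
    moreover have "cons (act c v) (word w') = word (act c v # w')" if "c \<in> carrier F" for c
      by (rule cons_word[OF bilinear_closed[OF act that v(1)] v(2)])
    ultimately show ?thesis
      by (intro linear_cong[OF linear_comp[OF bilinear_left[OF act] bilinear_left[OF cons_bilinear word_closed]]])
        (simp_all add: w Cons F letter_map_word[OF bilinear_right[OF act]])
  qed
qed

end

section \<open>The unitization\<close>

lemma unitization_simps [simp]:
  "carrier (unitization K B) = carrier K \<times> carrier B"
  "(a, x) \<otimes>\<^bsub>unitization K B\<^esub> (b, y) = (a \<otimes>\<^bsub>K\<^esub> b, a \<odot>\<^bsub>B\<^esub> y \<oplus>\<^bsub>B\<^esub> b \<odot>\<^bsub>B\<^esub> x \<oplus>\<^bsub>B\<^esub> x \<otimes>\<^bsub>B\<^esub> y)"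
  "\<one>\<^bsub>unitization K B\<^esub> = (\<one>\<^bsub>K\<^esub>, \<zero>\<^bsub>B\<^esub>)"
  "\<zero>\<^bsub>unitization K B\<^esub> = (\<zero>\<^bsub>K\<^esub>, \<zero>\<^bsub>B\<^esub>)"
  "(a, x) \<oplus>\<^bsub>unitization K B\<^esub> (b, y) = (a \<oplus>\<^bsub>K\<^esub> b, x \<oplus>\<^bsub>B\<^esub> y)"
  "c \<odot>\<^bsub>unitization K B\<^esub> (a, x) = (c \<otimes>\<^bsub>K\<^esub> a, c \<odot>\<^bsub>B\<^esub> x)"
  by (simp_all add: unitization_def)

lemma (in nonunital_comm_algebra) unitization_algebra: "algebra K (unitization K B)"
proof -
  let ?A = "unitization K B"
  note cl = m_closed M.add.m_closed smult_closed
  have r_distr: "x \<otimes> (y \<oplus> z) = x \<otimes> y \<oplus> x \<otimes> z"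
    if "x \<in> carrier B" "y \<in> carrier B" "z \<in> carrier B" for x y z
    using that by (simp add: m_comm[of x] l_distr)
  have smult_r: "x \<otimes> (a \<odot> y) = a \<odot> (x \<otimes> y)"
    if "a \<in> carrier K" "x \<in> carrier B" "y \<in> carrier B" for a x y
    using that by (simp add: m_comm[of x] smult_assoc2)
  have smult_swap: "a \<odot> (b \<odot> x) = b \<odot> (a \<odot> x)" if "a \<in> carrier K" "b \<in> carrier K" "x \<in> carrier B" for a b x
    using that by (simp add: smult_assoc1[symmetric] R.m_comm)
  have zero: "x \<otimes> \<zero> = \<zero>" "\<zero> \<otimes> x = \<zero>" if "x \<in> carrier B" for x
    using that smult_r[of "\<zero>\<^bsub>K\<^esub>" x \<zero>] smult_assoc2[of "\<zero>\<^bsub>K\<^esub>" \<zero> x] by (simp_all add: m_closed)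
  have group: "abelian_group ?A"
  proof (rule abelian_groupI)
    fix u assume "u \<in> carrier ?A"
    then show "\<exists>v\<in>carrier ?A. v \<oplus>\<^bsub>?A\<^esub> u = \<zero>\<^bsub>?A\<^esub>"
      by (intro bexI[of _ "(\<ominus>\<^bsub>K\<^esub> fst u, \<ominus> snd u)"]) (auto simp: R.l_neg M.l_neg)
  qed (auto simp: R.a_ac M.a_ac)
  have monoid: "Group.comm_monoid ?A"
  proof (rule comm_monoidI)
    fix u v w assume "u \<in> carrier ?A" "v \<in> carrier ?A" "w \<in> carrier ?A"
    then show "u \<otimes>\<^bsub>?A\<^esub> v \<otimes>\<^bsub>?A\<^esub> w = u \<otimes>\<^bsub>?A\<^esub> (v \<otimes>\<^bsub>?A\<^esub> w)"
      by (auto simp: cl R.m_assoc smult_r_distr l_distr r_distr smult_assoc1 smult_assoc2 smult_r m_assoc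
          smult_swap M.a_ac)
  next
    fix u v assume "u \<in> carrier ?A" "v \<in> carrier ?A"
    then show "u \<otimes>\<^bsub>?A\<^esub> v = v \<otimes>\<^bsub>?A\<^esub> u"
      using R.m_comm m_comm by (auto simp: cl M.a_ac)
  qed (auto simp: cl zero)
  have "cring ?A"
    by (rule cringI[OF group monoid])
      (auto simp: R.l_distr l_distr smult_l_distr smult_r_distr cl M.a_ac)
  then show ?thesis
    by (rule algebraI[OF R.is_cring])
      (auto simp: cl R.l_distr R.r_distr R.m_assoc smult_l_distr smult_r_distr smult_assoc1 smult_assoc2
        smult_swap)
qed


section \<open>The algebra \<open>Sha\<close> and its operators\<close>

text \<open>Identities in the shuffle algebra are stated with sums on both sides, whereas the operators of
  \<open>Sha\<close> contain a difference; this converts the former into the latter.\<close>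

lemma (in module_over) cancel_sum:
  assumes "l \<oplus> n = m \<oplus> k" "l \<in> carrier M" "n \<in> carrier M" "m \<in> carrier M" "k \<in> carrier M" "x \<in> carrier M"
  shows "x \<ominus> k = (x \<ominus> l) \<oplus> (m \<ominus> n)"
proof -
  have m: "m = (l \<oplus> n) \<oplus> \<ominus> k" using assms by (simp add: M.a_assoc M.r_neg)
  have "(x \<ominus> l) \<oplus> (m \<ominus> n) = (x \<oplus> \<ominus> k) \<oplus> ((l \<oplus> \<ominus> l) \<oplus> (n \<oplus> \<ominus> n))"
    unfolding m M.minus_eq using assms(2-) by (simp only: M.a_ac M.a_inv_closed M.add.m_closed)
  then show ?thesis using assms(2-) by (simp add: M.r_neg M.minus_eq)
qed

locale sha_construction = F: comm_matching_RBA K \<Omega> F \<kappa> + B: nonunital_comm_algebra K B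
  for K :: "'k ring" and \<Omega> :: "'w set" and F :: "('k, 'f) module" and \<kappa> :: "'w \<Rightarrow> 'f \<Rightarrow> 'f"
    and B :: "('k, 'b) module"
begin

sublocale coefficients K
  by (rule coefficients.intro) (rule F.R.is_cring)

abbreviation "A \<equiv> unitization K B"
abbreviation "FA \<equiv> tensor K F A"
abbreviation "FB \<equiv> tensor K F B"
abbreviation "k\<Omega> \<equiv> free_module K \<Omega>"
abbreviation "V \<equiv> tensor K k\<Omega> FB"
abbreviation "S \<equiv> Sh K V"
abbreviation "Z \<equiv> tensor K FA S"
abbreviation S_mult (infixl "\<star>" 70) where "p \<star> q \<equiv> p \<otimes>\<^bsub>S\<^esub> q"
abbreviation Z_mult (infixl "\<diamondop>" 70) where "x \<diamondop> y \<equiv> x \<otimes>\<^bsub>Z\<^esub> y"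
abbreviation Z_diff (infixl "\<ominus>\<^sub>Z" 65) where "x \<ominus>\<^sub>Z y \<equiv> x \<ominus>\<^bsub>Z\<^esub> y"
abbreviation Z_add (infixl "\<oplus>\<^sub>Z" 65) where "x \<oplus>\<^sub>Z y \<equiv> x \<oplus>\<^bsub>Z\<^esub> y"

sublocale A: algebra K A by (rule B.unitization_algebra)

sublocale FA: two_algebras K F A
  by (intro two_algebras.intro F.algebra_axioms B.unitization_algebra)

sublocale FA: algebra K FA by (rule FA.tensor_algebra)

sublocale FB: two_modules K F B
  by (intro two_modules.intro F.module_axioms B.module_axioms)

lemma FB_module: "module K FB" by (rule FB.tensor_module)

sublocale LV: two_modules K k\<Omega> FB
  by (intro two_modules.intro free_module_module FB_module)

lemma V_module: "module K V" by (rule LV.tensor_module)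

sublocale sh: shuffle_algebra K V
  by (intro shuffle_algebra.intro module_over.intro V_module)

sublocale Z: two_algebras K FA S
  by (intro two_algebras.intro FA.tensor_algebra sh.Sh_algebra)

sublocale Z: algebra K Z by (rule Z.tensor_algebra)

lemma constructions: "frakA K F B = FA" "frakA_plus K F B = FB" "letters K \<Omega> F B = V" "Sha K \<Omega> F B = Z"
  by (simp_all add: frakA_def frakA_plus_def letters_def Sha_def)

subsection \<open>The decomposition of \<open>F \<otimes> A\<close>\<close>

text \<open>\<open>E\<close> and \<open>e\<close> embed the summands \<open>F\<close> and \<open>F \<otimes> B\<close>. The two projections are obtained from the
  universal property; they turn the case distinction in the definition of the operators into
  a single bilinear formula.\<close>

abbreviation "E \<equiv> F_embed K F B"
abbreviation "e \<equiv> plus_embed K F B"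
abbreviation "act \<equiv> F_action K F B"

lemma E_linear: "E \<in> linear_maps K F FA"
  using bilinear_left[OF FA.pure_tensor_bilinear A.one_closed] by (simp add: F_embed_def[abs_def])

lemma E_mult: "c \<in> carrier F \<Longrightarrow> d \<in> carrier F \<Longrightarrow> E c \<otimes>\<^bsub>FA\<^esub> E d = E (c \<otimes>\<^bsub>F\<^esub> d)"
  using A.one_closed A.l_one[OF A.one_closed] by (simp add: F_embed_def FA.tensor_mult_pure del: unitization_simps)

lemma E_one: "E \<one>\<^bsub>F\<^esub> = \<one>\<^bsub>FA\<^esub>"
  by (simp add: F_embed_def FA.tensor_one)

lemma embed_B_linear: "(\<lambda>b. (\<zero>\<^bsub>K\<^esub>, b)) \<in> linear_maps K B A"
  by (rule linear_mapsI) auto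

interpretation embed: two_linear_maps K F B F A "\<lambda>c. c" "\<lambda>b. (\<zero>\<^bsub>K\<^esub>, b)"
  by (intro two_linear_maps.intro two_linear_maps_axioms.intro FB.two_modules_axioms FA.two_modules_axioms
      linear_id embed_B_linear)

lemma e_linear: "e \<in> linear_maps K FB FA"
  using embed.tensor_map_linear by (simp add: plus_embed_def)

lemma e_pure: "c \<in> carrier F \<Longrightarrow> b \<in> carrier B \<Longrightarrow>
    e (pure_tensor K F B c b) = pure_tensor K F A c (\<zero>\<^bsub>K\<^esub>, b)"
  using embed.tensor_map_pure by (simp add: plus_embed_def)

lemma
  assumes c: "c \<in> carrier F"
  shows act_linear: "act c \<in> linear_maps K FB FB"
    and act_pure: "c' \<in> carrier F \<Longrightarrow> b \<in> carrier B \<Longrightarrow>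
      act c (pure_tensor K F B c' b) = pure_tensor K F B (c \<otimes>\<^bsub>F\<^esub> c') b"
proof -
  interpret act: two_linear_maps K F B F B "\<lambda>c'. c \<otimes>\<^bsub>F\<^esub> c'" "\<lambda>b. b"
    by (intro two_linear_maps.intro two_linear_maps_axioms.intro FB.two_modules_axioms
      linear_id bilinear_right[OF mult_bilinear[OF F.algebra_axioms] c])
  show "act c \<in> linear_maps K FB FB"
    using act.tensor_map_linear by (simp add: F_action_def)
  show "c' \<in> carrier F \<Longrightarrow> b \<in> carrier B \<Longrightarrow>
      act c (pure_tensor K F B c' b) = pure_tensor K F B (c \<otimes>\<^bsub>F\<^esub> c') b"
    using act.tensor_map_pure by (simp add: F_action_def)
qed

abbreviation "FB_pures \<equiv> (\<lambda>(c, b). pure_tensor K F B c b) ` (carrier F \<times> carrier B)"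

lemma FB_span: "submodule_span K FB FB_pures = carrier FB"
  by (intro FB.pure_tensors_span carrier_spans F.module_axioms B.module_axioms)

lemma act_bilinear: "act \<in> bilinear_maps K F FB FB"
proof (rule bilinear_from_span[OF F.module_axioms FB_module FB_module FB_span act_linear])
  fix u assume "u \<in> FB_pures"
  then obtain c b where u: "u = pure_tensor K F B c b" "c \<in> carrier F" "b \<in> carrier B" by auto
  have "(\<lambda>x. pure_tensor K F B (x \<otimes>\<^bsub>F\<^esub> c) b) \<in> linear_maps K F FB"
    using u by (intro linear_comp[OF bilinear_left[OF mult_bilinear[OF F.algebra_axioms]]
      bilinear_left[OF FB.pure_tensor_bilinear]])
  then show "(\<lambda>x. act x u) \<in> linear_maps K F FB"
    by (rule linear_cong) (use u in \<open>simp_all add: act_pure F.module_axioms\<close>)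
qed

lemma act_act:
  assumes "c \<in> carrier F" "d \<in> carrier F" "u \<in> carrier FB"
  shows "act c (act d u) = act (c \<otimes>\<^bsub>F\<^esub> d) u"
  by (rule linear_eq_on_span[OF FB_module FB_module FB_span])
    (use assms in \<open>auto simp: act_pure F.m_assoc intro: linear_comp act_linear\<close>)

lemma E_mult_e:
  assumes c: "c \<in> carrier F" and u: "u \<in> carrier FB"
  shows "E c \<otimes>\<^bsub>FA\<^esub> e u = e (act c u)"
proof (rule linear_eq_on_span[OF FB_module FA.tensor_module FB_span _ _ _ u])
  show "(\<lambda>u. E c \<otimes>\<^bsub>FA\<^esub> e u) \<in> linear_maps K FB FA"
    by (rule linear_comp[OF e_linear bilinear_right[OF FA.tensor_mult_bilinear linear_closed[OF E_linear c]]])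
  show "(\<lambda>u. e (act c u)) \<in> linear_maps K FB FA"
    by (rule linear_comp[OF act_linear[OF c] e_linear])
  fix u assume "u \<in> FB_pures"
  then obtain c' b where u: "u = pure_tensor K F B c' b" "c' \<in> carrier F" "b \<in> carrier B" by auto
  have "\<one>\<^bsub>A\<^esub> \<otimes>\<^bsub>A\<^esub> (\<zero>\<^bsub>K\<^esub>, b) = (\<zero>\<^bsub>K\<^esub>, b)" using u by (intro A.l_one) simp
  then show "E c \<otimes>\<^bsub>FA\<^esub> e u = e (act c u)"
    using u c by (simp add: F_embed_def e_pure act_pure FA.tensor_mult_pure)
qed

abbreviation "FA_pures \<equiv> (\<lambda>(c, a). FA.pure c a) ` (carrier F \<times> carrier A)"

lemma FA_pures_span: "submodule_span K FA FA_pures = carrier FA"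
  by (intro FA.pure_tensors_span carrier_spans F.module_axioms A.module_axioms)

definition \<pi>\<^sub>F :: "('f \<times> 'k \<times> 'b \<Rightarrow> 'k) set \<Rightarrow> 'f" where
  "\<pi>\<^sub>F = tensor_lift K F (\<lambda>c (a, b). a \<odot>\<^bsub>F\<^esub> c)"

definition \<pi>\<^sub>B :: "('f \<times> 'k \<times> 'b \<Rightarrow> 'k) set \<Rightarrow> ('f \<times> 'b \<Rightarrow> 'k) set" where
  "\<pi>\<^sub>B = tensor_lift K FB (\<lambda>c (a, b). pure_tensor K F B c b)"

lemma \<pi>\<^sub>F_bilinear: "(\<lambda>c (a, b). a \<odot>\<^bsub>F\<^esub> c) \<in> bilinear_maps K F A F"
  by (intro bilinear_mapsI linear_mapsI)
    (auto simp: F.smult_l_distr F.smult_r_distr F.smult_assoc1[symmetric] F.R.m_comm)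

lemma \<pi>\<^sub>B_bilinear: "(\<lambda>c (a, b). pure_tensor K F B c b) \<in> bilinear_maps K F A FB"
  using bilinear_left[OF FB.pure_tensor_bilinear] bilinear_right[OF FB.pure_tensor_bilinear]
  by (auto simp: bilinear_maps_def linear_maps_def Pi_iff)

lemmas \<pi>\<^sub>F_linear = FA.tensor_lift_linear[OF F.module_axioms \<pi>\<^sub>F_bilinear, folded \<pi>\<^sub>F_def]
lemmas \<pi>\<^sub>F_pure = FA.tensor_lift_pure[OF F.module_axioms \<pi>\<^sub>F_bilinear, folded \<pi>\<^sub>F_def]
lemmas \<pi>\<^sub>B_linear = FA.tensor_lift_linear[OF FB_module \<pi>\<^sub>B_bilinear, folded \<pi>\<^sub>B_def]
lemmas \<pi>\<^sub>B_pure = FA.tensor_lift_pure[OF FB_module \<pi>\<^sub>B_bilinear, folded \<pi>\<^sub>B_def]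

lemma \<pi>\<^sub>F_E: "c \<in> carrier F \<Longrightarrow> \<pi>\<^sub>F (E c) = c"
  by (simp add: F_embed_def \<pi>\<^sub>F_pure)

lemma pure_zero: "c \<in> carrier F \<Longrightarrow> pure_tensor K F B c \<zero>\<^bsub>B\<^esub> = \<zero>\<^bsub>FB\<^esub>"
  using linear_zero[OF B.module_axioms FB_module
    bilinear_right[OF FB.pure_tensor_bilinear]] .

lemma \<pi>\<^sub>B_E: "c \<in> carrier F \<Longrightarrow> \<pi>\<^sub>B (E c) = \<zero>\<^bsub>FB\<^esub>"
  by (simp add: F_embed_def \<pi>\<^sub>B_pure pure_zero)

lemma \<pi>\<^sub>F_e:
  assumes "u \<in> carrier FB" shows "\<pi>\<^sub>F (e u) = \<zero>\<^bsub>F\<^esub>"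
proof -
  interpret X: two_modules K FB F by (intro two_modules.intro FB_module F.module_axioms)
  show ?thesis
    by (rule linear_eq_on_span[OF FB_module F.module_axioms FB_span linear_comp[OF e_linear \<pi>\<^sub>F_linear] X.linear_zero_map])
      (use assms in \<open>auto simp: e_pure \<pi>\<^sub>F_pure\<close>)
qed

lemma \<pi>\<^sub>B_e:
  assumes "u \<in> carrier FB" shows "\<pi>\<^sub>B (e u) = u"
  by (rule linear_eq_on_span[OF FB_module FB_module FB_span linear_comp[OF e_linear \<pi>\<^sub>B_linear] linear_id])
    (use assms in \<open>auto simp: e_pure \<pi>\<^sub>B_pure\<close>)

lemma FA_decomposition:
  assumes "u \<in> carrier FA" shows "u = E (\<pi>\<^sub>F u) \<oplus>\<^bsub>FA\<^esub> e (\<pi>\<^sub>B u)"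
proof -
  interpret X: two_modules K FA FA by (intro two_modules.intro FA.tensor_module)
  show ?thesis
  proof (rule linear_eq_on_span[OF FA.tensor_module FA.tensor_module FA_pures_span linear_id _ _ assms])
    show "(\<lambda>u. E (\<pi>\<^sub>F u) \<oplus>\<^bsub>FA\<^esub> e (\<pi>\<^sub>B u)) \<in> linear_maps K FA FA"
      by (intro X.linear_sum linear_comp[OF \<pi>\<^sub>F_linear E_linear] linear_comp[OF \<pi>\<^sub>B_linear e_linear])
    fix u assume "u \<in> FA_pures"
    then obtain c a b where u: "u = pure_tensor K F A c (a, b)" "c \<in> carrier F" "a \<in> carrier K" "b \<in> carrier B"
      by auto
    have "pure_tensor K F A (a \<odot>\<^bsub>F\<^esub> c) \<one>\<^bsub>A\<^esub> = pure_tensor K F A c (a \<odot>\<^bsub>A\<^esub> \<one>\<^bsub>A\<^esub>)"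
      using u linear_smult[OF bilinear_left[OF FA.pure_tensor_bilinear A.one_closed] u(3,2)]
        linear_smult[OF bilinear_right[OF FA.pure_tensor_bilinear u(2)] u(3) A.one_closed]
      by (simp del: unitization_simps)
    moreover have "pure_tensor K F A c (a \<odot>\<^bsub>A\<^esub> \<one>\<^bsub>A\<^esub> \<oplus>\<^bsub>A\<^esub> (\<zero>\<^bsub>K\<^esub>, b)) =
        pure_tensor K F A c (a \<odot>\<^bsub>A\<^esub> \<one>\<^bsub>A\<^esub>) \<oplus>\<^bsub>FA\<^esub> pure_tensor K F A c (\<zero>\<^bsub>K\<^esub>, b)"
      using u by (intro linear_add[OF bilinear_right[OF FA.pure_tensor_bilinear u(2)]]) auto
    moreover have "\<pi>\<^sub>F u = a \<odot>\<^bsub>F\<^esub> c" "\<pi>\<^sub>B u = pure_tensor K F B c b"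
      using u by (simp_all add: \<pi>\<^sub>F_pure \<pi>\<^sub>B_pure)
    ultimately show "u = E (\<pi>\<^sub>F u) \<oplus>\<^bsub>FA\<^esub> e (\<pi>\<^sub>B u)"
      using u by (simp add: e_pure F_embed_def)
  qed
qed

lemma FA_span: "submodule_span K FA (E ` carrier F \<union> e ` carrier FB) = carrier FA"
proof (rule module_over.spanningI[OF module_over.intro[OF FA.tensor_module]])
  fix H assume H: "submodule H K FA" "E ` carrier F \<union> e ` carrier FB \<subseteq> H"
  show "carrier FA \<subseteq> H"
  proof
    fix u assume u: "u \<in> carrier FA"
    have "E (\<pi>\<^sub>F u) \<in> H" "e (\<pi>\<^sub>B u) \<in> H"
      using H(2) linear_closed[OF \<pi>\<^sub>F_linear u] linear_closed[OF \<pi>\<^sub>B_linear u] by auto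
    then show "u \<in> H"
      by (subst FA_decomposition[OF u]) (rule FA.submoduleE(5)[OF H(1)])
  qed
qed (use linear_closed[OF E_linear] linear_closed[OF e_linear] in auto)


subsection \<open>Letters and their \<open>F\<close>-action\<close>

abbreviation "letter \<omega> u \<equiv> pure_tensor K k\<Omega> FB (basis_elt K \<omega>) u"

abbreviation "letter_pures \<equiv> (\<lambda>(p, u). pure_tensor K k\<Omega> FB p u) ` (basis_elt K ` \<Omega> \<times> carrier FB)"

lemma letter_linear: "\<omega> \<in> \<Omega> \<Longrightarrow> letter \<omega> \<in> linear_maps K FB V"
  by (rule bilinear_right[OF LV.pure_tensor_bilinear basis_elt_closed])

lemma letters_span: "submodule_span K V letter_pures = carrier V"
  by (intro LV.pure_tensors_span basis_spans_free_module carrier_spans FB_module)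

definition letter_act :: "'f \<Rightarrow> ('k, 'w, 'f, 'b) letter \<Rightarrow> ('k, 'w, 'f, 'b) letter" where
  "letter_act c = tensor_map K k\<Omega> FB (\<lambda>p. p) (act c)"

lemma
  assumes c: "c \<in> carrier F"
  shows letter_act_linear: "letter_act c \<in> linear_maps K V V"
    and letter_act_pure: "p \<in> carrier k\<Omega> \<Longrightarrow> u \<in> carrier FB \<Longrightarrow>
      letter_act c (pure_tensor K k\<Omega> FB p u) = pure_tensor K k\<Omega> FB p (act c u)"
proof -
  interpret act: two_linear_maps K k\<Omega> FB k\<Omega> FB "\<lambda>p. p" "act c"
    by (intro two_linear_maps.intro two_linear_maps_axioms.intro LV.two_modules_axioms
      linear_id act_linear c)
  show "letter_act c \<in> linear_maps K V V"
    using act.tensor_map_linear by (simp add: letter_act_def)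
  show "p \<in> carrier k\<Omega> \<Longrightarrow> u \<in> carrier FB \<Longrightarrow>
      letter_act c (pure_tensor K k\<Omega> FB p u) = pure_tensor K k\<Omega> FB p (act c u)"
    using act.tensor_map_pure by (simp add: letter_act_def)
qed

lemma letter_act_letter:
  "c \<in> carrier F \<Longrightarrow> \<omega> \<in> \<Omega> \<Longrightarrow> u \<in> carrier FB \<Longrightarrow> letter_act c (letter \<omega> u) = letter \<omega> (act c u)"
  by (simp add: letter_act_pure basis_elt_closed)

lemma letter_act_bilinear: "letter_act \<in> bilinear_maps K F V V"
proof (rule bilinear_from_span[OF F.module_axioms V_module V_module letters_span letter_act_linear])
  fix v assume "v \<in> letter_pures"
  then obtain \<omega> u where v: "v = letter \<omega> u" "\<omega> \<in> \<Omega>" "u \<in> carrier FB" by auto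
  show "(\<lambda>c. letter_act c v) \<in> linear_maps K F V"
    by (rule linear_cong[OF linear_comp[OF bilinear_left[OF act_bilinear v(3)] letter_linear[OF v(2)]]])
      (use v in \<open>simp_all add: letter_act_letter F.module_axioms\<close>)
qed

lemma letter_act_act:
  assumes c: "c \<in> carrier F" and d: "d \<in> carrier F" and v: "v \<in> carrier V"
  shows "letter_act c (letter_act d v) = letter_act (c \<otimes>\<^bsub>F\<^esub> d) v"
proof (rule linear_eq_on_span[OF V_module V_module letters_span _ _ _ v])
  show "(\<lambda>v. letter_act c (letter_act d v)) \<in> linear_maps K V V"
    by (rule linear_comp[OF letter_act_linear[OF d] letter_act_linear[OF c]])
  show "letter_act (c \<otimes>\<^bsub>F\<^esub> d) \<in> linear_maps K V V" by (simp add: letter_act_linear c d)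
  fix v assume "v \<in> letter_pures"
  then obtain \<omega> u where v: "v = letter \<omega> u" "\<omega> \<in> \<Omega>" "u \<in> carrier FB" by auto
  then show "letter_act c (letter_act d v) = letter_act (c \<otimes>\<^bsub>F\<^esub> d) v"
    using c d linear_closed[OF act_linear[OF d]] by (simp add: letter_act_letter act_act)
qed

abbreviation "D c \<equiv> sh.letter_map (letter_act c)"

lemma D_linear: "c \<in> carrier F \<Longrightarrow> D c \<in> linear_maps K S S"
  by (rule sh.letter_map_linear[OF letter_act_linear])

lemma D_bilinear: "D \<in> bilinear_maps K F S S"
  using sh.letter_map_bilinear[OF F.module_axioms letter_act_bilinear] .

lemma D_mult_D:
  assumes "c \<in> carrier F" "d \<in> carrier F" "p \<in> carrier S" "q \<in> carrier S"
  shows "D c p \<star> D d q \<oplus>\<^bsub>S\<^esub> D (c \<otimes>\<^bsub>F\<^esub> d) (p \<star> q) = D c (p \<star> D d q) \<oplus>\<^bsub>S\<^esub> D d (D c p \<star> q)"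
  by (rule sh.letter_map_mult_letter_map)
    (use assms F.m_comm[of c d] in \<open>simp_all add: letter_act_linear letter_act_act\<close>)

subsection \<open>The operators\<close>

abbreviation "pz \<equiv> pure_tensor K FA S"


lemma pz_right: "u \<in> carrier FA \<Longrightarrow> pz u \<in> linear_maps K S Z"
  by (rule bilinear_right[OF Z.pure_tensor_bilinear])

lemma pz_left: "p \<in> carrier S \<Longrightarrow> (\<lambda>u. pz u p) \<in> linear_maps K FA Z"
  by (rule bilinear_left[OF Z.pure_tensor_bilinear])

text \<open>The projections replace the distinction whether \<open>u\<close> lies in \<open>F\<close> or in \<open>F \<otimes> B\<close>. There is no
  distinction for the empty word either, since \<^const>\<open>sh.letter_map\<close> kills it.\<close>

definition op_form :: "'w \<Rightarrow> ('f \<times> 'k \<times> 'b \<Rightarrow> 'k) set \<Rightarrow> (('k, 'w, 'f, 'b) letter list \<Rightarrow> 'k) set \<Rightarrow> ('k, 'w, 'f, 'b) sha" where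
  "op_form \<omega> u p = pz (E (\<kappa> \<omega> (\<pi>\<^sub>F u))) p \<ominus>\<^sub>Z pz \<one>\<^bsub>FA\<^esub> (D (\<kappa> \<omega> (\<pi>\<^sub>F u)) p) \<oplus>\<^sub>Z
    pz \<one>\<^bsub>FA\<^esub> (sh.cons (letter \<omega> (\<pi>\<^sub>B u)) p)"

definition op :: "'w \<Rightarrow> ('k, 'w, 'f, 'b) sha \<Rightarrow> ('k, 'w, 'f, 'b) sha" where
  "op \<omega> = tensor_lift K Z (op_form \<omega>)"

context
  fixes \<omega> assumes \<omega>: "\<omega> \<in> \<Omega>"
begin

lemma \<kappa>_linear: "\<kappa> \<omega> \<in> linear_maps K F F"
  by (rule F.P_linear[OF \<omega>])

lemma op_form_bilinear: "op_form \<omega> \<in> bilinear_maps K FA S Z"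
proof (rule bilinear_mapsI)
  note \<kappa>\<pi> = linear_comp[OF \<pi>\<^sub>F_linear \<kappa>_linear]
  fix u assume u: "u \<in> carrier FA"
  interpret SZ: two_modules K S Z by (intro two_modules.intro sh.Sh_module Z.tensor_module)
  note c = linear_closed[OF \<kappa>\<pi> u]
  show "op_form \<omega> u \<in> linear_maps K S Z"
    unfolding op_form_def
    by (intro SZ.linear_sum SZ.linear_difference pz_right linear_comp[OF D_linear pz_right] c FA.one_closed
      linear_closed[OF E_linear] linear_comp[OF bilinear_right[OF sh.cons_bilinear] pz_right]
      linear_closed[OF letter_linear] linear_closed[OF \<pi>\<^sub>B_linear u] \<omega>)
next
  note \<kappa>\<pi> = linear_comp[OF \<pi>\<^sub>F_linear \<kappa>_linear]
  fix p assume p: "p \<in> carrier S"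
  interpret FZ: two_modules K FA Z by (intro two_modules.intro FA.tensor_module Z.tensor_module)
  show "(\<lambda>u. op_form \<omega> u p) \<in> linear_maps K FA Z"
    unfolding op_form_def
    by (intro FZ.linear_sum FZ.linear_difference linear_comp[OF linear_comp[OF \<kappa>\<pi> E_linear] pz_left]
      linear_comp[OF linear_comp[OF \<kappa>\<pi> bilinear_left[OF D_bilinear]] pz_right] p FA.one_closed
      linear_comp[OF linear_comp[OF linear_comp[OF \<pi>\<^sub>B_linear letter_linear]
        bilinear_left[OF sh.cons_bilinear]] pz_right] \<omega>)
qed

lemma op_linear: "op \<omega> \<in> linear_maps K Z Z"
  unfolding op_def by (rule Z.tensor_lift_linear[OF Z.tensor_module op_form_bilinear])

lemma op_pz: "u \<in> carrier FA \<Longrightarrow> p \<in> carrier S \<Longrightarrow> op \<omega> (pz u p) = op_form \<omega> u p"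
  unfolding op_def by (rule Z.tensor_lift_pure[OF Z.tensor_module op_form_bilinear])

lemma op_E:
  assumes c: "c \<in> carrier F" and p: "p \<in> carrier S"
  shows "op \<omega> (pz (E c) p) = pz (E (\<kappa> \<omega> c)) p \<ominus>\<^sub>Z pz \<one>\<^bsub>FA\<^esub> (D (\<kappa> \<omega> c) p)"
proof -
  have cl: "E c \<in> carrier FA" "\<kappa> \<omega> c \<in> carrier F" "E (\<kappa> \<omega> c) \<in> carrier FA" "D (\<kappa> \<omega> c) p \<in> carrier S"
    using linear_closed[OF E_linear] linear_closed[OF \<kappa>_linear] linear_closed[OF D_linear] c p by auto
  have "letter \<omega> \<zero>\<^bsub>FB\<^esub> = \<zero>\<^bsub>V\<^esub>"
    by (rule linear_zero[OF FB_module V_module letter_linear[OF \<omega>]])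
  moreover have "sh.cons \<zero>\<^bsub>V\<^esub> p = \<zero>\<^bsub>S\<^esub>"
    by (rule linear_zero[OF V_module sh.Sh_module bilinear_left[OF sh.cons_bilinear p]])
  moreover have "pz \<one>\<^bsub>FA\<^esub> \<zero>\<^bsub>S\<^esub> = \<zero>\<^bsub>Z\<^esub>"
    by (rule linear_zero[OF sh.Sh_module Z.tensor_module pz_right[OF FA.one_closed]])
  ultimately show ?thesis
    using cl p c linear_closed[OF pz_right] by (simp add: op_pz op_form_def \<pi>\<^sub>F_E \<pi>\<^sub>B_E)
qed

lemma op_e:
  assumes u: "u \<in> carrier FB" and p: "p \<in> carrier S"
  shows "op \<omega> (pz (e u) p) = pz \<one>\<^bsub>FA\<^esub> (sh.cons (letter \<omega> u) p)"
proof -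
  have cl: "e u \<in> carrier FA" "sh.cons (letter \<omega> u) p \<in> carrier S"
    using linear_closed[OF e_linear u] sh.cons_closed[OF linear_closed[OF letter_linear[OF \<omega>] u] p] by auto
  have \<kappa>0: "\<kappa> \<omega> \<zero>\<^bsub>F\<^esub> = \<zero>\<^bsub>F\<^esub>"
    by (rule linear_zero[OF F.module_axioms F.module_axioms \<kappa>_linear])
  have E0: "E \<zero>\<^bsub>F\<^esub> = \<zero>\<^bsub>FA\<^esub>"
    by (rule linear_zero[OF F.module_axioms FA.tensor_module E_linear])
  have p0: "pz \<zero>\<^bsub>FA\<^esub> p = \<zero>\<^bsub>Z\<^esub>"
    by (rule linear_zero[OF FA.tensor_module Z.tensor_module pz_left[OF p]])
  have D0: "D \<zero>\<^bsub>F\<^esub> p = \<zero>\<^bsub>S\<^esub>"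
    by (rule linear_zero[OF F.module_axioms sh.Sh_module bilinear_left[OF D_bilinear p]])
  have p1: "pz \<one>\<^bsub>FA\<^esub> \<zero>\<^bsub>S\<^esub> = \<zero>\<^bsub>Z\<^esub>"
    by (rule linear_zero[OF sh.Sh_module Z.tensor_module pz_right[OF FA.one_closed]])
  show ?thesis
    using cl p u linear_closed[OF pz_right[OF FA.one_closed]]
    by (simp add: op_pz op_form_def \<pi>\<^sub>F_e \<pi>\<^sub>B_e \<kappa>0 E0 p0 D0 p1 Z.minus_eq)
qed

end

subsection \<open>The Rota-Baxter identity\<close>

abbreviation RB :: "'w \<Rightarrow> 'w \<Rightarrow> ('k, 'w, 'f, 'b) sha \<Rightarrow> ('k, 'w, 'f, 'b) sha \<Rightarrow> bool" where
  "RB \<alpha> \<beta> x y \<equiv> op \<alpha> x \<diamondop> op \<beta> y = op \<alpha> (x \<diamondop> op \<beta> y) \<oplus>\<^sub>Z op \<beta> (op \<alpha> x \<diamondop> y)"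

context
  fixes \<alpha> \<beta> assumes \<alpha>: "\<alpha> \<in> \<Omega>" and \<beta>: "\<beta> \<in> \<Omega>"
begin

text \<open>The identity is verified on pure tensors whose first factors lie in \<open>F\<close> or \<open>F \<otimes> B\<close>. If both lie
  in \<open>F \<otimes> B\<close>, it is the recursion of the shuffle product.\<close>

lemma RB_e_e:
  assumes u: "u \<in> carrier FB" and v: "v \<in> carrier FB" and p: "p \<in> carrier S" and q: "q \<in> carrier S"
  shows "RB \<alpha> \<beta> (pz (e u) p) (pz (e v) q)"
proof -
  define a b where "a = letter \<alpha> u" "b = letter \<beta> v"
  have ab: "a \<in> carrier V" "b \<in> carrier V"
    using linear_closed[OF letter_linear[OF \<alpha>] u] linear_closed[OF letter_linear[OF \<beta>] v] by (auto simp: a_b_def)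
  have eu: "e u \<in> carrier FA" "e v \<in> carrier FA" using u v linear_closed[OF e_linear] by auto
  note cl = sh.cons_closed sh.Sh_mult_closed ab p q eu FA.one_closed
  show ?thesis
    using cl u v by (simp add: op_e \<alpha> \<beta> Z.tensor_mult_pure a_b_def[symmetric] sh.cons_mult_cons
        linear_add[OF pz_right])
qed

text \<open>The terms with first factor \<open>\<kappa>\<^sub>\<alpha>(c)\<close> cancel. The others have first factor \<open>1\<close>, and their
  equality is \<open>letter_map_mult_cons\<close>.\<close>

lemma RB_E_e:
  assumes c: "c \<in> carrier F" and v: "v \<in> carrier FB" and p: "p \<in> carrier S" and q: "q \<in> carrier S"
  shows "RB \<alpha> \<beta> (pz (E c) p) (pz (e v) q)"
proof -
  define k b where "k = \<kappa> \<alpha> c" "b = letter \<beta> v"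
  have k: "k \<in> carrier F" using linear_closed[OF \<kappa>_linear[OF \<alpha>] c] by (simp add: k_b_def)
  have b: "b \<in> carrier V" using linear_closed[OF letter_linear[OF \<beta>] v] by (simp add: k_b_def)
  have emb: "E c \<in> carrier FA" "E k \<in> carrier FA" "e v \<in> carrier FA" "e (act k v) \<in> carrier FA" "act k v \<in> carrier FB"
    using c k v linear_closed[OF E_linear] linear_closed[OF e_linear] linear_closed[OF act_linear[OF k]] by auto
  note Dcl = linear_closed[OF D_linear[OF k]]
  note cl = sh.cons_closed sh.Sh_mult_closed b p q emb FA.one_closed Dcl
  have lhs: "op \<alpha> (pz (E c) p) \<diamondop> op \<beta> (pz (e v) q) =
      pz (E k) (p \<star> sh.cons b q) \<ominus>\<^sub>Z pz \<one>\<^bsub>FA\<^esub> (D k p \<star> sh.cons b q)"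
    using cl c v Z.pure_tensor_closed
    by (simp add: op_e op_E \<alpha> \<beta> k_b_def[symmetric] Z.minus_eq Z.l_distr Z.l_minus Z.tensor_mult_pure)
  have x: "op \<alpha> (pz (E c) p \<diamondop> op \<beta> (pz (e v) q)) =
      pz (E k) (p \<star> sh.cons b q) \<ominus>\<^sub>Z pz \<one>\<^bsub>FA\<^esub> (D k (p \<star> sh.cons b q))"
    using cl c v by (simp add: op_e op_E \<alpha> \<beta> k_b_def[symmetric] Z.tensor_mult_pure)
  have "op \<alpha> (pz (E c) p) \<diamondop> pz (e v) q = pz (e (act k v)) (p \<star> q) \<ominus>\<^sub>Z pz (e v) (D k p \<star> q)"
    using cl c v k Z.pure_tensor_closed
    by (simp add: op_E \<alpha> k_b_def[symmetric] Z.minus_eq Z.l_distr Z.l_minus Z.tensor_mult_pure E_mult_e)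
  then have y: "op \<beta> (op \<alpha> (pz (E c) p) \<diamondop> pz (e v) q) =
      pz \<one>\<^bsub>FA\<^esub> (sh.cons (letter_act k b) (p \<star> q)) \<ominus>\<^sub>Z pz \<one>\<^bsub>FA\<^esub> (sh.cons b (D k p \<star> q))"
    using cl v k Z.pure_tensor_closed two_modules.linear_diff[OF two_modules.intro[OF Z.tensor_module Z.tensor_module] op_linear[OF \<beta>]]
    by (simp add: op_e \<beta> k_b_def(2) letter_act_letter)
  have kb: "letter_act k b \<in> carrier V" using linear_closed[OF letter_act_linear[OF k] b] .
  have "pz \<one>\<^bsub>FA\<^esub> (D k (p \<star> sh.cons b q)) \<oplus>\<^sub>Z pz \<one>\<^bsub>FA\<^esub> (sh.cons b (D k p \<star> q)) =
      pz \<one>\<^bsub>FA\<^esub> (sh.cons (letter_act k b) (p \<star> q)) \<oplus>\<^sub>Z pz \<one>\<^bsub>FA\<^esub> (D k p \<star> sh.cons b q)"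
    using sh.letter_map_mult_cons[OF letter_act_linear[OF k] b p q] cl kb
    by (simp add: linear_add[OF pz_right, symmetric])
  from module_over.cancel_sum[OF module_over.intro[OF Z.tensor_module] this] show ?thesis
    unfolding lhs x y using cl kb Z.pure_tensor_closed by simp
qed

text \<open>The Rota-Baxter identity of \<open>F\<close> splits \<open>\<kappa>\<^sub>\<alpha>(c) \<kappa>\<^sub>\<beta>(d)\<close> into \<open>\<kappa>\<^sub>\<alpha>(c \<kappa>\<^sub>\<beta>(d))\<close> and \<open>\<kappa>\<^sub>\<beta>(\<kappa>\<^sub>\<alpha>(c) d)\<close>. This
  is used twice, for the first factor and for the action on the first letter; what remains is
  \<open>letter_map_mult_letter_map\<close>.\<close>

lemma RB_E_E:
  assumes c: "c \<in> carrier F" and d: "d \<in> carrier F" and p: "p \<in> carrier S" and q: "q \<in> carrier S"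
  shows "RB \<alpha> \<beta> (pz (E c) p) (pz (E d) q)"
proof -
  define k l m n where "k = \<kappa> \<alpha> c" "l = \<kappa> \<beta> d" "m = \<kappa> \<alpha> (c \<otimes>\<^bsub>F\<^esub> l)" "n = \<kappa> \<beta> (k \<otimes>\<^bsub>F\<^esub> d)"
  have F: "k \<in> carrier F" "l \<in> carrier F" "m \<in> carrier F" "n \<in> carrier F"
    using linear_closed[OF \<kappa>_linear[OF \<alpha>]] linear_closed[OF \<kappa>_linear[OF \<beta>]] c d by (auto simp: k_l_m_n_def)
  have kl: "k \<otimes>\<^bsub>F\<^esub> l = m \<oplus>\<^bsub>F\<^esub> n"
    using F.Rota_Baxter[OF \<alpha> \<beta> c d] by (simp add: k_l_m_n_def)
  have E: "E c \<in> carrier FA" "E k \<in> carrier FA" "E d \<in> carrier FA" "E l \<in> carrier FA" "E m \<in> carrier FA" "E n \<in> carrier FA"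
    using c d F linear_closed[OF E_linear] by auto
  note Dcl = linear_closed[OF D_linear[OF F(1)]] linear_closed[OF D_linear[OF F(2)]]
    linear_closed[OF D_linear[OF F(3)]] linear_closed[OF D_linear[OF F(4)]]
  note cl = sh.Sh_mult_closed p q E FA.one_closed Dcl Z.pure_tensor_closed
  interpret ZZ: two_modules K Z Z by (intro two_modules.intro Z.tensor_module)
  define X M N T U Y Y' where
    "X = pz (E k \<otimes>\<^bsub>FA\<^esub> E l) (p \<star> q)" "M = pz (E k) (p \<star> D l q)" "N = pz (E l) (D k p \<star> q)" "T = pz \<one>\<^bsub>FA\<^esub> (D k (p \<star> D l q))" "U = pz \<one>\<^bsub>FA\<^esub> (D l (D k p \<star> q))" "Y = pz \<one>\<^bsub>FA\<^esub> (D m (p \<star> q))" "Y' = pz \<one>\<^bsub>FA\<^esub> (D n (p \<star> q))"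
  define X1 X2 H where "X1 = pz (E m) (p \<star> q)" "X2 = pz (E n) (p \<star> q)" "H = pz \<one>\<^bsub>FA\<^esub> (D k p \<star> D l q)"
  have Zcl: "X \<in> carrier Z" "M \<in> carrier Z" "N \<in> carrier Z" "T \<in> carrier Z" "U \<in> carrier Z" "Y \<in> carrier Z" "Y' \<in> carrier Z"
    "X1 \<in> carrier Z" "X2 \<in> carrier Z" "H \<in> carrier Z"
    using cl by (simp_all add: X_M_N_T_U_Y_Y'_def X1_X2_H_def)
  have X: "X = X1 \<oplus>\<^sub>Z X2"
    using cl F by (simp add: X_M_N_T_U_Y_Y'_def X1_X2_H_def E_mult kl linear_add[OF E_linear] linear_add[OF pz_left])
  have "D (k \<otimes>\<^bsub>F\<^esub> l) (p \<star> q) = D m (p \<star> q) \<oplus>\<^bsub>S\<^esub> D n (p \<star> q)"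
    unfolding kl using cl F by (simp add: linear_add[OF bilinear_left[OF D_bilinear]])
  with D_mult_D[OF F(1,2) p q]
  have "pz \<one>\<^bsub>FA\<^esub> (D k p \<star> D l q \<oplus>\<^bsub>S\<^esub> (D m (p \<star> q) \<oplus>\<^bsub>S\<^esub> D n (p \<star> q))) =
    pz \<one>\<^bsub>FA\<^esub> (D k (p \<star> D l q) \<oplus>\<^bsub>S\<^esub> D l (D k p \<star> q))"
    by simp
  then have H: "H \<oplus>\<^sub>Z (Y \<oplus>\<^sub>Z Y') = T \<oplus>\<^sub>Z U"
    using cl by (simp add: X_M_N_T_U_Y_Y'_def X1_X2_H_def linear_add[OF pz_right])
  have px: "op \<alpha> (pz (E c) p) = pz (E k) p \<ominus>\<^sub>Z pz \<one>\<^bsub>FA\<^esub> (D k p)"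
    and py: "op \<beta> (pz (E d) q) = pz (E l) q \<ominus>\<^sub>Z pz \<one>\<^bsub>FA\<^esub> (D l q)"
    using c d p q by (simp_all add: op_E \<alpha> \<beta> k_l_m_n_def)
  have lhs: "op \<alpha> (pz (E c) p) \<diamondop> op \<beta> (pz (E d) q) = X \<ominus>\<^sub>Z M \<ominus>\<^sub>Z (N \<ominus>\<^sub>Z H)"
    unfolding px py X_M_N_T_U_Y_Y'_def X1_X2_H_def
    using cl by (simp add: Z.minus_eq Z.l_distr Z.r_distr Z.l_minus Z.r_minus Z.minus_add Z.tensor_mult_pure Z.a_ac)
  have "pz (E c) p \<diamondop> op \<beta> (pz (E d) q) = pz (E (c \<otimes>\<^bsub>F\<^esub> l)) (p \<star> q) \<ominus>\<^sub>Z pz (E c) (p \<star> D l q)"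
    unfolding py using cl c F by (simp add: Z.minus_eq Z.r_distr Z.r_minus Z.tensor_mult_pure E_mult)
  then have x: "op \<alpha> (pz (E c) p \<diamondop> op \<beta> (pz (E d) q)) = (X1 \<ominus>\<^sub>Z Y) \<ominus>\<^sub>Z (M \<ominus>\<^sub>Z T)"
    using cl c F linear_closed[OF E_linear]
    by (simp add: ZZ.linear_diff[OF op_linear[OF \<alpha>]] op_E \<alpha> k_l_m_n_def(1,3)[symmetric] X_M_N_T_U_Y_Y'_def X1_X2_H_def)
  have "op \<alpha> (pz (E c) p) \<diamondop> pz (E d) q = pz (E (k \<otimes>\<^bsub>F\<^esub> d)) (p \<star> q) \<ominus>\<^sub>Z pz (E d) (D k p \<star> q)"
    unfolding px using cl d F by (simp add: Z.minus_eq Z.l_distr Z.l_minus Z.tensor_mult_pure E_mult)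
  then have y: "op \<beta> (op \<alpha> (pz (E c) p) \<diamondop> pz (E d) q) = (X2 \<ominus>\<^sub>Z Y') \<ominus>\<^sub>Z (N \<ominus>\<^sub>Z U)"
    using cl d F linear_closed[OF E_linear]
    by (simp add: ZZ.linear_diff[OF op_linear[OF \<beta>]] op_E \<beta> k_l_m_n_def(2,4)[symmetric] X_M_N_T_U_Y_Y'_def X1_X2_H_def)
  have "H = (T \<oplus>\<^sub>Z U) \<oplus>\<^sub>Z \<ominus>\<^bsub>Z\<^esub> (Y \<oplus>\<^sub>Z Y')"
    using H[symmetric] Zcl by (simp add: Z.a_assoc Z.r_neg)
  then show ?thesis
    unfolding lhs x y using Zcl by (simp add: X Z.minus_eq Z.minus_add Z.a_ac)
qed

end

abbreviation "Z_pures \<equiv> (\<lambda>(u, p). pz u p) ` ((E ` carrier F \<union> e ` carrier FB) \<times> carrier S)"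

lemma Z_span: "submodule_span K Z Z_pures = carrier Z"
  by (intro Z.pure_tensors_span FA_span carrier_spans sh.Sh_module)

lemma RB_swap:
  assumes "\<alpha> \<in> \<Omega>" "\<beta> \<in> \<Omega>" "x \<in> carrier Z" "y \<in> carrier Z" "RB \<beta> \<alpha> y x"
  shows "RB \<alpha> \<beta> x y"
proof -
  note cl = linear_closed[OF op_linear[OF assms(1)]] linear_closed[OF op_linear[OF assms(2)]]
  have "op \<alpha> x \<diamondop> op \<beta> y = op \<beta> y \<diamondop> op \<alpha> x" "y \<diamondop> op \<alpha> x = op \<alpha> x \<diamondop> y"
    "op \<beta> y \<diamondop> x = x \<diamondop> op \<beta> y"
    using assms cl by (intro Z.m_comm; simp)+
  then show ?thesis using assms cl by (simp add: Z.a_comm Z.m_closed)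
qed

lemma RB_all:
  assumes \<alpha>: "\<alpha> \<in> \<Omega>" and \<beta>: "\<beta> \<in> \<Omega>" and x: "x \<in> carrier Z" and y: "y \<in> carrier Z"
  shows "RB \<alpha> \<beta> x y"
proof (rule bilinear_eq_on_span[OF Z.tensor_module Z.tensor_module Z.tensor_module Z_span Z_span _ _ _ x y])
  interpret ZZ: two_modules K Z Z by (intro two_modules.intro Z.tensor_module)
  note a = op_linear[OF \<alpha>] and b = op_linear[OF \<beta>]
  note ac = linear_closed[OF a] and bc = linear_closed[OF b]
  note l = bilinear_left[OF Z.tensor_mult_bilinear] and r = bilinear_right[OF Z.tensor_mult_bilinear]
  show "(\<lambda>x y. op \<alpha> x \<diamondop> op \<beta> y) \<in> bilinear_maps K Z Z Z"
    by (intro bilinear_mapsI linear_comp[OF a l] linear_comp[OF b r] ac bc)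
  show "(\<lambda>x y. op \<alpha> (x \<diamondop> op \<beta> y) \<oplus>\<^sub>Z op \<beta> (op \<alpha> x \<diamondop> y)) \<in> bilinear_maps K Z Z Z"
    by (intro bilinear_mapsI ZZ.linear_sum linear_comp[OF linear_comp[OF b r] a] linear_comp[OF r b]
      linear_comp[OF l a] linear_comp[OF linear_comp[OF a l] b] ac bc)
  fix s t assume s: "s \<in> Z_pures" and t: "t \<in> Z_pures"
  have cl: "pz (E c) p \<in> carrier Z" "pz (e u) p \<in> carrier Z"
    if "c \<in> carrier F" "u \<in> carrier FB" "p \<in> carrier S" for c u p
    using that Z.pure_tensor_closed linear_closed[OF E_linear] linear_closed[OF e_linear] by auto
  from s consider (E) c p where "s = pz (E c) p" "c \<in> carrier F" "p \<in> carrier S"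
    | (e) u p where "s = pz (e u) p" "u \<in> carrier FB" "p \<in> carrier S" by auto
  then show "RB \<alpha> \<beta> s t"
  proof cases
    case s: E
    from t consider (E) d q where "t = pz (E d) q" "d \<in> carrier F" "q \<in> carrier S"
      | (e) v q where "t = pz (e v) q" "v \<in> carrier FB" "q \<in> carrier S" by auto
    then show ?thesis
      by cases (use s in \<open>simp_all only: RB_E_E[OF \<alpha> \<beta>] RB_E_e[OF \<alpha> \<beta>]\<close>)
  next
    case s: e
    from t consider (E) d q where "t = pz (E d) q" "d \<in> carrier F" "q \<in> carrier S"
      | (e) v q where "t = pz (e v) q" "v \<in> carrier FB" "q \<in> carrier S" by auto
    then show ?thesis
    proof cases
      case E
      then show ?thesis unfolding s(1) E(1)
        using s by (intro RB_swap[OF \<alpha> \<beta>] RB_E_e[OF \<beta> \<alpha>]) (auto intro: Z.pure_tensor_closed linear_closed[OF E_linear] linear_closed[OF e_linear])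
    qed (use s in \<open>simp only: RB_e_e[OF \<alpha> \<beta>]\<close>)
  qed
qed


subsection \<open>Characterization of the operators\<close>

abbreviation "letter_word \<equiv> map (\<lambda>(\<omega>, v). letter \<omega> v)"

lemma letter_closed: "\<omega> \<in> \<Omega> \<Longrightarrow> u \<in> carrier FB \<Longrightarrow> letter \<omega> u \<in> carrier V"
  by (rule linear_closed[OF letter_linear])

lemma letter_word_closed: "ws \<in> lists (\<Omega> \<times> carrier FB) \<Longrightarrow> letter_word ws \<in> lists (carrier V)"
  by (induction ws) (auto simp: letter_closed)

lemma sha_pure_eq: "sha_pure K \<Omega> F B u ws = pz u (sh.word (letter_word ws))"
  by (simp add: sha_pure_def constructions)

lemma pz_one_zero: "pz \<one>\<^bsub>FA\<^esub> \<zero>\<^bsub>S\<^esub> = \<zero>\<^bsub>Z\<^esub>"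
  by (rule linear_zero[OF sh.Sh_module Z.tensor_module pz_right[OF FA.one_closed]])

lemma op_is_sha_operator:
  assumes \<omega>: "\<omega> \<in> \<Omega>" shows "is_sha_operator K \<Omega> F \<kappa> B \<omega> (op \<omega>)"
  unfolding is_sha_operator_def constructions sha_pure_eq
proof (intro conjI ballI op_linear[OF \<omega>])
  note kc = linear_closed[OF \<kappa>_linear[OF \<omega>]]
  fix c assume c: "c \<in> carrier F"
  note D = letter_act_linear[OF kc[OF c]]
  have "E (\<kappa> \<omega> c) \<in> carrier FA" using linear_closed[OF E_linear] kc c by simp
  then have "pz (E (\<kappa> \<omega> c)) (sh.word []) \<in> carrier Z" by (simp add: Z.pure_tensor_closed sh.word_closed)
  then show "op \<omega> (pz (E c) (sh.word (letter_word []))) = pz (E (\<kappa> \<omega> c)) (sh.word (letter_word []))"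
    using c by (simp add: op_E \<omega> sh.word_closed sh.letter_map_Nil[OF D] pz_one_zero Z.minus_eq)
  fix \<beta> u ws assume "\<beta> \<in> \<Omega>" "u \<in> carrier FB" "ws \<in> lists (\<Omega> \<times> carrier FB)"
  then show "op \<omega> (pz (E c) (sh.word (letter_word ((\<beta>, u) # ws)))) =
      pz (E (\<kappa> \<omega> c)) (sh.word (letter_word ((\<beta>, u) # ws))) \<ominus>\<^sub>Z
      pz \<one>\<^bsub>FA\<^esub> (sh.word (letter_word ((\<beta>, act (\<kappa> \<omega> c) u) # ws)))"
    using c kc letter_word_closed[of ws]
    by (simp add: op_E \<omega> sh.word_closed letter_closed sh.letter_map_word[OF D] letter_act_letter)
next
  fix u ws assume "u \<in> carrier FB" "ws \<in> lists (\<Omega> \<times> carrier FB)"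
  then show "op \<omega> (pz (e u) (sh.word (letter_word ws))) = pz \<one>\<^bsub>FA\<^esub> (sh.word (letter_word ((\<omega>, u) # ws)))"
    using letter_word_closed[of ws] by (simp add: op_e \<omega> sh.word_closed letter_closed sh.cons_word)
qed

text \<open>The prescribed values are those on the pure tensors with first factor in \<open>F\<close> or \<open>F \<otimes> B\<close> and
  with a word in letters \<open>\<omega> \<otimes> v\<close>. These span the algebra.\<close>

lemma sha_operators_agree:
  assumes P: "is_sha_operator K \<Omega> F \<kappa> B \<omega> P" and Q: "is_sha_operator K \<Omega> F \<kappa> B \<omega> Q" and x: "x \<in> carrier Z"
  shows "P x = Q x"
proof -
  note PQ = P[unfolded is_sha_operator_def constructions] Q[unfolded is_sha_operator_def constructions]
  have S_span: "submodule_span K S (sh.word ` lists letter_pures) = carrier S"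
    by (rule sh.words_in_spanning_letters_span[OF letters_span])
  show ?thesis
  proof (rule linear_eq_on_span[OF Z.tensor_module Z.tensor_module Z.pure_tensors_span[OF FA_span S_span] _ _ _ x])
    show "P \<in> linear_maps K Z Z" "Q \<in> linear_maps K Z Z" using PQ by auto
    fix z assume "z \<in> (\<lambda>(u, p). pz u p) ` ((E ` carrier F \<union> e ` carrier FB) \<times> sh.word ` lists letter_pures)"
    then obtain u w where z: "z = pz u (sh.word w)" "u \<in> E ` carrier F \<union> e ` carrier FB" "w \<in> lists letter_pures"
      by blast
    have "letter_pures = (\<lambda>(\<omega>, v). letter \<omega> v) ` (\<Omega> \<times> carrier FB)" by force
    then obtain ws where ws: "w = letter_word ws" "ws \<in> lists (\<Omega> \<times> carrier FB)"
      using z(3) by (auto simp: lists_image)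
    have z': "z = sha_pure K \<Omega> F B u ws" by (simp add: z(1) ws(1) sha_pure_eq)
    from z(2) show "P z = Q z"
    proof
      assume "u \<in> e ` carrier FB"
      then obtain v where "u = e v" "v \<in> carrier FB" by auto
      then show ?thesis unfolding z' using PQ ws(2) by simp
    next
      assume "u \<in> E ` carrier F"
      then obtain c where c: "u = E c" "c \<in> carrier F" by auto
      show ?thesis
      proof (cases ws)
        case Nil
        then show ?thesis unfolding z' using PQ c by auto
      next
        case (Cons y ws')
        obtain \<beta> v where y: "y = (\<beta>, v)" by force
        with Cons ws(2) have "\<beta> \<in> \<Omega>" "v \<in> carrier FB" "ws' \<in> lists (\<Omega> \<times> carrier FB)" by simp_all
        then show ?thesis unfolding z' Cons y c(1) using PQ c(2) by metis
      qed
    qed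
  qed
qed

lemma sha_operator_eq:
  assumes \<omega>: "\<omega> \<in> \<Omega>"
  shows "sha_operator K \<Omega> F \<kappa> B \<omega> = restrict (op \<omega>) (carrier Z)"
  unfolding sha_operator_def constructions
proof (rule the_equality)
  have "restrict (op \<omega>) (carrier Z) \<in> linear_maps K Z Z"
    by (rule linear_cong[OF op_linear[OF \<omega>] _ Z.tensor_module]) simp
  moreover have "sha_pure K \<Omega> F B u ws \<in> carrier Z" if "u \<in> carrier FA" "ws \<in> lists (\<Omega> \<times> carrier FB)" for u ws
    using that letter_word_closed by (simp add: sha_pure_eq Z.pure_tensor_closed sh.word_closed)
  moreover have "\<And>c. c \<in> carrier F \<Longrightarrow> E c \<in> carrier FA" "\<And>u. u \<in> carrier FB \<Longrightarrow> e u \<in> carrier FA"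
    using linear_closed[OF E_linear] linear_closed[OF e_linear] by auto
  ultimately have "is_sha_operator K \<Omega> F \<kappa> B \<omega> (restrict (op \<omega>) (carrier Z))"
    using op_is_sha_operator[OF \<omega>] by (simp add: is_sha_operator_def constructions)
  then show *: "restrict (op \<omega>) (carrier Z) \<in> extensional (carrier Z) \<and>
      is_sha_operator K \<Omega> F \<kappa> B \<omega> (restrict (op \<omega>) (carrier Z))"
    by simp
  fix P assume "P \<in> extensional (carrier Z) \<and> is_sha_operator K \<Omega> F \<kappa> B \<omega> P"
  then have P: "P \<in> extensional (carrier Z)" "is_sha_operator K \<Omega> F \<kappa> B \<omega> P" by auto
  show "P = restrict (op \<omega>) (carrier Z)"
    by (rule extensionalityI[OF P(1) conjunct1[OF *] sha_operators_agree[OF P(2) conjunct2[OF *]]])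
qed

abbreviation "sop \<equiv> sha_operator K \<Omega> F \<kappa> B"

lemma sop_apply: "\<omega> \<in> \<Omega> \<Longrightarrow> x \<in> carrier Z \<Longrightarrow> sop \<omega> x = op \<omega> x"
  by (simp add: sha_operator_eq)

lemma sop_linear: "\<omega> \<in> \<Omega> \<Longrightarrow> sop \<omega> \<in> linear_maps K Z Z"
  by (rule linear_cong[OF op_linear _ Z.tensor_module]) (simp_all add: sop_apply)

subsection \<open>\<open>Sha\<close> as a relative matching Rota-Baxter algebra\<close>

lemma Z_matching_RBA: "comm_matching_RBA K \<Omega> Z sop"
proof (intro comm_matching_RBA.intro comm_matching_RBA_axioms.intro Z.tensor_algebra sop_linear)
  fix \<alpha> \<beta> x y assume *: "\<alpha> \<in> \<Omega>" "\<beta> \<in> \<Omega>" "x \<in> carrier Z" "y \<in> carrier Z"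
  then show "sop \<alpha> x \<diamondop> sop \<beta> y = sop \<alpha> (x \<diamondop> sop \<beta> y) \<oplus>\<^sub>Z sop \<beta> (sop \<alpha> x \<diamondop> y)"
    using RB_all[OF *] linear_closed[OF op_linear[OF *(1)]] linear_closed[OF op_linear[OF *(2)]]
    by (simp add: sop_apply)
qed

abbreviation "all_Z_pures \<equiv> (\<lambda>(u, p). pz u p) ` (carrier FA \<times> carrier S)"

lemma all_Z_pures_span: "submodule_span K Z all_Z_pures = carrier Z"
  by (intro Z.pure_tensors_span carrier_spans FA.tensor_module sh.Sh_module)

abbreviation "one_word \<equiv> sh.word []"

lemma one_word_mult: "p \<in> carrier S \<Longrightarrow> one_word \<star> p = p" "p \<in> carrier S \<Longrightarrow> p \<star> one_word = p"
  by (simp_all add: sh.Sh_one[symmetric])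

lemma one_word_closed: "one_word \<in> carrier S"
  by (simp add: sh.word_closed)

lemma Z_one: "\<one>\<^bsub>Z\<^esub> = pz \<one>\<^bsub>FA\<^esub> one_word"
  by (simp add: Z.tensor_one sh.Sh_one)

lemma Z_factor: "u \<in> carrier FA \<Longrightarrow> p \<in> carrier S \<Longrightarrow> pz u one_word \<diamondop> pz \<one>\<^bsub>FA\<^esub> p = pz u p"
  by (simp add: Z.tensor_mult_pure one_word_closed one_word_mult)

lemma base_algebra_hom: "(\<lambda>u. pz u one_word) \<in> algebra_homs K FA Z"
  unfolding algebra_homs_def
  by (intro IntI pz_left one_word_closed ring_hom_memI)
    (auto simp: Z.pure_tensor_closed one_word_closed Z.tensor_mult_pure one_word_mult Z_one
      linear_add[OF pz_left])

lemma algebra_homs_comp: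
  "h \<in> algebra_homs K M N \<Longrightarrow> k \<in> algebra_homs K N Q \<Longrightarrow> (\<lambda>x. k (h x)) \<in> algebra_homs K M Q"
  unfolding algebra_homs_def by (auto intro: linear_comp simp: ring_hom_def Pi_iff)

lemma sha_i_eq: "sha_i K \<Omega> F B c = pz (E c) one_word"
  by (simp add: sha_i_def sha_pure_eq F_embed_def)

lemma sha_j_eq: "sha_j K \<Omega> F B a = pz (FA.pure \<one>\<^bsub>F\<^esub> a) one_word"
  by (simp add: sha_j_def sha_pure_eq)

lemma sha_i_hom: "sha_i K \<Omega> F B \<in> matching_RBA_homs K \<Omega> F \<kappa> Z sop"
proof -
  have "E \<in> algebra_homs K F FA"
    unfolding algebra_homs_def
    by (intro IntI E_linear ring_hom_memI)
      (auto simp: linear_closed[OF E_linear] E_mult E_one linear_add[OF E_linear])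
  from algebra_homs_comp[OF this base_algebra_hom] have "sha_i K \<Omega> F B \<in> algebra_homs K F Z"
    by (simp add: sha_i_eq[abs_def])
  moreover have "sha_i K \<Omega> F B (\<kappa> \<omega> c) = sop \<omega> (sha_i K \<Omega> F B c)" if "\<omega> \<in> \<Omega>" "c \<in> carrier F" for \<omega> c
    using op_is_sha_operator[OF that(1)] that linear_closed[OF E_linear that(2)]
    by (simp add: is_sha_operator_def sha_i_eq sha_pure_eq sop_apply Z.pure_tensor_closed one_word_closed)
  ultimately show ?thesis by (simp add: matching_RBA_homs_def)
qed

lemma Z_rel_matching_RBA: "comm_rel_matching_RBA K \<Omega> F \<kappa> Z sop (sha_i K \<Omega> F B)"
  by (intro comm_rel_matching_RBA.intro comm_rel_matching_RBA_axioms.intro Z_matching_RBA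
      sha_i_hom F.comm_matching_RBA_axioms)

lemma sha_j_hom: "sha_j K \<Omega> F B \<in> algebra_homs K A Z"
proof -
  have lin: "FA.pure \<one>\<^bsub>F\<^esub> \<in> linear_maps K A FA"
    by (rule bilinear_right[OF FA.pure_tensor_bilinear F.one_closed])
  have "FA.pure \<one>\<^bsub>F\<^esub> \<in> algebra_homs K A FA"
    unfolding algebra_homs_def
    by (intro IntI lin ring_hom_memI)
      (auto simp: FA.tensor_mult_pure FA.tensor_one linear_closed[OF lin] A.m_closed linear_add[OF lin]
        simp del: unitization_simps)
  from algebra_homs_comp[OF this base_algebra_hom] show ?thesis
    by (simp add: sha_j_eq[abs_def])
qed

text \<open>The algebra is generated by the images of \<open>F\<close> and \<open>A\<close> under products and the operators: the
  former give all of \<open>F \<otimes> A\<close>, and a word \<open>(\<omega> \<otimes> u) q\<close> is the image of \<open>u \<otimes> q\<close> under \<open>P\<^sub>\<omega>\<close>.\<close>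

lemma homs_agree:
  assumes R: "module K R"
    and h: "h \<in> rel_matching_RBA_homs K \<Omega> F Z sop (sha_i K \<Omega> F B) R P \<iota>"
    and k: "k \<in> rel_matching_RBA_homs K \<Omega> F Z sop (sha_i K \<Omega> F B) R P \<iota>"
    and j: "\<And>a. a \<in> carrier A \<Longrightarrow> h (sha_j K \<Omega> F B a) = k (sha_j K \<Omega> F B a)"
    and x: "x \<in> carrier Z"
  shows "h x = k x"
proof -
  have lin: "h \<in> linear_maps K Z R" "k \<in> linear_maps K Z R"
    and mult: "\<And>x y. x \<in> carrier Z \<Longrightarrow> y \<in> carrier Z \<Longrightarrow> h (x \<diamondop> y) = h x \<otimes>\<^bsub>R\<^esub> h y"
      "\<And>x y. x \<in> carrier Z \<Longrightarrow> y \<in> carrier Z \<Longrightarrow> k (x \<diamondop> y) = k x \<otimes>\<^bsub>R\<^esub> k y"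
    and op: "\<And>\<omega> x. \<omega> \<in> \<Omega> \<Longrightarrow> x \<in> carrier Z \<Longrightarrow> h (op \<omega> x) = P \<omega> (h x)"
      "\<And>\<omega> x. \<omega> \<in> \<Omega> \<Longrightarrow> x \<in> carrier Z \<Longrightarrow> k (op \<omega> x) = P \<omega> (k x)"
    and i: "\<And>c. c \<in> carrier F \<Longrightarrow> h (sha_i K \<Omega> F B c) = k (sha_i K \<Omega> F B c)"
    using h k by (auto simp: rel_matching_RBA_homs_def matching_RBA_homs_def algebra_homs_def ring_hom_def sop_apply)
  interpret ZR: two_modules K Z R by (intro two_modules.intro Z.tensor_module R)
  have base: "h (pz u one_word) = k (pz u one_word)" if u: "u \<in> carrier FA" for u
  proof (rule linear_eq_on_span[OF FA.tensor_module R FA_pures_span _ _ _ u])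
    show "(\<lambda>u. h (pz u one_word)) \<in> linear_maps K FA R" "(\<lambda>u. k (pz u one_word)) \<in> linear_maps K FA R"
      by (intro linear_comp[OF pz_left] lin one_word_closed)+
    fix u assume "u \<in> FA_pures"
    then obtain c a where u: "u = FA.pure c a" "c \<in> carrier F" "a \<in> carrier A"
      by (auto simp del: unitization_simps)
    have cl: "sha_i K \<Omega> F B c \<in> carrier Z" "sha_j K \<Omega> F B a \<in> carrier Z"
      using sha_i_hom sha_j_hom u by (auto simp: matching_RBA_homs_def algebra_homs_def ring_hom_def)
    have "E c \<otimes>\<^bsub>FA\<^esub> FA.pure \<one>\<^bsub>F\<^esub> a = u"
      using u by (simp add: F_embed_def FA.tensor_mult_pure del: unitization_simps)
    then have "pz u one_word = sha_i K \<Omega> F B c \<diamondop> sha_j K \<Omega> F B a"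
      using u linear_closed[OF E_linear u(2)] FA.pure_tensor_closed[OF F.one_closed u(3)]
      by (simp add: sha_i_eq sha_j_eq Z.tensor_mult_pure one_word_closed one_word_mult)
    then show "h (pz u one_word) = k (pz u one_word)"
      using cl mult i j u by simp
  qed
  have fibre: "h (pz \<one>\<^bsub>FA\<^esub> p) = k (pz \<one>\<^bsub>FA\<^esub> p)" if p: "p \<in> carrier S" for p
  proof -
    interpret SR: two_modules K S R by (intro two_modules.intro sh.Sh_module R)
    let ?H = "{p \<in> carrier S. h (pz \<one>\<^bsub>FA\<^esub> p) = k (pz \<one>\<^bsub>FA\<^esub> p)}"
    have "p \<in> ?H"
    proof (rule sh.Sh_generated[OF _ _ _ letters_span p])
      show "submodule ?H K S"
        by (intro SR.equalizer_submodule linear_comp[OF pz_right] lin FA.one_closed)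
      show "one_word \<in> ?H" using base[OF FA.one_closed] one_word_closed by simp
      fix v q assume "v \<in> letter_pures" and q: "q \<in> ?H"
      then obtain \<omega> u where v: "v = letter \<omega> u" "\<omega> \<in> \<Omega>" "u \<in> carrier FB" by auto
      have eu: "e u \<in> carrier FA" by (rule linear_closed[OF e_linear v(3)])
      have Zcl: "pz (e u) one_word \<in> carrier Z" "pz \<one>\<^bsub>FA\<^esub> q \<in> carrier Z" "pz (e u) q \<in> carrier Z"
        using eu q by (auto intro: Z.pure_tensor_closed one_word_closed)
      have "h (pz (e u) q) = k (pz (e u) q)"
        using Z_factor[OF eu, of q, symmetric] q Zcl mult base[OF eu] by simp
      then have "h (pz \<one>\<^bsub>FA\<^esub> (sh.cons v q)) = k (pz \<one>\<^bsub>FA\<^esub> (sh.cons v q))"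
        using op_e[OF v(2,3), of q, symmetric] q op v Zcl by simp
      then show "sh.cons v q \<in> ?H"
        using q v sh.cons_closed[OF letter_closed] by simp
    qed
    then show ?thesis by simp
  qed
  show ?thesis
  proof (rule linear_eq_on_span[OF Z.tensor_module R all_Z_pures_span lin _ x])
    fix z assume "z \<in> all_Z_pures"
    then obtain u p where z: "z = pz u p" "u \<in> carrier FA" "p \<in> carrier S" by auto
    then show "h z = k z"
      using Z_factor[OF z(2,3), symmetric] mult base fibre
      by (simp add: Z.pure_tensor_closed one_word_closed)
  qed
qed

end

section \<open>The universal property\<close>

locale sha_target = sha_construction K \<Omega> F \<kappa> B + R: comm_rel_matching_RBA K \<Omega> F \<kappa> R P \<iota>
  for K :: "'k ring" and \<Omega> :: "'w set" and F :: "('k, 'f) module" and \<kappa> :: "'w \<Rightarrow> 'f \<Rightarrow> 'f"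
    and B :: "('k, 'b) module" and R :: "('k, 'r) module" and P \<iota> +
  fixes f :: "'k \<times> 'b \<Rightarrow> 'r"
  assumes f: "f \<in> algebra_homs K A R"
begin

lemma R_algebra: "algebra K R" by (rule R.R.algebra_axioms)

lemma R_module: "module K R" by (rule R.R.module_axioms)

lemma \<iota>_linear: "\<iota> \<in> linear_maps K F R"
  and \<iota>_mult: "c \<in> carrier F \<Longrightarrow> d \<in> carrier F \<Longrightarrow> \<iota> (c \<otimes>\<^bsub>F\<^esub> d) = \<iota> c \<otimes>\<^bsub>R\<^esub> \<iota> d"
  and \<iota>_one: "\<iota> \<one>\<^bsub>F\<^esub> = \<one>\<^bsub>R\<^esub>"
  and \<iota>_\<kappa>: "\<omega> \<in> \<Omega> \<Longrightarrow> c \<in> carrier F \<Longrightarrow> \<iota> (\<kappa> \<omega> c) = P \<omega> (\<iota> c)"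
  using R.structure_map by (auto simp: matching_RBA_homs_def algebra_homs_def ring_hom_def)

lemma f_linear: "f \<in> linear_maps K A R"
  and f_mult: "a \<in> carrier A \<Longrightarrow> b \<in> carrier A \<Longrightarrow> f (a \<otimes>\<^bsub>A\<^esub> b) = f a \<otimes>\<^bsub>R\<^esub> f b"
  and f_one: "f \<one>\<^bsub>A\<^esub> = \<one>\<^bsub>R\<^esub>"
  using f by (simp_all add: algebra_homs_def ring_hom_mult ring_hom_one del: unitization_simps)

abbreviation R_times (infixl "\<bullet>" 70) where "x \<bullet> y \<equiv> x \<otimes>\<^bsub>R\<^esub> y"

lemmas R_mult = mult_bilinear[OF R_algebra]
lemmas \<iota>_closed = linear_closed[OF \<iota>_linear]
lemmas f_closed = linear_closed[OF f_linear]

definition \<phi> :: "('f \<times> 'k \<times> 'b \<Rightarrow> 'k) set \<Rightarrow> 'r" where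
  "\<phi> = tensor_lift K R (\<lambda>c a. \<iota> c \<bullet> f a)"

lemma \<phi>_bilinear: "(\<lambda>c a. \<iota> c \<bullet> f a) \<in> bilinear_maps K F A R"
  by (intro bilinear_mapsI linear_comp[OF f_linear bilinear_right[OF R_mult]] \<iota>_closed f_closed
      linear_comp[OF \<iota>_linear bilinear_left[OF R_mult]])

lemmas \<phi>_linear = FA.tensor_lift_linear[OF R_module \<phi>_bilinear, folded \<phi>_def]
lemmas \<phi>_pure = FA.tensor_lift_pure[OF R_module \<phi>_bilinear, folded \<phi>_def]
lemmas \<phi>_closed = linear_closed[OF \<phi>_linear]

lemma \<phi>_E: "c \<in> carrier F \<Longrightarrow> \<phi> (E c) = \<iota> c"
  using \<phi>_pure[OF _ A.one_closed] \<iota>_closed by (simp add: F_embed_def f_one del: unitization_simps)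

lemma \<phi>_j: "a \<in> carrier A \<Longrightarrow> \<phi> (FA.pure \<one>\<^bsub>F\<^esub> a) = f a"
  using f_closed by (simp add: \<phi>_pure \<iota>_one del: unitization_simps)

lemma \<phi>_one: "\<phi> \<one>\<^bsub>FA\<^esub> = \<one>\<^bsub>R\<^esub>"
  using \<phi>_E[OF F.one_closed] by (simp add: E_one \<iota>_one)

lemma \<phi>_mult:
  assumes u: "u \<in> carrier FA" and v: "v \<in> carrier FA"
  shows "\<phi> (u \<otimes>\<^bsub>FA\<^esub> v) = \<phi> u \<bullet> \<phi> v"
proof (rule bilinear_eq_on_span[OF FA.tensor_module FA.tensor_module R_module FA_pures_span FA_pures_span _ _ _ u v])
  show "(\<lambda>u v. \<phi> (u \<otimes>\<^bsub>FA\<^esub> v)) \<in> bilinear_maps K FA FA R"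
    by (intro bilinear_mapsI linear_comp[OF bilinear_right[OF FA.tensor_mult_bilinear] \<phi>_linear]
      linear_comp[OF bilinear_left[OF FA.tensor_mult_bilinear] \<phi>_linear])
  show "(\<lambda>u v. \<phi> u \<bullet> \<phi> v) \<in> bilinear_maps K FA FA R"
    by (intro bilinear_mapsI linear_comp[OF \<phi>_linear bilinear_right[OF R_mult]] \<phi>_closed
      linear_comp[OF \<phi>_linear bilinear_left[OF R_mult]])
  fix s t assume "s \<in> FA_pures" "t \<in> FA_pures"
  then obtain c a d b where *: "s = FA.pure c a" "c \<in> carrier F" "a \<in> carrier A" "t = FA.pure d b" "d \<in> carrier F" "b \<in> carrier A"
    by (auto simp del: unitization_simps)
  have cl: "\<iota> c \<in> carrier R" "\<iota> d \<in> carrier R" "f a \<in> carrier R" "f b \<in> carrier R"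
    using * by (simp_all add: \<iota>_closed f_closed del: unitization_simps)
  have "\<phi> (s \<otimes>\<^bsub>FA\<^esub> t) = (\<iota> c \<bullet> \<iota> d) \<bullet> (f a \<bullet> f b)"
    using * by (simp add: FA.tensor_mult_pure \<phi>_pure \<iota>_mult f_mult del: unitization_simps)
  also have "\<dots> = (\<iota> c \<bullet> f a) \<bullet> (\<iota> d \<bullet> f b)"
    using cl by (simp add: R.R.m_ac)
  finally show "\<phi> (s \<otimes>\<^bsub>FA\<^esub> t) = \<phi> s \<bullet> \<phi> t"
    using * by (simp add: \<phi>_pure del: unitization_simps)
qed

text \<open>The integral operator of a letter: \<open>J (\<omega> \<otimes> u) r = P\<^sub>\<omega>(\<phi>(u) r)\<close>.\<close>

definition J :: "('k, 'w, 'f, 'b) letter \<Rightarrow> 'r \<Rightarrow> 'r" where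
  "J v r = tensor_lift K R (\<lambda>p u. lin_ext K R (\<lambda>\<omega>. P \<omega> (\<phi> (e u) \<bullet> r)) p) v"

lemma P_linear: "\<omega> \<in> \<Omega> \<Longrightarrow> P \<omega> \<in> linear_maps K R R"
  by (rule R.R.P_linear)

lemma \<phi>e_closed: "u \<in> carrier FB \<Longrightarrow> \<phi> (e u) \<in> carrier R"
  by (rule linear_closed[OF linear_comp[OF e_linear \<phi>_linear]])

lemma J_form_bilinear:
  assumes r: "r \<in> carrier R"
  shows "(\<lambda>p u. lin_ext K R (\<lambda>\<omega>. P \<omega> (\<phi> (e u) \<bullet> r)) p) \<in> bilinear_maps K k\<Omega> FB R"
proof (rule bilinear_swap, rule bilinear_from_span[OF FB_module free_module_module R_module basis_spans_free_module])
  interpret RR: module_over K R by (rule module_over.intro[OF R_module])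
  have cl: "P \<omega> (\<phi> (e u) \<bullet> r) \<in> carrier R" if "\<omega> \<in> \<Omega>" "u \<in> carrier FB" for \<omega> u
    using that r \<phi>e_closed linear_closed[OF P_linear] by simp
  show "lin_ext K R (\<lambda>\<omega>. P \<omega> (\<phi> (e u) \<bullet> r)) \<in> linear_maps K k\<Omega> R" if "u \<in> carrier FB" for u
    by (rule RR.lin_ext_linear) (rule cl[OF _ that])
  fix b assume "b \<in> basis_elt K ` \<Omega>"
  then obtain \<omega> where \<omega>: "b = basis_elt K \<omega>" "\<omega> \<in> \<Omega>" by blast
  have "(\<lambda>u. P \<omega> (\<phi> (e u) \<bullet> r)) \<in> linear_maps K FB R"
    by (intro linear_comp[OF linear_comp[OF linear_comp[OF e_linear \<phi>_linear] bilinear_left[OF R_mult]] P_linear] r \<omega>)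
  then show "(\<lambda>u. lin_ext K R (\<lambda>\<omega>. P \<omega> (\<phi> (e u) \<bullet> r)) b) \<in> linear_maps K FB R"
    by (rule linear_cong) (simp_all add: \<omega> FB_module RR.lin_ext_basis cl)
qed

lemma J_letter:
  assumes "\<omega> \<in> \<Omega>" "u \<in> carrier FB" "r \<in> carrier R"
  shows "J (letter \<omega> u) r = P \<omega> (\<phi> (e u) \<bullet> r)"
proof -
  interpret RR: module_over K R by (rule module_over.intro[OF R_module])
  show ?thesis
    using assms \<phi>e_closed linear_closed[OF P_linear[OF assms(1)]]
    by (simp add: J_def LV.tensor_lift_pure[OF R_module J_form_bilinear] basis_elt_closed RR.lin_ext_basis)
qed

lemma J_bilinear: "J \<in> bilinear_maps K V R R"
proof (rule bilinear_swap, rule bilinear_from_span[OF R_module V_module R_module letters_span])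
  show "(\<lambda>v. J v r) \<in> linear_maps K V R" if "r \<in> carrier R" for r
    unfolding J_def by (rule LV.tensor_lift_linear[OF R_module J_form_bilinear[OF that]])
  fix v assume "v \<in> letter_pures"
  then obtain \<omega> u where v: "v = letter \<omega> u" "\<omega> \<in> \<Omega>" "u \<in> carrier FB" by auto
  have "(\<lambda>r. P \<omega> (\<phi> (e u) \<bullet> r)) \<in> linear_maps K R R"
    by (intro linear_comp[OF bilinear_right[OF R_mult] P_linear] \<phi>e_closed v)
  then show "J v \<in> linear_maps K R R"
    by (rule linear_cong) (simp_all add: v J_letter R_module)
qed

lemmas J_closed = bilinear_closed[OF J_bilinear]

text \<open>The Rota-Baxter identity of \<open>R\<close> at \<open>\<phi>(u) x\<close> and \<open>\<phi>(u') y\<close>.\<close>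

lemma J_Rota_Baxter:
  assumes v: "v \<in> carrier V" and w: "w \<in> carrier V" and x: "x \<in> carrier R" and y: "y \<in> carrier R"
  shows "J v x \<bullet> J w y = J v (x \<bullet> J w y) \<oplus>\<^bsub>R\<^esub> J w (J v x \<bullet> y)"
proof (rule bilinear_eq_on_span[OF V_module V_module R_module letters_span letters_span _ _ _ v w])
  interpret VR: two_modules K V R by (intro two_modules.intro V_module R_module)
  note l = bilinear_left[OF R_mult] and r = bilinear_right[OF R_mult]
  note Jl = bilinear_left[OF J_bilinear] and Jr = bilinear_right[OF J_bilinear]
  note cl = J_closed x y R.R.m_closed
  show "(\<lambda>v w. J v x \<bullet> J w y) \<in> bilinear_maps K V V R"
    by (intro bilinear_mapsI linear_comp[OF Jl l] linear_comp[OF Jl r] cl)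
  show "(\<lambda>v w. J v (x \<bullet> J w y) \<oplus>\<^bsub>R\<^esub> J w (J v x \<bullet> y)) \<in> bilinear_maps K V V R"
    by (intro bilinear_mapsI VR.linear_sum linear_comp[OF linear_comp[OF Jl r] Jr]
      linear_comp[OF linear_comp[OF Jl l] Jr] Jl cl)
  fix s t assume "s \<in> letter_pures" "t \<in> letter_pures"
  then obtain \<alpha> u \<beta> u' where *: "s = letter \<alpha> u" "\<alpha> \<in> \<Omega>" "u \<in> carrier FB"
    "t = letter \<beta> u'" "\<beta> \<in> \<Omega>" "u' \<in> carrier FB" by auto
  note pc = \<phi>e_closed[OF *(3)] \<phi>e_closed[OF *(6)] linear_closed[OF P_linear[OF *(2)]] linear_closed[OF P_linear[OF *(5)]]
  have "P \<beta> (P \<alpha> (\<phi> (e u) \<bullet> x) \<bullet> (\<phi> (e u') \<bullet> y)) = P \<beta> (\<phi> (e u') \<bullet> (P \<alpha> (\<phi> (e u) \<bullet> x) \<bullet> y))"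
    using pc x y by (simp add: R.R.m_lcomm)
  moreover have "P \<alpha> (\<phi> (e u) \<bullet> x \<bullet> P \<beta> (\<phi> (e u') \<bullet> y)) = P \<alpha> (\<phi> (e u) \<bullet> (x \<bullet> P \<beta> (\<phi> (e u') \<bullet> y)))"
    using pc x y by (simp add: R.R.m_assoc)
  ultimately show "J s x \<bullet> J t y = J s (x \<bullet> J t y) \<oplus>\<^bsub>R\<^esub> J t (J s x \<bullet> y)"
    using * pc x y R.R.Rota_Baxter[OF *(2,5), of "\<phi> (e u) \<bullet> x" "\<phi> (e u') \<bullet> y"]
    by (simp add: J_letter)
qed

text \<open>The Rota-Baxter identity of \<open>R\<close> at \<open>\<iota>(c)\<close> and \<open>\<phi>(u) y\<close>. It explains the correction term in
  the definition of the operators of \<open>Sha\<close>, which compatibility with \<open>P\<^sub>\<omega>\<close> forces.\<close>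

lemma J_letter_act:
  assumes \<omega>: "\<omega> \<in> \<Omega>" and c: "c \<in> carrier F" and v: "v \<in> carrier V" and y: "y \<in> carrier R"
  shows "\<iota> (\<kappa> \<omega> c) \<bullet> J v y = P \<omega> (\<iota> c \<bullet> J v y) \<oplus>\<^bsub>R\<^esub> J (letter_act (\<kappa> \<omega> c) v) y"
proof (rule linear_eq_on_span[OF V_module R_module letters_span _ _ _ v])
  interpret VR: two_modules K V R by (intro two_modules.intro V_module R_module)
  have k: "\<kappa> \<omega> c \<in> carrier F" using linear_closed[OF \<kappa>_linear[OF \<omega>] c] .
  note Jl = bilinear_left[OF J_bilinear y]
  show "(\<lambda>v. \<iota> (\<kappa> \<omega> c) \<bullet> J v y) \<in> linear_maps K V R"
    by (intro linear_comp[OF Jl bilinear_right[OF R_mult]] \<iota>_closed k)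
  show "(\<lambda>v. P \<omega> (\<iota> c \<bullet> J v y) \<oplus>\<^bsub>R\<^esub> J (letter_act (\<kappa> \<omega> c) v) y) \<in> linear_maps K V R"
    by (intro VR.linear_sum linear_comp[OF letter_act_linear[OF k] Jl]
      linear_comp[OF linear_comp[OF Jl bilinear_right[OF R_mult]] P_linear] \<iota>_closed c \<omega>)
  fix v assume "v \<in> letter_pures"
  then obtain \<beta> u where v: "v = letter \<beta> u" "\<beta> \<in> \<Omega>" "u \<in> carrier FB" by auto
  have "\<phi> (e (act (\<kappa> \<omega> c) u)) = \<iota> (\<kappa> \<omega> c) \<bullet> \<phi> (e u)"
    using \<phi>_mult[OF linear_closed[OF E_linear k] linear_closed[OF e_linear v(3)]] k v by (simp add: E_mult_e \<phi>_E)
  then show "\<iota> (\<kappa> \<omega> c) \<bullet> J v y = P \<omega> (\<iota> c \<bullet> J v y) \<oplus>\<^bsub>R\<^esub> J (letter_act (\<kappa> \<omega> c) v) y"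
    using v y c k \<omega> \<phi>e_closed[OF v(3)] R.R.Rota_Baxter[OF \<omega> v(2) \<iota>_closed[OF c], of "\<phi> (e u) \<bullet> y"]
      linear_closed[OF act_linear[OF k] v(3)] \<iota>_closed[OF k]
    by (simp add: J_letter letter_act_letter \<iota>_\<kappa>[symmetric] R.R.m_assoc)
qed

abbreviation "\<Theta> \<equiv> sh.word_fold R J \<one>\<^bsub>R\<^esub>"

lemmas \<Theta>_linear = sh.word_fold_linear[OF R_module J_bilinear R.R.one_closed]
lemmas \<Theta>_closed = linear_closed[OF \<Theta>_linear]
lemmas \<Theta>_cons = sh.word_fold_cons[OF R_module J_bilinear R.R.one_closed]

lemma \<Theta>_one: "\<Theta> one_word = \<one>\<^bsub>R\<^esub>"
  by (simp add: sh.word_fold_word[OF R_module J_bilinear R.R.one_closed])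

lemma \<Theta>_mult: "p \<in> carrier S \<Longrightarrow> q \<in> carrier S \<Longrightarrow> \<Theta> (p \<star> q) = \<Theta> p \<bullet> \<Theta> q"
  by (rule sh.word_fold_mult[OF R_algebra J_bilinear J_Rota_Baxter])

definition ext :: "('k, 'w, 'f, 'b) sha \<Rightarrow> 'r" where
  "ext = tensor_lift K R (\<lambda>u p. \<phi> u \<bullet> \<Theta> p)"

lemma ext_form_bilinear: "(\<lambda>u p. \<phi> u \<bullet> \<Theta> p) \<in> bilinear_maps K FA S R"
  by (intro bilinear_mapsI linear_comp[OF \<Theta>_linear bilinear_right[OF R_mult]] \<phi>_closed \<Theta>_closed
      linear_comp[OF \<phi>_linear bilinear_left[OF R_mult]])

lemmas ext_linear = Z.tensor_lift_linear[OF R_module ext_form_bilinear, folded ext_def]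
lemmas ext_pz = Z.tensor_lift_pure[OF R_module ext_form_bilinear, folded ext_def]
lemmas ext_closed = linear_closed[OF ext_linear]

lemma ext_mult:
  assumes x: "x \<in> carrier Z" and y: "y \<in> carrier Z"
  shows "ext (x \<diamondop> y) = ext x \<bullet> ext y"
proof (rule bilinear_eq_on_span[OF Z.tensor_module Z.tensor_module R_module all_Z_pures_span all_Z_pures_span _ _ _ x y])
  show "(\<lambda>u v. ext (u \<diamondop> v)) \<in> bilinear_maps K Z Z R"
    by (intro bilinear_mapsI linear_comp[OF bilinear_right[OF Z.tensor_mult_bilinear] ext_linear]
      linear_comp[OF bilinear_left[OF Z.tensor_mult_bilinear] ext_linear])
  show "(\<lambda>u v. ext u \<bullet> ext v) \<in> bilinear_maps K Z Z R"
    by (intro bilinear_mapsI linear_comp[OF ext_linear bilinear_right[OF R_mult]] ext_closed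
      linear_comp[OF ext_linear bilinear_left[OF R_mult]])
  fix s t assume "s \<in> all_Z_pures" "t \<in> all_Z_pures"
  then obtain u p v q where *: "s = pz u p" "u \<in> carrier FA" "p \<in> carrier S" "t = pz v q" "v \<in> carrier FA" "q \<in> carrier S"
    by (auto simp del: unitization_simps)
  have "ext (s \<diamondop> t) = (\<phi> u \<bullet> \<phi> v) \<bullet> (\<Theta> p \<bullet> \<Theta> q)"
    using * by (simp add: Z.tensor_mult_pure ext_pz \<phi>_mult \<Theta>_mult)
  also have "\<dots> = (\<phi> u \<bullet> \<Theta> p) \<bullet> (\<phi> v \<bullet> \<Theta> q)"
    using * by (simp add: R.R.m_ac \<phi>_closed \<Theta>_closed)
  finally show "ext (s \<diamondop> t) = ext s \<bullet> ext t"
    using * by (simp add: ext_pz)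
qed

text \<open>On the empty word this is compatibility of \<open>\<iota>\<close> with the operators.\<close>

lemma ext_op_E:
  assumes \<omega>: "\<omega> \<in> \<Omega>" and c: "c \<in> carrier F" and p: "p \<in> carrier S"
  shows "\<iota> (\<kappa> \<omega> c) \<bullet> \<Theta> p = P \<omega> (\<iota> c \<bullet> \<Theta> p) \<oplus>\<^bsub>R\<^esub> \<Theta> (D (\<kappa> \<omega> c) p)"
proof (rule sh.linear_eq_on_Sh[OF R_module _ _ _ _ p])
  interpret SR: two_modules K S R by (intro two_modules.intro sh.Sh_module R_module)
  have k: "\<kappa> \<omega> c \<in> carrier F" using linear_closed[OF \<kappa>_linear[OF \<omega>] c] .
  show "(\<lambda>p. \<iota> (\<kappa> \<omega> c) \<bullet> \<Theta> p) \<in> linear_maps K S R"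
    by (intro linear_comp[OF \<Theta>_linear bilinear_right[OF R_mult]] \<iota>_closed k)
  show "(\<lambda>p. P \<omega> (\<iota> c \<bullet> \<Theta> p) \<oplus>\<^bsub>R\<^esub> \<Theta> (D (\<kappa> \<omega> c) p)) \<in> linear_maps K S R"
    by (intro SR.linear_sum linear_comp[OF D_linear[OF k] \<Theta>_linear]
      linear_comp[OF linear_comp[OF \<Theta>_linear bilinear_right[OF R_mult]] P_linear] \<iota>_closed c \<omega>)
  have "\<Theta> \<zero>\<^bsub>S\<^esub> = \<zero>\<^bsub>R\<^esub>" by (rule SR.linear_zero[OF \<Theta>_linear])
  then show "\<iota> (\<kappa> \<omega> c) \<bullet> \<Theta> one_word = P \<omega> (\<iota> c \<bullet> \<Theta> one_word) \<oplus>\<^bsub>R\<^esub> \<Theta> (D (\<kappa> \<omega> c) one_word)"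
    using \<iota>_closed[OF c] \<iota>_closed[OF k]
    by (simp add: \<Theta>_one sh.letter_map_Nil[OF letter_act_linear[OF k]] \<iota>_\<kappa>[OF \<omega> c, symmetric])
  show "\<iota> (\<kappa> \<omega> c) \<bullet> \<Theta> (sh.cons v q) = P \<omega> (\<iota> c \<bullet> \<Theta> (sh.cons v q)) \<oplus>\<^bsub>R\<^esub> \<Theta> (D (\<kappa> \<omega> c) (sh.cons v q))"
    if "v \<in> carrier V" "q \<in> carrier S" for v q
    using that J_letter_act[OF \<omega> c that(1) \<Theta>_closed[OF that(2)]] linear_closed[OF letter_act_linear[OF k] that(1)]
    by (simp add: \<Theta>_cons sh.letter_map_cons[OF letter_act_linear[OF k]])
qed

lemma ext_op:
  assumes \<omega>: "\<omega> \<in> \<Omega>" and x: "x \<in> carrier Z"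
  shows "ext (op \<omega> x) = P \<omega> (ext x)"
proof (rule linear_eq_on_span[OF Z.tensor_module R_module Z_span linear_comp[OF op_linear[OF \<omega>] ext_linear]
      linear_comp[OF ext_linear P_linear[OF \<omega>]] _ x])
  interpret ZR: two_modules K Z R by (intro two_modules.intro Z.tensor_module R_module)
  fix z assume "z \<in> Z_pures"
  then consider (E) c p where "z = pz (E c) p" "c \<in> carrier F" "p \<in> carrier S"
    | (e) u p where "z = pz (e u) p" "u \<in> carrier FB" "p \<in> carrier S" by auto
  then show "ext (op \<omega> z) = P \<omega> (ext z)"
  proof cases
    case E
    define k where "k = \<kappa> \<omega> c"
    have k: "k \<in> carrier F" unfolding k_def by (rule linear_closed[OF \<kappa>_linear[OF \<omega>] E(2)])
    have cl: "E c \<in> carrier FA" "E k \<in> carrier FA" "D k p \<in> carrier S"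
      using E k linear_closed[OF E_linear] linear_closed[OF D_linear] by auto
    have "ext (op \<omega> z) = \<iota> k \<bullet> \<Theta> p \<ominus>\<^bsub>R\<^esub> \<Theta> (D k p)"
      unfolding E(1) op_E[OF \<omega> E(2,3)] k_def[symmetric]
      using cl E k by (simp add: ZR.linear_diff[OF ext_linear] Z.pure_tensor_closed ext_pz \<phi>_E \<phi>_one \<Theta>_closed)
    also have "\<dots> = P \<omega> (\<iota> c \<bullet> \<Theta> p)"
      using ext_op_E[OF \<omega> E(2,3)] cl E linear_closed[OF P_linear[OF \<omega>]] \<iota>_closed
      by (simp add: k_def[symmetric] \<Theta>_closed R.R.minus_eq R.R.a_assoc R.R.r_neg)
    also have "\<dots> = P \<omega> (ext z)"
      using cl E by (simp add: ext_pz \<phi>_E)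
    finally show ?thesis .
  next
    case e
    have "e u \<in> carrier FA" by (rule linear_closed[OF e_linear e(2)])
    then show ?thesis
      using e \<phi>e_closed[OF e(2)] linear_closed[OF P_linear[OF \<omega>]] sh.cons_closed[OF letter_closed[OF \<omega>]]
      by (simp add: op_e \<omega> ext_pz \<phi>_one \<Theta>_cons letter_closed J_letter \<Theta>_closed)
  qed
qed

lemma ext_one: "ext \<one>\<^bsub>Z\<^esub> = \<one>\<^bsub>R\<^esub>"
  by (simp add: Z_one ext_pz one_word_closed \<phi>_one \<Theta>_one)

lemma ext_hom: "ext \<in> rel_matching_RBA_homs K \<Omega> F Z sop (sha_i K \<Omega> F B) R P \<iota>"
proof -
  have "ext \<in> ring_hom Z R"
    by (rule ring_hom_memI)
      (auto simp: ext_closed ext_mult linear_add[OF ext_linear] ext_one)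
  then show ?thesis
    using linear_closed[OF E_linear] \<iota>_closed
    by (auto simp: rel_matching_RBA_homs_def matching_RBA_homs_def algebra_homs_def ext_linear sop_apply ext_op
      sha_i_eq ext_pz one_word_closed \<phi>_E \<Theta>_one)
qed

lemma ext_j: "a \<in> carrier A \<Longrightarrow> ext (sha_j K \<Omega> F B a) = f a"
  using FA.pure_tensor_closed[OF F.one_closed] f_closed
  by (simp add: sha_j_eq ext_pz one_word_closed \<phi>_j \<Theta>_one del: unitization_simps)

lemma universal_property:
  "\<exists>!g. g \<in> extensional (carrier Z) \<and>
    g \<in> rel_matching_RBA_homs K \<Omega> F Z sop (sha_i K \<Omega> F B) R P \<iota> \<and>
    (\<forall>a\<in>carrier A. g (sha_j K \<Omega> F B a) = f a)"
proof (rule ex1I)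
  have "restrict ext (carrier Z) \<in> rel_matching_RBA_homs K \<Omega> F Z sop (sha_i K \<Omega> F B) R P \<iota>"
  proof -
    have "restrict ext (carrier Z) \<in> linear_maps K Z R"
      by (rule linear_cong[OF ext_linear _ Z.tensor_module]) simp
    moreover have "restrict ext (carrier Z) \<in> ring_hom Z R"
      by (rule ring_hom_memI)
        (auto simp: ext_closed ext_mult linear_add[OF ext_linear] ext_one)
    moreover have "sop \<omega> x \<in> carrier Z" if "\<omega> \<in> \<Omega>" "x \<in> carrier Z" for \<omega> x
      by (rule linear_closed[OF sop_linear[OF that(1)] that(2)])
    moreover have "sha_i K \<Omega> F B c \<in> carrier Z" if "c \<in> carrier F" for c
      using that by (simp add: sha_i_eq Z.pure_tensor_closed one_word_closed linear_closed[OF E_linear])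
    ultimately show ?thesis
      using ext_hom by (simp add: rel_matching_RBA_homs_def matching_RBA_homs_def algebra_homs_def)
  qed
  moreover have "restrict ext (carrier Z) (sha_j K \<Omega> F B a) = f a" if "a \<in> carrier A" for a
    using ext_j[OF that] sha_j_hom that by (auto simp: algebra_homs_def ring_hom_def simp del: unitization_simps)
  ultimately show g: "restrict ext (carrier Z) \<in> extensional (carrier Z) \<and>
    restrict ext (carrier Z) \<in> rel_matching_RBA_homs K \<Omega> F Z sop (sha_i K \<Omega> F B) R P \<iota> \<and>
    (\<forall>a\<in>carrier A. restrict ext (carrier Z) (sha_j K \<Omega> F B a) = f a)"
    by simp
  fix g assume g': "g \<in> extensional (carrier Z) \<and>
    g \<in> rel_matching_RBA_homs K \<Omega> F Z sop (sha_i K \<Omega> F B) R P \<iota> \<and>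
    (\<forall>a\<in>carrier A. g (sha_j K \<Omega> F B a) = f a)"
  show "g = restrict ext (carrier Z)"
  proof (rule extensionalityI[of _ "carrier Z"])
    show "g x = restrict ext (carrier Z) x" if "x \<in> carrier Z" for x
      by (rule homs_agree[OF R_module _ _ _ that, of g P \<iota>]) (use g g' in \<open>simp_all del: restrict_apply unitization_simps\<close>)
  qed (use g' in auto)
qed

end

theorem theorem3p3:
  fixes K :: "'k ring" and \<Omega> :: "'w set"
    and F :: "('k, 'f) module" and \<kappa> :: "'w \<Rightarrow> 'f \<Rightarrow> 'f"
    and B :: "('k, 'b) module"
  assumes "cring K"
    and "\<Omega> \<noteq> {}"
    and "comm_matching_RBA K \<Omega> F \<kappa>"
    and "nonunital_comm_algebra K B"
  shows "comm_rel_matching_RBA K \<Omega> F \<kappa> (Sha K \<Omega> F B) (sha_operator K \<Omega> F \<kappa> B) (sha_i K \<Omega> F B) \<and>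
    sha_j K \<Omega> F B \<in> algebra_homs K (unitization K B) (Sha K \<Omega> F B) \<and>
    (\<forall>(R :: ('k, 'r) module) P \<iota> f.
       comm_rel_matching_RBA K \<Omega> F \<kappa> R P \<iota> \<longrightarrow>
       f \<in> algebra_homs K (unitization K B) R \<longrightarrow>
       (\<exists>!g. g \<in> extensional (carrier (Sha K \<Omega> F B)) \<and>
          g \<in> rel_matching_RBA_homs K \<Omega> F (Sha K \<Omega> F B) (sha_operator K \<Omega> F \<kappa> B) (sha_i K \<Omega> F B) R P \<iota> \<and>
          (\<forall>a\<in>carrier (unitization K B). g (sha_j K \<Omega> F B a) = f a)))"
proof -
  interpret sha_construction K \<Omega> F \<kappa> B
    using assms(3,4) by (rule sha_construction.intro)
  show ?thesis
    unfolding constructions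
  proof (intro conjI allI impI Z_rel_matching_RBA sha_j_hom)
    fix R :: "('k, 'r) module" and P \<iota> f
    assume "comm_rel_matching_RBA K \<Omega> F \<kappa> R P \<iota>" "f \<in> algebra_homs K A R"
    then interpret sha_target K \<Omega> F \<kappa> B R P \<iota> f
      by (intro sha_target.intro sha_target_axioms.intro sha_construction_axioms)
    show "\<exists>!g. g \<in> extensional (carrier Z) \<and>
      g \<in> rel_matching_RBA_homs K \<Omega> F Z sop (sha_i K \<Omega> F B) R P \<iota> \<and>
      (\<forall>a\<in>carrier A. g (sha_j K \<Omega> F B a) = f a)"
      by (rule universal_property)
  qed
qed

end
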